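(* Let $n\ge 2$ and let $K\subset\mathbb{R}^{n+1}$ be a convex body with the origin in its interior, with $C^\infty$-smooth boundary of strictly positive curvature (i.e. $K\in\mathcal K_+^\infty$). Let $\kappa>0$ and assume $$\mathrm{Ric}^1_{g_{\partial K},f_{\partial K}}\ \ge\ (n-1)\,\kappa\,\mathrm{e}^{-\frac{4f_{\partial K}}{n-1}}\,g_{\partial K}$$ and that there exist $x,y\in\partial K$ such that $$d_{\widehat g_{\partial K}}(x,y)=\frac{\pi}{\sqrt\kappa}.$$ Then $K$ is a rotationally symmetric ellipsoid. In particular, for $e:=\mathfrak n(x)$ and every $\theta\in\mathbb{S}^*$, $$h_K(\theta)^2=h_K(e)^2\langle\theta,e\rangle^2+\kappa\,h_K(e)^{-2}\,|P_{e^\perp}\theta|^2 .$$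
   Context: $E=\mathbb{R}^{n+1}$ with its Euclidean inner product $\langle\cdot,\cdot\rangle$, and the dual $E^*$ is identified with $E$; $\mathbb{S}^*$ is the unit sphere in $E^*$, with standard Riemannian metric $g_{\mathbb{S}^*}$. $h_K(\theta):=\max_{z\in K}\langle\theta,z\rangle$ is the support function, regarded also as a function on $\mathbb{S}^*$. $\mathfrak n:\partial K\to\mathbb{S}^*$ is the Gauss map (outer unit normal), a diffeomorphism. For $e\in\mathbb S^*$, $e^\perp=\{z:\langle e,z\rangle=0\}$ and $P_{e^\perp}$ is the orthogonal projection onto $e^\perp$. Set $g_{\partial K}:=\mathfrak n^*g_{\mathbb{S}^*}$, $h_{\partial K}:=h_K\circ\mathfrak n$, $f_{\partial K}:=(n-1)\log h_{\partial K}$, $\widehat g_{\partial K}:=\mathrm{e}^{-\frac{4f_{\partial K}}{n-1}}g_{\partial K}$, and let $d_{\widehat g_{\partial K}}$ be the Riemannian distance of $\widehat g_{\partial K}$ on $\partial K$. For an $n$-dimensional Riemannian manifold $(M,g)$ and $f\in C^\infty(M)$: $\mathrm{Ric}^1_{g,f}:=\mathrm{Ric}_g+\mathrm{Hess}_g f+\frac{\mathrm{d}f\otimes \mathrm{d}f}{n-1}$. *)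

theory Defs
  imports "HOL-Analysis.Analysis"
begin

section \<open>Smooth maps\<close>

primrec Ck_on ::
  "nat \<Rightarrow> ('a::real_normed_vector \<Rightarrow> 'b::real_normed_vector) \<Rightarrow> 'a set \<Rightarrow> bool" where
  "Ck_on 0 f S \<longleftrightarrow> continuous_on S f"
| "Ck_on (Suc k) f S \<longleftrightarrow>
     (\<forall>x\<in>S. f differentiable (at x)) \<and>
     (\<forall>v. Ck_on k (\<lambda>x. frechet_derivative f (at x) v) S)"

text \<open>For open sets only, since the derivatives are the unrestricted ones.\<close>

definition smooth_on ::
  "('a::real_normed_vector \<Rightarrow> 'b::real_normed_vector) \<Rightarrow> 'a set \<Rightarrow> bool" where
  "smooth_on f S \<longleftrightarrow> (\<forall>k. Ck_on k f S)"


section \<open>Riemannian geometry in local coordinates\<close>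

text \<open>A Riemannian metric on an open set of \<open>real ^ 'n\<close> is given by its coefficient matrix
  \<open>G u\<close>, with entries \<open>G u $ i $ j\<close>.\<close>

definition partial ::
  "'n::finite \<Rightarrow> (real ^ 'n \<Rightarrow> 'b::real_normed_vector) \<Rightarrow> real ^ 'n \<Rightarrow> 'b" where
  "partial i F u = frechet_derivative F (at u) (axis i 1)"

text \<open>\<open>christoffel G k i j\<close> is the Christoffel symbol of the second kind with upper index \<open>k\<close>.\<close>

definition christoffel ::
  "(real ^ 'n::finite \<Rightarrow> real ^ 'n ^ 'n) \<Rightarrow> 'n \<Rightarrow> 'n \<Rightarrow> 'n \<Rightarrow> real ^ 'n \<Rightarrow> real" where
  "christoffel G k i j u =
     (\<Sum>l\<in>UNIV. matrix_inv (G u) $ k $ l *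
        (partial i (\<lambda>w. G w $ j $ l) u + partial j (\<lambda>w. G w $ i $ l) u
          - partial l (\<lambda>w. G w $ i $ j) u)) / 2"

text \<open>The sign is such that round spheres have positive Ricci curvature.\<close>

definition ricci ::
  "(real ^ 'n::finite \<Rightarrow> real ^ 'n ^ 'n) \<Rightarrow> real ^ 'n \<Rightarrow> real ^ 'n ^ 'n" where
  "ricci G u = (\<chi> i j.
     (\<Sum>k\<in>UNIV. partial k (christoffel G k i j) u - partial j (christoffel G k i k) u)
     + (\<Sum>k\<in>UNIV. \<Sum>l\<in>UNIV. christoffel G k k l u * christoffel G l i j u
          - christoffel G k j l u * christoffel G l i k u))"

definition hessian ::
  "(real ^ 'n::finite \<Rightarrow> real ^ 'n ^ 'n) \<Rightarrow> (real ^ 'n \<Rightarrow> real) \<Rightarrow> real ^ 'n \<Rightarrow> real ^ 'n ^ 'n" where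
  "hessian G f u = (\<chi> i j.
     partial i (partial j f) u - (\<Sum>k\<in>UNIV. christoffel G k i j u * partial k f u))"

definition ricci1 ::
  "(real ^ 'n::finite \<Rightarrow> real ^ 'n ^ 'n) \<Rightarrow> (real ^ 'n \<Rightarrow> real) \<Rightarrow> real ^ 'n \<Rightarrow> real ^ 'n ^ 'n" where
  "ricci1 G f u = ricci G u + hessian G f u
     + (\<chi> i j. partial i f u * partial j f u / (real CARD('n) - 1))"


section \<open>Riemannian geometry on a hypersurface\<close>

text \<open>A Riemannian metric on an embedded hypersurface \<open>M\<close> of a Euclidean space is a function \<open>g\<close>
  of a point \<open>p\<close> of \<open>M\<close> and two ambient vectors; only its values at vectors tangent to \<open>M\<close> at \<open>p\<close>
  matter.\<close>

definition local_parametrization ::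
  "'a::euclidean_space set \<Rightarrow> (real ^ 'n::finite) set \<Rightarrow> (real ^ 'n \<Rightarrow> 'a) \<Rightarrow> bool" where
  "local_parametrization M U \<phi> \<longleftrightarrow>
     open U \<and> smooth_on \<phi> U \<and> (\<forall>u\<in>U. inj (frechet_derivative \<phi> (at u))) \<and>
     openin (top_of_set M) (\<phi> ` U) \<and> (\<exists>\<psi>. homeomorphism U (\<phi> ` U) \<phi> \<psi>)"

definition metric_coeff ::
  "('a \<Rightarrow> 'a \<Rightarrow> 'a \<Rightarrow> real) \<Rightarrow> (real ^ 'n::finite \<Rightarrow> 'a::euclidean_space)
     \<Rightarrow> real ^ 'n \<Rightarrow> real ^ 'n ^ 'n" where
  "metric_coeff g \<phi> u = (\<chi> i j. g (\<phi> u) (partial i \<phi> u) (partial j \<phi> u))"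

definition speed ::
  "('a \<Rightarrow> 'a \<Rightarrow> 'a \<Rightarrow> real) \<Rightarrow> (real \<Rightarrow> 'a::euclidean_space) \<Rightarrow> real \<Rightarrow> real" where
  "speed g \<gamma> t =
     sqrt (g (\<gamma> t) (vector_derivative \<gamma> (at t)) (vector_derivative \<gamma> (at t)))"

text \<open>The curves allowed by \<open>piecewise_C1_differentiable_on\<close> may have unbounded velocity near the
  finitely many exceptional parameters. The integrability condition below discards exactly the
  curves of infinite length, to which \<open>integral\<close> would assign the length 0.\<close>

definition riem_dist ::
  "'a::euclidean_space set \<Rightarrow> ('a \<Rightarrow> 'a \<Rightarrow> 'a \<Rightarrow> real) \<Rightarrow> 'a \<Rightarrow> 'a \<Rightarrow> real" where
  "riem_dist M g x y =
     Inf {integral {0..1} (speed g \<gamma>) | \<gamma>.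
       \<gamma> piecewise_C1_differentiable_on {0..1} \<and> path_image \<gamma> \<subseteq> M \<and>
       pathstart \<gamma> = x \<and> pathfinish \<gamma> = y \<and> speed g \<gamma> integrable_on {0..1}}"


section \<open>Convex bodies\<close>

definition support_fun :: "'a::euclidean_space set \<Rightarrow> 'a \<Rightarrow> real" where
  "support_fun K \<theta> = (SUP z\<in>K. \<theta> \<bullet> z)"

definition gauss_map :: "'a::euclidean_space set \<Rightarrow> 'a \<Rightarrow> 'a" where
  "gauss_map K p = (THE \<nu>. norm \<nu> = 1 \<and> (\<forall>z\<in>K. \<nu> \<bullet> (z - p) \<le> 0))"

text \<open>The derivative within the boundary is determined only on vectors tangent to the boundary
  at \<open>p\<close>, where it is the differential of the Gauss map.\<close>

definition gauss_differential :: "'a::euclidean_space set \<Rightarrow> 'a \<Rightarrow> 'a \<Rightarrow> 'a" where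
  "gauss_differential K p = frechet_derivative (gauss_map K) (at p within frontier K)"

definition smooth_boundary :: "'a::euclidean_space set \<Rightarrow> bool" where
  "smooth_boundary K \<longleftrightarrow>
     (\<forall>p\<in>frontier K. \<exists>W \<rho>. open W \<and> p \<in> W \<and> smooth_on (\<rho> :: 'a \<Rightarrow> real) W \<and>
        (\<forall>z\<in>W. frechet_derivative \<rho> (at z) \<noteq> (\<lambda>v. 0)) \<and>
        K \<inter> W = {z \<in> W. \<rho> z \<le> 0})"

text \<open>The differential of the outer unit normal is the shape operator, so the condition says that
  the second fundamental form is positive definite, i.e. that all principal curvatures are
  positive.\<close>

definition positively_curved_boundary :: "'a::euclidean_space set \<Rightarrow> bool" where
  "positively_curved_boundary K \<longleftrightarrow>
     (\<forall>p\<in>frontier K. \<forall>v. v \<bullet> gauss_map K p = 0 \<and> v \<noteq> 0 \<longrightarrow> gauss_differential K p v \<bullet> v > 0)"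

text \<open>The class \<open>\<K>\<^sub>+\<^sup>\<infinity>\<close>, with the origin in the interior of the bodies.\<close>

definition smooth_convex_body :: "'a::euclidean_space set \<Rightarrow> bool" where
  "smooth_convex_body K \<longleftrightarrow>
     compact K \<and> convex K \<and> 0 \<in> interior K \<and> smooth_boundary K \<and> positively_curved_boundary K"

text \<open>The pull-back under the Gauss map of the metric of the unit sphere, which is the restriction
  of the Euclidean inner product.\<close>

definition bd_metric :: "'a::euclidean_space set \<Rightarrow> 'a \<Rightarrow> 'a \<Rightarrow> 'a \<Rightarrow> real" where
  "bd_metric K p v w = gauss_differential K p v \<bullet> gauss_differential K p w"

definition bd_support :: "'a::euclidean_space set \<Rightarrow> 'a \<Rightarrow> real" where
  "bd_support K p = support_fun K (gauss_map K p)"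

definition bd_weight :: "nat \<Rightarrow> 'a::euclidean_space set \<Rightarrow> 'a \<Rightarrow> real" where
  "bd_weight n K p = (real n - 1) * ln (bd_support K p)"

definition bd_conformal_metric :: "nat \<Rightarrow> 'a::euclidean_space set \<Rightarrow> 'a \<Rightarrow> 'a \<Rightarrow> 'a \<Rightarrow> real" where
  "bd_conformal_metric n K p v w = exp (- 4 * bd_weight n K p / (real n - 1)) * bd_metric K p v w"


section \<open>Ellipsoids\<close>

definition ellipsoid :: "'a::euclidean_space set \<Rightarrow> bool" where
  "ellipsoid K \<longleftrightarrow> (\<exists>c (L :: 'a \<Rightarrow> 'a). linear L \<and> bij L \<and> K = (\<lambda>z. c + L z) ` cball 0 1)"

text \<open>The axis is the line through \<open>c\<close> in direction \<open>e\<close>; invariance is required under all linear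
  isometries fixing the axis pointwise, orientation-reversing ones included.\<close>

definition rotationally_symmetric :: "'a::euclidean_space set \<Rightarrow> bool" where
  "rotationally_symmetric K \<longleftrightarrow>
     (\<exists>c e. norm e = 1 \<and>
        (\<forall>R. orthogonal_transformation R \<and> R e = e \<longrightarrow> (\<lambda>z. c + R (z - c)) ` K = K))"

text \<open>For a unit vector \<open>e\<close>, the orthogonal projection onto the hyperplane orthogonal to \<open>e\<close>.\<close>

definition proj_perp :: "'a::euclidean_space \<Rightarrow> 'a \<Rightarrow> 'a" where
  "proj_perp e \<theta> = \<theta> - (\<theta> \<bullet> e) *\<^sub>R e"

end

theory Submission
  imports Defs
begin

text \<open>Under the Gauss map the curvature assumption becomes \<open>Hess h + h g \<ge> \<kappa> h\<^sup>-\<^sup>3 g\<close> on the round sphere,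
  because the gradient terms of \<open>Hess f\<close> and \<open>df \<otimes> df / (n - 1)\<close> cancel; along a great circle it reads
  \<open>h'' + h \<ge> \<kappa> / h\<^sup>3\<close>, and the conformal length is \<open>\<integral> h\<^sup>-\<^sup>2\<close>. Sturm comparison shows that half a great
  circle has conformal length at most \<open>\<pi> / \<surd>\<kappa>\<close>, with equality only for solutions of the
  Ermakov--Pinney equation. Hence points at maximal distance have antipodal normals, equality holds
  along all meridians between them, and integrating the equation gives
  \<open>h(\<theta>)\<^sup>2 = \<langle>\<theta>, x\<rangle>\<^sup>2 + \<kappa> h(e)\<^sup>-\<^sup>2 |P \<theta>|\<^sup>2\<close>. Finally the inequality along great circles transversal to the
  meridians, near \<open>e\<close>, forces \<open>x\<close> to be a multiple of \<open>e\<close>.\<close>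

section \<open>Smooth maps and their inverses\<close>

text \<open>Let F be the inverse of the Gauss map, so that h(\<theta>) = \<theta> \<bullet>
  F(\<theta>). As \<theta> is normal to the boundary at F(\<theta>), the differential of F drops out
  of dh, and Hess h + h g is the quadratic form taking w to w \<bullet> dF(w). The weighted Ricci
  tensor is (n - 1) / h times this form, and exp(-4 f / (n - 1)) is 1 / h^4; hence the power h^3.
  Only first derivatives of F enter the estimates, but F has to be shown smooth, and it lives on the
  sphere whereas the derivatives in use are those of maps on open sets; local extensions of F bridge
  this gap. The curvature assumption is evaluated, at each point, at the centre of one stereographic
  chart, where the Christoffel symbols vanish. Of the distance, only the bound by the length of an
  explicit curve enters. Equality along the meridians cannot detect a component of x orthogonal to
  e: it appears as the initial slope h'(0), which the one-dimensional equation leaves free. This is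
  why a second family of great circles is required.\<close>

lemma frechet_derivative_cong_open:
  assumes "open S" "x \<in> S" "\<And>y. y \<in> S \<Longrightarrow> f y = g y"
  shows "frechet_derivative f (at x) = frechet_derivative g (at x)"
proof -
  \<comment> \<open>\<open>frechet_derivative\<close> chooses from the set of all derivatives;
    equality of these sets also covers points where neither function is differentiable.\<close>
  have "(f has_derivative D) (at x) \<longleftrightarrow> (g has_derivative D) (at x)" for D
    using assms has_derivative_transform_within_open[of f D x UNIV S g]
      has_derivative_transform_within_open[of g D x UNIV S f] by fastforce
  then show ?thesis
    unfolding frechet_derivative_def by presburger
qed

lemma Ck_on_cong:
  assumes "open S" "\<And>y. y \<in> S \<Longrightarrow> f y = g y"
  shows "Ck_on k f S \<longleftrightarrow> Ck_on k g S"
  using assms(2)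
proof (induction k arbitrary: f g)
  case 0
  then show ?case by (simp cong: continuous_on_cong)
next
  case (Suc k)
  have "frechet_derivative f (at y) = frechet_derivative g (at y)" if "y \<in> S" for y
    using assms(1) that Suc.prems by (rule frechet_derivative_cong_open)
  then have "Ck_on k (\<lambda>x. frechet_derivative f (at x) v) S \<longleftrightarrow>
      Ck_on k (\<lambda>x. frechet_derivative g (at x) v) S" for v
    by (intro Suc.IH) simp
  moreover have "f differentiable (at y) \<longleftrightarrow> g differentiable (at y)" if "y \<in> S" for y
    using assms(1) that Suc.prems has_derivative_transform_within_open[of f _ y UNIV S g]
      has_derivative_transform_within_open[of g _ y UNIV S f]
    unfolding differentiable_def by fastforce
  ultimately show ?case by simp
qed

text \<open>The closure properties under algebraic operations and composition are inductions that
  supply an explicit derivative \<open>f'\<close>; this rule lets such a formula stand in for the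
  chosen \<open>frechet_derivative\<close>.\<close>

lemma Ck_on_SucI:
  assumes "open S" "\<And>x. x \<in> S \<Longrightarrow> (f has_derivative f' x) (at x)"
    and "\<And>v. Ck_on k (\<lambda>x. f' x v) S"
  shows "Ck_on (Suc k) f S"
proof -
  have "frechet_derivative f (at x) = f' x" if "x \<in> S" for x
    using assms(2) that frechet_derivative_at by metis
  then have "Ck_on k (\<lambda>x. frechet_derivative f (at x) v) S" for v
    using assms(3)[of v] Ck_on_cong[OF assms(1), of "\<lambda>x. frechet_derivative f (at x) v"] by simp
  then show ?thesis
    using assms(2) by (auto simp: differentiable_def)
qed

lemma Ck_on_has_derivative:
  assumes "Ck_on (Suc k) f S" "x \<in> S"
  shows "(f has_derivative frechet_derivative f (at x)) (at x)"
  using assms by (simp add: frechet_derivative_works)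

lemma Ck_on_imp_continuous_on: "Ck_on k f S \<Longrightarrow> continuous_on S f"
  by (cases k) (auto intro!: differentiable_imp_continuous_on differentiable_at_imp_differentiable_on)

lemma Ck_on_SucD: "Ck_on (Suc k) f S \<Longrightarrow> Ck_on k f S"
proof (induction k arbitrary: f)
  case 0
  then show ?case using Ck_on_imp_continuous_on[OF "0.prems"] by simp
next
  case (Suc k)
  then show ?case by (metis Ck_on.simps(2))
qed

lemma Ck_on_subset: "Ck_on k f S \<Longrightarrow> T \<subseteq> S \<Longrightarrow> Ck_on k f T"
  by (induction k arbitrary: f) (auto intro: continuous_on_subset)

lemma Ck_on_const: "Ck_on k (\<lambda>x. c) S"
  by (induction k arbitrary: c) (auto intro: continuous_on_const)

lemma Ck_on_bounded_linear: "bounded_linear f \<Longrightarrow> open S \<Longrightarrow> Ck_on k f S"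
proof (cases k)
  case 0
  assume "bounded_linear f"
  then show ?thesis using 0 by (auto intro: linear_continuous_on)
next
  case (Suc m)
  assume "bounded_linear f" "open S"
  then show ?thesis unfolding Suc
    by (intro Ck_on_SucI[where f' = "\<lambda>_. f"] Ck_on_const)
       (auto intro: bounded_linear_imp_has_derivative)
qed

lemma Ck_on_add:
  assumes "open S"
  shows "Ck_on k f S \<Longrightarrow> Ck_on k g S \<Longrightarrow> Ck_on k (\<lambda>x. f x + g x) S"
proof (induction k arbitrary: f g)
  case 0
  then show ?case by (auto intro: continuous_on_add)
next
  case (Suc k)
  show ?case
    by (rule Ck_on_SucI[OF assms
          has_derivative_add[OF Ck_on_has_derivative[OF Suc.prems(1)] Ck_on_has_derivative[OF Suc.prems(2)]]])
       (use Suc in auto)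
qed

lemma (in bounded_bilinear) Ck_on:
  assumes "open S"
  shows "Ck_on k f S \<Longrightarrow> Ck_on k g S \<Longrightarrow> Ck_on k (\<lambda>x. prod (f x) (g x)) S"
proof (induction k arbitrary: f g)
  case 0
  then show ?case by (auto intro: continuous_on)
next
  case (Suc k)
  show ?case
    by (rule Ck_on_SucI[OF assms
          FDERIV[OF Ck_on_has_derivative[OF Suc.prems(1)] Ck_on_has_derivative[OF Suc.prems(2)]]])
       (use Suc Ck_on_SucD[OF Suc.prems(1)] Ck_on_SucD[OF Suc.prems(2)] in
         \<open>auto intro!: Ck_on_add[OF assms]\<close>)
qed

lemmas Ck_on_scaleR = bounded_bilinear.Ck_on[OF bounded_bilinear_scaleR]
lemmas Ck_on_inner = bounded_bilinear.Ck_on[OF bounded_bilinear_inner]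

lemma Ck_on_diff:
  assumes "open S" "Ck_on k f S" "Ck_on k g S"
  shows "Ck_on k (\<lambda>x. f x - g x) S"
  using Ck_on_add[OF assms(1,2) Ck_on_scaleR[OF assms(1) Ck_on_const[of k "-1"] assms(3)]] by simp

lemma Ck_on_ident: "open S \<Longrightarrow> Ck_on k (\<lambda>x. x) S"
  by (rule Ck_on_bounded_linear[OF bounded_linear_ident])

lemma Ck_on_sum:
  assumes "open S"
  shows "finite I \<Longrightarrow> (\<And>i. i \<in> I \<Longrightarrow> Ck_on k (f i) S) \<Longrightarrow> Ck_on k (\<lambda>x. \<Sum>i\<in>I. f i x) S"
  by (induction I rule: finite_induct) (auto intro: Ck_on_const Ck_on_add[OF assms])

text \<open>The exponent varies in the induction because differentiation lowers it by one. The cases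
  in use are -1, for a reciprocal, and -1/2, which normalises a gradient without differentiating a
  norm.\<close>

lemma Ck_on_powr:
  fixes f :: "'a::real_normed_vector \<Rightarrow> real"
  assumes "open S" "\<And>x. x \<in> S \<Longrightarrow> f x > 0"
  shows "Ck_on k f S \<Longrightarrow> Ck_on k (\<lambda>x. f x powr a) S"
proof (induction k arbitrary: a)
  case 0
  have "f x \<noteq> 0" if "x \<in> S" for x using assms(2)[OF that] by simp
  with 0 show ?case by (auto intro!: continuous_on_powr continuous_on_const)
next
  case (Suc k)
  have "((\<lambda>x. f x powr a) has_derivative
      (\<lambda>v. (a * f x powr (a - 1)) *\<^sub>R frechet_derivative f (at x) v)) (at x)" if "x \<in> S" for x
    using has_derivative_powr[OF Ck_on_has_derivative[OF Suc.prems that] has_derivative_const[of a] assms(2)[OF that]]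
      assms(2)[OF that]
    by (auto simp: powr_diff algebra_simps elim!: has_derivative_eq_rhs)
  then show ?case
  proof (rule Ck_on_SucI[OF assms(1)])
    have c1: "Ck_on k (\<lambda>x. a *\<^sub>R f x powr (a - 1)) S"
      by (intro Ck_on_scaleR assms(1) Ck_on_const Suc.IH Ck_on_SucD[OF Suc.prems])
    have c2: "Ck_on k (\<lambda>x. frechet_derivative f (at x) v) S" for v
      using Suc.prems by simp
    show "Ck_on k (\<lambda>x. (a * f x powr (a - 1)) *\<^sub>R frechet_derivative f (at x) v) S" for v
      using Ck_on_scaleR[OF assms(1) c1 c2] by simp
  qed
qed

lemma Ck_on_locally:
  assumes "\<And>x. x \<in> S \<Longrightarrow> \<exists>I. open I \<and> x \<in> I \<and> Ck_on k f I"
  shows "Ck_on k f S"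
  using assms
proof (induction k arbitrary: f)
  case 0
  have "isCont f x" if x: "x \<in> S" for x
  proof -
    obtain I where "open I" "x \<in> I" "continuous_on I f" using "0.prems"[OF x] by auto
    then show ?thesis using continuous_on_eq_continuous_at by blast
  qed
  then show ?case by (simp add: continuous_at_imp_continuous_on)
next
  case (Suc k)
  have "f differentiable (at x)" if "x \<in> S" for x
    using Suc.prems[OF that] by auto
  moreover have "Ck_on k (\<lambda>x. frechet_derivative f (at x) v) S" for v
  proof (rule Suc.IH)
    fix x assume "x \<in> S"
    then obtain I where "open I" "x \<in> I" "Ck_on (Suc k) f I" using Suc.prems by blast
    then show "\<exists>I. open I \<and> x \<in> I \<and> Ck_on k (\<lambda>x. frechet_derivative f (at x) v) I" by auto
  qed
  ultimately show ?case by simp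
qed

lemma linear_sum_Basis:
  fixes f :: "'a::euclidean_space \<Rightarrow> 'b::real_normed_vector"
  assumes "linear f"
  shows "f v = (\<Sum>b\<in>Basis. (v \<bullet> b) *\<^sub>R f b)"
  by (metis (mono_tags, lifting) assms euclidean_representation linear_scale linear_sum sum.cong)

text \<open>In the chain rule the vector fed to the derivative of \<open>f\<close> depends on the
  point, whereas \<open>Ck_on\<close> controls derivatives in fixed directions. Expanding that
  vector in \<open>Basis\<close> separates the two: the coefficients come from \<open>g\<close>, and
  the remaining directions are constant.\<close>

lemma Ck_on_compose:
  fixes f :: "'a::euclidean_space \<Rightarrow> 'b::real_normed_vector"
    and g :: "'c::real_normed_vector \<Rightarrow> 'a"
  assumes "open S" "open T" "g ` S \<subseteq> T"
  shows "Ck_on k f T \<Longrightarrow> Ck_on k g S \<Longrightarrow> Ck_on k (\<lambda>x. f (g x)) S"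
proof (induction k arbitrary: f)
  case 0
  then show ?case using assms(3) by (auto intro: continuous_on_compose2)
next
  case (Suc k)
  have "((\<lambda>x. f (g x)) has_derivative (\<lambda>v. \<Sum>b\<in>Basis. (frechet_derivative g (at x) v \<bullet> b) *\<^sub>R
      frechet_derivative f (at (g x)) b)) (at x)" if "x \<in> S" for x
  proof -
    have gx: "g x \<in> T" using assms(3) that by auto
    have "linear (frechet_derivative f (at (g x)))"
      using Ck_on_has_derivative[OF Suc.prems(1) gx] has_derivative_linear by blast
    note L = linear_sum_Basis[OF this]
    show ?thesis
      using diff_chain_at[OF Ck_on_has_derivative[OF Suc.prems(2) that] Ck_on_has_derivative[OF Suc.prems(1) gx]]
      unfolding o_def by (subst (asm) L)
  qed
  then show ?case
  proof (rule Ck_on_SucI[OF assms(1)])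
    have g: "Ck_on k g S" by (rule Ck_on_SucD[OF Suc.prems(2)])
    have Df: "Ck_on k (\<lambda>x. frechet_derivative f (at (g x)) b) S" for b
      using Suc.prems(1) by (intro Suc.IH g) simp
    have Dg: "Ck_on k (\<lambda>x. frechet_derivative g (at x) v) S" for v
      using Suc.prems(2) by simp
    show "Ck_on k (\<lambda>x. \<Sum>b\<in>Basis. (frechet_derivative g (at x) v \<bullet> b) *\<^sub>R
        frechet_derivative f (at (g x)) b) S" for v
      by (intro Ck_on_sum Ck_on_scaleR Ck_on_inner Ck_on_const Df Dg assms(1) finite_Basis)
  qed
qed

section \<open>Inverses of operators and the smooth inverse function theorem\<close>

text \<open>Where the first factor vanishes, continuity of the second suffices for the product rule,
  because the increment of \<open>g\<close> is multiplied by a quantity of first order. This breaks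
  the circle in differentiating an operator inverse, which is at first known to be continuous
  only.\<close>

lemma has_derivative_mult_continuous_at_zero:
  fixes f :: "'a::real_normed_vector \<Rightarrow> real" and g :: "'a \<Rightarrow> 'b::real_normed_vector"
  assumes f: "(f has_derivative f') (at x)" and "f x = 0" and g: "isCont g x"
  shows "((\<lambda>y. f y *\<^sub>R g y) has_derivative (\<lambda>v. f' v *\<^sub>R g x)) (at x)"
proof -
  have bl: "bounded_linear f'" using f has_derivative_bounded_linear by blast
  obtain K where K: "\<And>v. norm (f' v) \<le> norm v * K" "K > 0"
    using bounded_linear.pos_bounded[OF bl] by metis
  have 1: "((\<lambda>y. (norm (f y - f x - f' (y - x)) / norm (y - x)) * norm (g y)) \<longlongrightarrow> 0 * norm (g x)) (at x)"
    using f g unfolding has_derivative_iff_norm isCont_def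
    by (intro tendsto_mult tendsto_norm) auto
  have 2: "((\<lambda>y. K * norm (g y - g x)) \<longlongrightarrow> K * norm (g x - g x)) (at x)"
    using g unfolding isCont_def by (intro tendsto_intros)
  have 3: "((\<lambda>y. (norm (f y - f x - f' (y - x)) / norm (y - x)) * norm (g y) + K * norm (g y - g x)) \<longlongrightarrow> 0) (at x)"
    using tendsto_add[OF 1 2] by simp
  have "((\<lambda>y. norm (f y *\<^sub>R g y - f x *\<^sub>R g x - f' (y - x) *\<^sub>R g x) / norm (y - x)) \<longlongrightarrow> 0) (at x)"
  proof (rule Lim_null_comparison[OF _ 3], rule eventuallyI)
    fix y
    have "f y *\<^sub>R g y - f' (y - x) *\<^sub>R g x = (f y - f' (y - x)) *\<^sub>R g y + f' (y - x) *\<^sub>R (g y - g x)"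
      by (simp add: algebra_simps)
    then have "norm (f y *\<^sub>R g y - f' (y - x) *\<^sub>R g x) \<le>
        norm (f y - f' (y - x)) * norm (g y) + norm (f' (y - x)) * norm (g y - g x)"
      by (metis norm_triangle_ineq norm_scaleR real_norm_def)
    also have "\<dots> \<le> norm (f y - f' (y - x)) * norm (g y) + (norm (y - x) * K) * norm (g y - g x)"
      by (intro add_left_mono mult_right_mono K) auto
    finally have *: "norm (f y *\<^sub>R g y - f' (y - x) *\<^sub>R g x) \<le> \<dots>" .
    show "norm (norm (f y *\<^sub>R g y - f x *\<^sub>R g x - f' (y - x) *\<^sub>R g x) / norm (y - x))
       \<le> (norm (f y - f x - f' (y - x)) / norm (y - x)) * norm (g y) + K * norm (g y - g x)"
      using divide_right_mono[OF *, of "norm (y - x)"] K(2) \<open>f x = 0\<close>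
      by (cases "y = x") (auto simp: add_divide_distrib mult_ac)
  qed
  then show ?thesis
    unfolding has_derivative_iff_norm using bl by (auto intro: bounded_linear_scaleR_const)
qed

text \<open>Near \<open>y0\<close> the operators are small perturbations of \<open>A y0\<close>, so
  their inverses are uniformly bounded; then \<open>B y v - B y0 v = B y (v - A y (B y0 v))\<close>
  tends to zero.\<close>

lemma continuous_inverse_operator:
  fixes A B :: "'a::metric_space \<Rightarrow> 'b::euclidean_space \<Rightarrow> 'b"
  assumes lin: "\<And>y. y \<in> S \<Longrightarrow> linear (A y)" "linear (B y0)"
    and inv: "\<And>y v. y \<in> S \<Longrightarrow> B y (A y v) = v" "\<And>y v. y \<in> S \<Longrightarrow> A y (B y v) = v"
    and "y0 \<in> S" "open S"
    and cont: "\<And>v. isCont (\<lambda>y. A y v) y0"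
  shows "isCont (\<lambda>y. B y v) y0"
proof -
  obtain K where K: "\<And>v. norm (B y0 v) \<le> norm v * K" "K > 0"
    using bounded_linear.pos_bounded[of "B y0"] lin(2) linear_conv_bounded_linear by metis
  \<comment> \<open>Bounds the operator norm of \<open>A y - A y0\<close>, by expansion in
    \<open>Basis\<close>.\<close>
  define \<epsilon> where "\<epsilon> y = (\<Sum>b\<in>Basis. norm (A y b - A y0 b))" for y
  have "(\<epsilon> \<longlongrightarrow> (\<Sum>b\<in>Basis. norm (A y0 b - A y0 b))) (at y0)"
    unfolding \<epsilon>_def using cont unfolding isCont_def by (intro tendsto_intros)
  then have "eventually (\<lambda>y. \<epsilon> y < 1 / (2 * K)) (at y0)"
    using K(2) by (intro order_tendstoD(2)) auto
  moreover have "eventually (\<lambda>y. y \<in> S) (at y0)"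
    using assms by (intro eventually_at_in_open') auto
  ultimately have ev: "eventually (\<lambda>y. y \<in> S \<and> \<epsilon> y < 1 / (2 * K)) (at y0)"
    by eventually_elim auto
  \<comment> \<open>Since \<open>K\<close> bounds \<open>B y0\<close>, a perturbation below
    \<open>1 / (2 * K)\<close> costs at most half of \<open>norm ?u\<close>, which is absorbed on
    the left.\<close>
  have bound: "norm (B y w) \<le> 2 * K * norm w" if y: "y \<in> S" "\<epsilon> y < 1 / (2 * K)" for y w
  proof -
    let ?u = "B y w"
    have lin': "linear (\<lambda>w. A y w - A y0 w)"
      using lin(1) y(1) \<open>y0 \<in> S\<close> by (intro linear_compose_sub) auto
    have "norm (A y ?u - A y0 ?u) \<le> (\<Sum>b\<in>Basis. norm ((?u \<bullet> b) *\<^sub>R (A y b - A y0 b)))"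
      unfolding linear_sum_Basis[OF lin', of ?u] by (rule norm_sum)
    also have "\<dots> \<le> (\<Sum>b\<in>Basis. norm ?u * norm (A y b - A y0 b))"
      by (intro sum_mono) (auto intro!: mult_right_mono Basis_le_norm)
    also have "\<dots> = \<epsilon> y * norm ?u"
      unfolding \<epsilon>_def by (simp add: sum_distrib_left mult.commute)
    also have "\<dots> \<le> 1 / (2 * K) * norm ?u"
      using y by (intro mult_right_mono) auto
    finally have 1: "norm (A y ?u - A y0 ?u) \<le> 1 / (2 * K) * norm ?u" .
    have "norm ?u = norm (B y0 (A y0 ?u))" using inv(1) \<open>y0 \<in> S\<close> by simp
    also have "\<dots> \<le> norm (A y0 ?u) * K" by (rule K)
    also have "\<dots> \<le> (norm (A y ?u) + norm (A y ?u - A y0 ?u)) * K"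
      using K(2) norm_triangle_sub[of "A y0 ?u" "A y ?u"] by (intro mult_right_mono) (auto simp: norm_minus_commute)
    also have "\<dots> \<le> (norm w + 1 / (2 * K) * norm ?u) * K"
      using 1 inv(2)[OF y(1)] K(2) by (intro mult_right_mono) auto
    also have "\<dots> = norm w * K + norm ?u / 2" using K(2) by (simp add: field_simps)
    finally have "norm ?u \<le> norm w * K + norm ?u / 2" .
    then have "norm ?u \<le> 2 * (norm w * K)" by linarith
    then show ?thesis by (simp add: mult_ac)
  qed
  have "((\<lambda>y. 2 * K * norm (v - A y (B y0 v))) \<longlongrightarrow> 2 * K * norm (v - A y0 (B y0 v))) (at y0)"
    using cont unfolding isCont_def by (intro tendsto_intros)
  then have lim: "((\<lambda>y. 2 * K * norm (v - A y (B y0 v))) \<longlongrightarrow> 0) (at y0)"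
    using inv(2) \<open>y0 \<in> S\<close> by simp
  have "((\<lambda>y. B y v - B y0 v) \<longlongrightarrow> 0) (at y0)"
  proof (rule Lim_null_comparison[OF _ lim], rule eventually_mono[OF ev])
    fix y assume y: "y \<in> S \<and> \<epsilon> y < 1 / (2 * K)"
    have "linear (B y)"
    proof
      show "B y (a + b) = B y a + B y b" for a b
        using inv(1)[of y "B y a + B y b"] inv(2) y by (simp add: linear_add[OF lin(1)])
      show "B y (r *\<^sub>R a) = r *\<^sub>R B y a" for r a
        using inv(1)[of y "r *\<^sub>R B y a"] inv(2) y by (simp add: linear_scale[OF lin(1)])
    qed
    then have "B y v - B y0 v = B y (v - A y (B y0 v))"
      using inv(1) y by (simp add: linear_diff)
    then show "norm (B y v - B y0 v) \<le> 2 * K * norm (v - A y (B y0 v))"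
      using bound y by auto
  qed
  then show ?thesis unfolding isCont_def by (simp add: LIM_zero_iff)
qed

text \<open>Differentiating \<open>A y (B y v) = v\<close> suggests the derivative
  \<open>- B y (A' (B y v))\<close>, with \<open>A'\<close> the derivative of \<open>A\<close>. It
  contains only \<open>B\<close> and first derivatives of \<open>A\<close>, so each induction step
  gains one order.\<close>

lemma Ck_on_inverse_operator:
  fixes A B :: "'a::real_normed_vector \<Rightarrow> 'b::euclidean_space \<Rightarrow> 'b"
  assumes "open S"
    and lin: "\<And>y. y \<in> S \<Longrightarrow> linear (A y)" "\<And>y. y \<in> S \<Longrightarrow> linear (B y)"
    and inv: "\<And>y v. y \<in> S \<Longrightarrow> B y (A y v) = v" "\<And>y v. y \<in> S \<Longrightarrow> A y (B y v) = v"
  shows "(\<And>v. Ck_on k (\<lambda>y. A y v) S) \<Longrightarrow> Ck_on k (\<lambda>y. B y v) S"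
proof (induction k arbitrary: v)
  case 0
  show ?case
    using continuous_inverse_operator[of S A B] assms 0
    by (auto simp: continuous_on_eq_continuous_at)
next
  case (Suc k)
  have Ak: "Ck_on k (\<lambda>y. A y v) S" for v using Suc.prems Ck_on_SucD by blast
  note Bk = Suc.IH[OF Ak]
  have Bc: "isCont (\<lambda>y. B y v) y" if "y \<in> S" for v y
    using Ck_on_imp_continuous_on[OF Bk] that \<open>open S\<close> continuous_on_eq_continuous_at by blast
  define D where "D y w = - (\<Sum>c\<in>Basis. ((\<Sum>b\<in>Basis. (B y v \<bullet> b) *\<^sub>R
      frechet_derivative (\<lambda>y. A y b) (at y) w) \<bullet> c) *\<^sub>R B y c)" for y w
  show ?case
  proof (rule Ck_on_SucI[OF \<open>open S\<close>, where f' = D])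
    fix y assume y: "y \<in> S"
    let ?u = "B y v"
    have dA: "((\<lambda>z. A z b) has_derivative frechet_derivative (\<lambda>z. A z b) (at y)) (at y)" for b
      by (rule Ck_on_has_derivative[OF Suc.prems y])
    have d1: "((\<lambda>z. \<Sum>b\<in>Basis. (?u \<bullet> b) *\<^sub>R A z b) has_derivative
        (\<lambda>w. \<Sum>b\<in>Basis. (?u \<bullet> b) *\<^sub>R frechet_derivative (\<lambda>z. A z b) (at y) w)) (at y)"
      by (intro has_derivative_sum has_derivative_scaleR_right dA)
    have d2: "((\<lambda>z. A z ?u) has_derivative
        (\<lambda>w. \<Sum>b\<in>Basis. (?u \<bullet> b) *\<^sub>R frechet_derivative (\<lambda>z. A z b) (at y) w)) (at y)"
      by (rule has_derivative_transform_within_open[OF d1 \<open>open S\<close> y])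
         (simp add: linear_sum_Basis[OF lin(1), of _ ?u])
    have d3: "((\<lambda>z. (A z ?u - v) \<bullet> c) has_derivative
        (\<lambda>w. (\<Sum>b\<in>Basis. (?u \<bullet> b) *\<^sub>R frechet_derivative (\<lambda>z. A z b) (at y) w) \<bullet> c)) (at y)" for c
      using has_derivative_diff[OF d2 has_derivative_const[of v]]
      by (intro has_derivative_inner_left) simp
    \<comment> \<open>The identity behind this is \<open>B z v = ?u - B z (A z ?u - v)\<close> with
      \<open>?u = B y v\<close> frozen: the inner factor vanishes at \<open>z = y\<close>, so
      continuity of \<open>B\<close> is enough to differentiate.\<close>
    have d4: "((\<lambda>z. ((A z ?u - v) \<bullet> c) *\<^sub>R B z c) has_derivative
        (\<lambda>w. ((\<Sum>b\<in>Basis. (?u \<bullet> b) *\<^sub>R frechet_derivative (\<lambda>z. A z b) (at y) w) \<bullet> c) *\<^sub>R B y c)) (at y)" for c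
      by (intro has_derivative_mult_continuous_at_zero d3 Bc y) (simp add: inv(2) y)
    have d5: "((\<lambda>z. ?u - (\<Sum>c\<in>Basis. ((A z ?u - v) \<bullet> c) *\<^sub>R B z c)) has_derivative
        (\<lambda>w. 0 - (\<Sum>c\<in>Basis. ((\<Sum>b\<in>Basis. (?u \<bullet> b) *\<^sub>R frechet_derivative (\<lambda>z. A z b) (at y) w) \<bullet> c) *\<^sub>R B y c))) (at y)"
      by (intro has_derivative_sum has_derivative_diff has_derivative_const d4)
    show "((\<lambda>z. B z v) has_derivative D y) (at y)"
    proof (rule has_derivative_transform_within_open[of _ _ _ _ S])
      show "((\<lambda>z. ?u - (\<Sum>c\<in>Basis. ((A z ?u - v) \<bullet> c) *\<^sub>R B z c)) has_derivative D y) (at y)"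
        using d5 unfolding D_def by simp
      fix z assume z: "z \<in> S"
      show "?u - (\<Sum>c\<in>Basis. ((A z ?u - v) \<bullet> c) *\<^sub>R B z c) = B z v"
        unfolding linear_sum_Basis[OF lin(2)[OF z], symmetric]
        by (simp add: linear_diff[OF lin(2)[OF z]] inv z)
    qed (use \<open>open S\<close> y in auto)
  next
    fix w
    have dA: "Ck_on k (\<lambda>y. frechet_derivative (\<lambda>y. A y b) (at y) w) S" for b
      using Suc.prems by simp
    have "Ck_on k (\<lambda>y. (-1) *\<^sub>R (\<Sum>c\<in>Basis. ((\<Sum>b\<in>Basis. (B y v \<bullet> b) *\<^sub>R
      frechet_derivative (\<lambda>y. A y b) (at y) w) \<bullet> c) *\<^sub>R B y c)) S"
      by (intro Ck_on_scaleR Ck_on_sum Ck_on_inner Ck_on_const dA Bk \<open>open S\<close> finite_Basis)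
    then show "Ck_on k (\<lambda>y. D y w) S"
      unfolding D_def by simp
  qed
qed

text \<open>A bootstrap: the derivative of \<open>g\<close> is the operator inverse of the
  derivative of \<open>f\<close> at \<open>g y\<close>. If \<open>g\<close> is of class k, so is
  that operator, hence so is its inverse, and \<open>g\<close> is of class k + 1.\<close>

theorem smooth_inverse_function:
  fixes f :: "'a::euclidean_space \<Rightarrow> 'a"
  assumes "open W" "smooth_on f W" "p \<in> W" "inj (frechet_derivative f (at p))"
  obtains U V g where "open U" "U \<subseteq> W" "p \<in> U" "open V" "f p \<in> V" "homeomorphism U V f g"
    "smooth_on g V"
    "\<And>y v. y \<in> V \<Longrightarrow> frechet_derivative f (at (g y)) (frechet_derivative g (at y) v) = v"
proof -
  let ?D = "\<lambda>x. frechet_derivative f (at x)"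
  have Ck: "Ck_on k f W" for k using assms(2) unfolding smooth_on_def by blast
  have der: "(f has_derivative ?D x) (at x)" if "x \<in> W" for x
    by (rule Ck_on_has_derivative[OF Ck that])
  have bl: "bounded_linear (?D x)" if "x \<in> W" for x
    using der[OF that] has_derivative_bounded_linear by blast
  \<comment> \<open>The inverse function theorem asks for a derivative continuous in operator norm;
    in finite dimension this follows from continuity in each basis direction.\<close>
  define f' where "f' x = Blinfun (?D x)" for x
  have f': "blinfun_apply (f' x) = ?D x" if "x \<in> W" for x
    unfolding f'_def using bounded_linear_Blinfun_apply[OF bl[OF that]] .
  have CkD: "Ck_on k (\<lambda>x. ?D x v) W" for k v
    using Ck[of "Suc k"] by simp
  have "continuous_on W (\<lambda>x. blinfun_apply (f' x) b)" for b
    using Ck_on_imp_continuous_on[OF CkD[of 0 b]] by (simp add: f' cong: continuous_on_cong)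
  then have cont: "continuous_on W f'"
    by (rule continuous_on_blinfun_componentwise)
  obtain h where h: "linear h" "h \<circ> ?D p = id"
    using linear_injective_left_inverse[OF _ assms(4)] bl[OF assms(3)] bounded_linear.linear by blast
  have comp: "Blinfun h o\<^sub>L f' p = id_blinfun"
    using h f'[OF assms(3)]
    by (intro blinfun_eqI) (simp add: bounded_linear_Blinfun_apply linear_conv_bounded_linear o_def fun_eq_iff)
  have der': "(f has_derivative blinfun_apply (f' x)) (at x)" if "x \<in> W" for x
    using der[OF that] f'[OF that] by simp
  obtain U V g g' where UV: "open U" "U \<subseteq> W" "p \<in> U" "open V" "f p \<in> V" "homeomorphism U V f g"
    and g: "\<And>y. y \<in> V \<Longrightarrow> (g has_derivative (g' y)) (at y)"
    "\<And>y. y \<in> V \<Longrightarrow> g' y = inv (blinfun_apply (f'(g y)))"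
    "\<And>y. y \<in> V \<Longrightarrow> bij (blinfun_apply (f'(g y)))"
    by (rule inverse_function_theorem[OF assms(1) der' cont assms(3) comp]) blast+
  have gV: "g y \<in> W" if "y \<in> V" for y
    using UV that by (metis homeomorphism_image2 image_eqI subsetD)
  have inv: "?D (g y) (g' y v) = v" "g' y (?D (g y) v) = v" if "y \<in> V" for y v
    using g(3)[OF that] unfolding g(2)[OF that] f'[OF gV[OF that]]
    by (auto simp: bij_is_surj surj_f_inv_f bij_is_inj inv_f_f)
  have lin: "linear (?D (g y))" "linear (g' y)" if "y \<in> V" for y
    using bl[OF gV[OF that]] g(1)[OF that] bounded_linear.linear has_derivative_bounded_linear by blast+
  have Ckg: "Ck_on k g V" for k
  proof (induction k)
    case 0
    show ?case using UV(6) by (simp add: homeomorphism_def)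
  next
    case (Suc k)
    have "Ck_on k (\<lambda>y. ?D (g y) v) V" for v
      by (rule Ck_on_compose[OF UV(4) assms(1) _ CkD Suc]) (use gV in auto)
    then have "Ck_on k (\<lambda>y. g' y v) V" for v
      by (intro Ck_on_inverse_operator[of V "\<lambda>y. ?D (g y)" g'] UV(4) lin inv)
    then show ?case
      by (intro Ck_on_SucI[OF UV(4) g(1)])
  qed
  have "frechet_derivative g (at y) = g' y" if "y \<in> V" for y
    using g(1)[OF that] frechet_derivative_at by metis
  then have "frechet_derivative f (at (g y)) (frechet_derivative g (at y) v) = v" if "y \<in> V" for y v
    using inv(1) that by simp
  moreover have "smooth_on g V" using Ckg unfolding smooth_on_def by blast
  ultimately show ?thesis
    using that[OF UV] by blast
qed

section \<open>The Gauss map\<close>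

definition gradient :: "('a::euclidean_space \<Rightarrow> real) \<Rightarrow> 'a \<Rightarrow> 'a" where
  "gradient \<rho> z = (\<Sum>b\<in>Basis. frechet_derivative \<rho> (at z) b *\<^sub>R b)"

lemma gradient_inner:
  assumes "\<rho> differentiable (at z)"
  shows "gradient \<rho> z \<bullet> v = frechet_derivative \<rho> (at z) v"
proof -
  have "linear (frechet_derivative \<rho> (at z))"
    using assms linear_frechet_derivative by blast
  then show ?thesis
    unfolding gradient_def linear_sum_Basis[OF \<open>linear _\<close>, of v]
    by (simp add: inner_sum_right inner_commute mult.commute)
qed

lemma Ck_on_gradient: "open W \<Longrightarrow> Ck_on (Suc k) \<rho> W \<Longrightarrow> Ck_on k (gradient \<rho>) W"
  unfolding gradient_def by (intro Ck_on_sum Ck_on_scaleR Ck_on_const finite_Basis) auto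

lemma positive_derivative_increase:
  fixes f :: "'a::real_normed_vector \<Rightarrow> real"
  assumes f: "(f has_derivative D) (at z)" and "D v > 0" "open W" "z \<in> W"
  obtains d where "d > 0" "\<And>s. 0 < s \<Longrightarrow> s < d \<Longrightarrow> z + s *\<^sub>R v \<in> W \<and> f (z + s *\<^sub>R v) > f z"
proof -
  have "((\<lambda>s. z + s *\<^sub>R v) has_derivative (\<lambda>s. s *\<^sub>R v)) (at 0)"
    by (auto intro!: derivative_eq_intros)
  then have "((\<lambda>s. f (z + s *\<^sub>R v)) has_derivative (\<lambda>s. D (s *\<^sub>R v))) (at 0)"
    using diff_chain_at[of "\<lambda>s. z + s *\<^sub>R v" "\<lambda>s. s *\<^sub>R v" 0 f D] f by (simp add: o_def)
  then have "((\<lambda>s. f (z + s *\<^sub>R v)) has_real_derivative D v) (at 0)"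
    using has_derivative_linear[OF f]
    by (simp add: has_field_derivative_def linear_scale mult_commute_abs)
  from DERIV_pos_inc_right[OF this \<open>D v > 0\<close>]
  obtain d where d: "d > 0" "\<And>s. 0 < s \<Longrightarrow> s < d \<Longrightarrow> f (z + s *\<^sub>R v) > f z" by auto
  have "open ((\<lambda>s::real. z + s *\<^sub>R v) -` W)"
    by (intro open_vimage \<open>open W\<close> continuous_intros)
  moreover have "0 \<in> (\<lambda>s::real. z + s *\<^sub>R v) -` W" using \<open>z \<in> W\<close> by simp
  ultimately obtain e where "e > 0" "ball 0 e \<subseteq> (\<lambda>s::real. z + s *\<^sub>R v) -` W"
    by (meson openE)
  then have e: "e > 0" "\<And>s. \<bar>s\<bar> < e \<Longrightarrow> z + s *\<^sub>R v \<in> W" by (auto simp: subset_eq)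
  show ?thesis by (rule that[of "min d e"]) (use d e in auto)
qed

text \<open>For a hypersurface \<open>S\<close> the derivative within \<open>S\<close> is determined
  only on tangent vectors; on velocities of curves inside \<open>S\<close> it is pinned down by the
  composed curve.\<close>

lemma has_vector_derivative_compose_within:
  assumes f: "(f has_derivative D) (at (q t) within S)"
    and q: "(q has_vector_derivative v) (at t)" and I: "open I" "t \<in> I" "q ` I \<subseteq> S"
  shows "((\<lambda>s. f (q s)) has_vector_derivative D v) (at t)"
proof -
  have "(q has_derivative (\<lambda>s. s *\<^sub>R v)) (at t within I)"
    using q unfolding has_vector_derivative_def by (rule has_derivative_at_withinI)
  moreover have "(f has_derivative D) (at (q t) within q ` I)"
    using f I(3) by (rule has_derivative_subset)
  ultimately have "((\<lambda>s. f (q s)) has_derivative (\<lambda>s. D (s *\<^sub>R v))) (at t within I)"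
    using diff_chain_within[of q _ t I f D] by (simp add: o_def)
  then show ?thesis
    using has_derivative_linear[OF f] at_within_open[OF I(2,1)]
    by (simp add: has_vector_derivative_def linear_scale)
qed

lemma isCont_mem_open:
  fixes f :: "'a::metric_space \<Rightarrow> 'b::topological_space"
  assumes "isCont f x" "open S" "f x \<in> S"
  obtains I where "open I" "x \<in> I" "f ` I \<subseteq> S"
proof -
  obtain I where "open I" "x \<in> I" "\<forall>y\<in>I. f y \<in> S"
    using assms unfolding continuous_at_open by blast
  then show ?thesis using that[of I] by blast
qed

section \<open>Supporting hyperplanes, smooth extension and local inversion of the Gauss map\<close>

context
  fixes K :: "'a::euclidean_space set"
  assumes K: "smooth_convex_body K"
begin

lemma compact_K: "compact K" and convex_K: "convex K" and zero_interior: "0 \<in> interior K"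
  using K by (auto simp: smooth_convex_body_def)

lemma frontier_subset: "frontier K \<subseteq> K"
  using compact_K by (simp add: frontier_def compact_imp_closed)

lemma supporting_point_frontier:
  assumes "z \<in> K" "\<nu> \<noteq> 0" "\<And>y. y \<in> K \<Longrightarrow> \<nu> \<bullet> (y - z) \<le> 0"
  shows "z \<in> frontier K"
proof (rule ccontr)
  assume "z \<notin> frontier K"
  then have "z \<in> interior K"
    using assms(1) closure_subset by (auto simp: frontier_def)
  then obtain e where e: "e > 0" "cball z e \<subseteq> K" by (meson mem_interior_cball)
  have "z + (e / norm \<nu>) *\<^sub>R \<nu> \<in> K" using e assms(2) by (auto simp: dist_norm intro!: subsetD[OF e(2)])
  from assms(3)[OF this] have "(e / norm \<nu>) * (\<nu> \<bullet> \<nu>) \<le> 0" by simp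
  moreover have "(e / norm \<nu>) * (\<nu> \<bullet> \<nu>) > 0" using e(1) assms(2) by simp
  ultimately show False by linarith
qed

text \<open>A zero of \<open>\<rho>\<close> in the interior of \<open>K\<close> would be a local
  maximum of \<open>\<rho>\<close> with non-zero derivative, so the zero set is exactly the
  frontier. The neighbourhood is shrunk until \<open>\<bar>\<rho>\<bar> < 1\<close>, which later
  keeps \<open>1 + \<rho>\<close> positive.\<close>

lemma boundary_defining_function:
  assumes "p \<in> frontier K"
  obtains W \<rho> where "open W" "p \<in> W" "smooth_on \<rho> W" "\<And>z. z \<in> W \<Longrightarrow> gradient \<rho> z \<noteq> 0"
    "\<And>z. z \<in> W \<Longrightarrow> \<bar>\<rho> z\<bar> < 1" "\<And>z. z \<in> W \<Longrightarrow> z \<in> K \<longleftrightarrow> \<rho> z \<le> 0"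
    "\<And>z. z \<in> W \<Longrightarrow> z \<in> frontier K \<longleftrightarrow> \<rho> z = 0"
proof -
  obtain W0 and \<rho> :: "'a \<Rightarrow> real" where W0: "open W0" "p \<in> W0" "smooth_on \<rho> W0"
      "\<And>z. z \<in> W0 \<Longrightarrow> frechet_derivative \<rho> (at z) \<noteq> (\<lambda>v. 0)" "K \<inter> W0 = {z \<in> W0. \<rho> z \<le> 0}"
  proof -
    have "smooth_boundary K" using K by (simp add: smooth_convex_body_def)
    from this[unfolded smooth_boundary_def, THEN bspec, OF assms]
    show thesis using that by blast
  qed
  have Ck: "Ck_on k \<rho> W0" for k using W0(3) by (simp add: smooth_on_def)
  have der: "(\<rho> has_derivative frechet_derivative \<rho> (at z)) (at z)" if "z \<in> W0" for z
    by (rule Ck_on_has_derivative[OF Ck that])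
  have cont: "continuous_on W0 \<rho>" by (rule Ck_on_imp_continuous_on[OF Ck])
  have grad: "gradient \<rho> z \<noteq> 0" if "z \<in> W0" for z
  proof
    assume "gradient \<rho> z = 0"
    moreover have "\<rho> differentiable (at z)" using der[OF that] by (rule differentiableI)
    ultimately have "frechet_derivative \<rho> (at z) v = 0" for v
      using gradient_inner[of \<rho> z v] by simp
    then show False using W0(4)[OF that] by auto
  qed
  have inK: "z \<in> K \<longleftrightarrow> \<rho> z \<le> 0" if "z \<in> W0" for z using W0(5) that by blast
  have fr: "z \<in> frontier K \<longleftrightarrow> \<rho> z = 0" if z: "z \<in> W0" for z
  proof
    assume z': "z \<in> frontier K"
    then have "\<rho> z \<le> 0" using inK[OF z] frontier_subset by blast
    moreover have "\<not> \<rho> z < 0"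
    proof
      assume "\<rho> z < 0"
      then have "z \<in> W0 \<inter> \<rho> -` {..<0}" using z by simp
      moreover have "open (W0 \<inter> \<rho> -` {..<0})"
        by (rule continuous_open_preimage[OF cont W0(1)]) simp
      moreover have "W0 \<inter> \<rho> -` {..<0} \<subseteq> K" using inK by auto
      ultimately have "z \<in> interior K" by (meson interiorI)
      then show False using z' by (simp add: frontier_def)
    qed
    ultimately show "\<rho> z = 0" by simp
  next
    assume z0: "\<rho> z = 0"
    show "z \<in> frontier K"
    proof (rule ccontr)
      assume "z \<notin> frontier K"
      moreover have "z \<in> K" using inK z z0 by simp
      ultimately have "z \<in> interior K" using closure_subset by (auto simp: frontier_def)
      then have "z \<in> interior K \<inter> W0" using z by simp
      moreover have "open (interior K \<inter> W0)" using W0(1) by auto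
      moreover have "\<rho> y \<le> \<rho> z" if "y \<in> interior K \<inter> W0" for y
        using inK[of y] that z0 interior_subset by auto
      ultimately have "eventually (\<lambda>y. \<rho> y \<le> \<rho> z) (at z)"
        by (meson eventually_at_topological)
      then have "frechet_derivative \<rho> (at z) = (\<lambda>v. 0)"
        by (rule has_derivative_local_max[OF der[OF z]])
      then show False using W0(4)[OF z] by simp
    qed
  qed
  define W where "W = W0 \<inter> \<rho> -` {-1<..<1}"
  have "open W" unfolding W_def by (rule continuous_open_preimage[OF cont W0(1)]) simp
  moreover have "p \<in> W" unfolding W_def using W0(2) fr[OF W0(2)] assms by auto
  moreover have "smooth_on \<rho> W" unfolding smooth_on_def W_def using Ck Ck_on_subset by blast
  ultimately show ?thesis
    by (rule that[of W \<rho>]) (use grad inK fr in \<open>auto simp: W_def\<close>)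
qed

text \<open>If the gradient had positive product with \<open>y - z\<close>, the segment from
  \<open>z\<close> to \<open>y\<close> would start outside the convex set \<open>K\<close>.
  Conversely every direction with negative product enters \<open>K\<close>, which leaves room for
  only one unit supporting normal.\<close>

lemma gauss_map_eq_gradient:
  assumes z: "z \<in> frontier K" "z \<in> W" and W: "open W" "\<And>y. y \<in> W \<Longrightarrow> y \<in> K \<longleftrightarrow> \<rho> y \<le> 0"
    and \<rho>: "\<rho> differentiable (at z)" "gradient \<rho> z \<noteq> 0" "\<rho> z = 0"
  shows "gauss_map K z = gradient \<rho> z /\<^sub>R norm (gradient \<rho> z)"
    and "\<And>y. y \<in> K \<Longrightarrow> gauss_map K z \<bullet> (y - z) \<le> 0"
    and "\<And>\<nu>. norm \<nu> = 1 \<Longrightarrow> (\<And>y. y \<in> K \<Longrightarrow> \<nu> \<bullet> (y - z) \<le> 0) \<Longrightarrow> \<nu> = gauss_map K z"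
proof -
  define m where "m = gradient \<rho> z /\<^sub>R norm (gradient \<rho> z)"
  have m: "norm m = 1" "gradient \<rho> z = norm (gradient \<rho> z) *\<^sub>R m" using \<rho>(2) by (auto simp: m_def)
  have gp: "norm (gradient \<rho> z) > 0" using \<rho>(2) by simp
  have der: "(\<rho> has_derivative (\<lambda>v. gradient \<rho> z \<bullet> v)) (at z)"
    using \<rho>(1) gradient_inner[OF \<rho>(1)] by (simp add: frechet_derivative_works)
  have ex: "m \<bullet> (y - z) \<le> 0" if y: "y \<in> K" for y
  proof (rule ccontr)
    assume "\<not> m \<bullet> (y - z) \<le> 0"
    then have "gradient \<rho> z \<bullet> (y - z) > 0" using gp by (subst m(2)) simp
    from positive_derivative_increase[OF der this W(1) z(2)]
    obtain d where d: "d > 0"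
      "\<And>s. 0 < s \<Longrightarrow> s < d \<Longrightarrow> z + s *\<^sub>R (y - z) \<in> W \<and> \<rho> (z + s *\<^sub>R (y - z)) > \<rho> z" by blast
    define s where "s = min (d / 2) 1"
    have s: "0 < s" "s < d" "s \<le> 1" using d by (auto simp: s_def min_def)
    have "z + s *\<^sub>R (y - z) = (1 - s) *\<^sub>R z + s *\<^sub>R y" by (simp add: algebra_simps)
    then have "z + s *\<^sub>R (y - z) \<in> K"
      using convexD_alt[OF convex_K, of z y s] z(1) frontier_subset y s by auto
    then show False using d(2)[OF s(1,2)] W(2)[of "z + s *\<^sub>R (y - z)"] \<rho>(3) by simp
  qed
  have un: "\<nu> = m" if \<nu>: "norm \<nu> = 1" "\<And>y. y \<in> K \<Longrightarrow> \<nu> \<bullet> (y - z) \<le> 0" for \<nu>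
  proof -
    have neg: "\<nu> \<bullet> v \<le> 0" if "m \<bullet> v < 0" for v
    proof -
      have der': "((\<lambda>y. - \<rho> y) has_derivative (\<lambda>v. - (gradient \<rho> z \<bullet> v))) (at z)"
        by (intro has_derivative_minus der)
      have "- (gradient \<rho> z \<bullet> v) > 0" using that gp by (subst m(2)) (simp add: mult_pos_neg)
      from positive_derivative_increase[OF der' this W(1) z(2)]
      obtain d where d: "d > 0"
        "\<And>s. 0 < s \<Longrightarrow> s < d \<Longrightarrow> z + s *\<^sub>R v \<in> W \<and> - \<rho> (z + s *\<^sub>R v) > - \<rho> z" by blast
      have "z + (d / 2) *\<^sub>R v \<in> K"
        using d(2)[of "d/2"] d(1) W(2)[of "z + (d / 2) *\<^sub>R v"] \<rho>(3) by simp
      from \<nu>(2)[OF this] show ?thesis using d(1) by (simp add: mult_le_0_iff)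
    qed
    define c where "c = \<nu> \<bullet> m"
    have c: "\<bar>c\<bar> \<le> 1" using Cauchy_Schwarz_ineq2[of \<nu> m] \<nu>(1) m(1) by (simp add: c_def)
    have mm: "m \<bullet> m = 1" "\<nu> \<bullet> \<nu> = 1" using m(1) \<nu>(1) by (simp_all add: norm_eq_1)
    have "c = 1"
    proof (rule ccontr)
      assume "c \<noteq> 1"
      \<comment> \<open>\<open>t\<close> lies strictly between \<open>c\<close> and 1, so
        \<open>\<nu> - t *\<^sub>R m\<close> points strictly inwards; testing \<open>\<nu>\<close>
        on it gives \<open>1 \<le> t * c\<close>, impossible for \<open>\<bar>t\<bar> < 1\<close>
        and \<open>\<bar>c\<bar> \<le> 1\<close>.\<close>
      define t where "t = (c + 1) / 2"
      have t: "t > c" "\<bar>t\<bar> < 1" using c \<open>c \<noteq> 1\<close> by (auto simp: t_def abs_if split: if_splits)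
      have "m \<bullet> (\<nu> - t *\<^sub>R m) < 0" using t(1) mm by (simp add: inner_diff_right c_def inner_commute)
      from neg[OF this] have "1 \<le> t * c" using mm by (simp add: inner_diff_right c_def)
      moreover have "\<bar>t * c\<bar> \<le> \<bar>t\<bar>" unfolding abs_mult using c by (intro mult_left_le) auto
      ultimately show False using t(2) by linarith
    qed
    then have "(\<nu> - m) \<bullet> (\<nu> - m) = 0"
      using mm by (simp add: inner_diff_left inner_diff_right c_def inner_commute)
    then show "\<nu> = m" by simp
  qed
  have eq: "gauss_map K z = m"
    unfolding gauss_map_def by (rule the_equality) (use m(1) ex un in blast)+
  show "gauss_map K z = gradient \<rho> z /\<^sub>R norm (gradient \<rho> z)" using eq m_def by simp
  show "gauss_map K z \<bullet> (y - z) \<le> 0" if "y \<in> K" for y using ex that eq by simp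
  show "\<nu> = gauss_map K z" if "norm \<nu> = 1" "\<And>y. y \<in> K \<Longrightarrow> \<nu> \<bullet> (y - z) \<le> 0" for \<nu>
    unfolding eq by (rule un[OF that])
qed

lemma gauss_map_normal:
  assumes "p \<in> frontier K"
  shows norm_gauss_map: "norm (gauss_map K p) = 1"
    and gauss_map_supporting: "\<And>y. y \<in> K \<Longrightarrow> gauss_map K p \<bullet> (y - p) \<le> 0"
    and gauss_map_unique:
      "\<And>\<nu>. norm \<nu> = 1 \<Longrightarrow> (\<And>y. y \<in> K \<Longrightarrow> \<nu> \<bullet> (y - p) \<le> 0) \<Longrightarrow> gauss_map K p = \<nu>"
proof -
  obtain W \<rho> where W: "open W" "p \<in> W" "smooth_on \<rho> W" "\<And>z. z \<in> W \<Longrightarrow> gradient \<rho> z \<noteq> 0"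
    "\<And>z. z \<in> W \<Longrightarrow> \<bar>\<rho> z\<bar> < 1" "\<And>z. z \<in> W \<Longrightarrow> z \<in> K \<longleftrightarrow> \<rho> z \<le> 0"
    "\<And>z. z \<in> W \<Longrightarrow> z \<in> frontier K \<longleftrightarrow> \<rho> z = 0"
    by (rule boundary_defining_function[OF assms]) (rule that; assumption)
  have d: "\<rho> differentiable (at p)"
    using W(3)[unfolded smooth_on_def, rule_format, of "Suc 0"] W(2) by simp
  note * = gauss_map_eq_gradient[OF assms W(2,1,6) d W(4)[OF W(2)]]
  have "\<rho> p = 0" using W(2,7) assms by blast
  note * = *[OF _ this]
  show "norm (gauss_map K p) = 1" using *(1) W(4)[OF W(2)] by simp
  show "gauss_map K p \<bullet> (y - p) \<le> 0" if "y \<in> K" for y using *(2) that by simp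
  show "gauss_map K p = \<nu>" if "norm \<nu> = 1" "\<And>y. y \<in> K \<Longrightarrow> \<nu> \<bullet> (y - p) \<le> 0" for \<nu>
    by (rule *(3)[symmetric]) (use that in auto)
qed

lemma gauss_map_surj:
  assumes "norm \<theta> = 1"
  obtains p where "p \<in> frontier K" "gauss_map K p = \<theta>"
proof -
  have "K \<noteq> {}" using zero_interior interior_subset by blast
  then obtain p where p: "p \<in> K" "\<And>y. y \<in> K \<Longrightarrow> \<theta> \<bullet> y \<le> \<theta> \<bullet> p"
    using continuous_attains_sup[OF compact_K, of "\<lambda>y. \<theta> \<bullet> y"] continuous_on_inner[OF continuous_on_const continuous_on_id]
    by blast
  have "p \<in> frontier K"
    by (rule supporting_point_frontier[OF p(1), of \<theta>]) (use assms p(2) in \<open>auto simp: inner_diff_right\<close>)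
  moreover from this have "gauss_map K p = \<theta>"
    by (rule gauss_map_unique) (use assms p(2) in \<open>auto simp: inner_diff_right\<close>)
  ultimately show ?thesis by (rule that)
qed

lemma support_fun_ge: "y \<in> K \<Longrightarrow> \<theta> \<bullet> y \<le> support_fun K \<theta>"
proof -
  assume "y \<in> K"
  moreover have "bdd_above ((\<lambda>z. \<theta> \<bullet> z) ` K)"
    by (intro bounded_imp_bdd_above compact_imp_bounded compact_continuous_image compact_K continuous_intros)
  ultimately show ?thesis unfolding support_fun_def by (intro cSUP_upper)
qed

lemma support_fun_gauss_map:
  assumes "p \<in> frontier K"
  shows "support_fun K (gauss_map K p) = gauss_map K p \<bullet> p"
  unfolding support_fun_def
  by (rule cSup_eq_maximum) (use assms frontier_subset gauss_map_supporting[OF assms] in \<open>auto simp: inner_diff_right\<close>)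

lemma support_fun_pos:
  assumes "\<theta> \<noteq> 0"
  shows "support_fun K \<theta> > 0"
proof -
  obtain e where e: "e > 0" "cball 0 e \<subseteq> K" using zero_interior by (meson mem_interior_cball)
  have "(e / norm \<theta>) *\<^sub>R \<theta> \<in> K" using e assms by (intro subsetD[OF e(2)]) auto
  from support_fun_ge[OF this, of \<theta>] have "(e / norm \<theta>) * (\<theta> \<bullet> \<theta>) \<le> support_fun K \<theta>" by simp
  moreover have "(e / norm \<theta>) * (\<theta> \<bullet> \<theta>) > 0" using e assms by simp
  ultimately show ?thesis by linarith
qed

text \<open>The Gauss map is meaningful on the frontier only. The normalised gradient of a defining
  function continues it to a unit field on an open set, where unrestricted derivatives are
  available.\<close>

lemma gauss_map_smooth_extension:
  assumes "p \<in> frontier K"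
  obtains W \<rho> N where "open W" "p \<in> W" "smooth_on \<rho> W" "smooth_on N W"
    "\<And>z. z \<in> W \<Longrightarrow> \<bar>\<rho> z\<bar> < 1" "\<And>z. z \<in> W \<Longrightarrow> z \<in> frontier K \<longleftrightarrow> \<rho> z = 0"
    "\<And>z. z \<in> W \<Longrightarrow> N z \<bullet> N z = 1" "\<And>z. z \<in> W \<Longrightarrow> z \<in> frontier K \<Longrightarrow> gauss_map K z = N z"
    "frechet_derivative \<rho> (at p) = (\<lambda>v. norm (gradient \<rho> p) * (N p \<bullet> v))" "gradient \<rho> p \<noteq> 0"
proof -
  obtain W \<rho> where W: "open W" "p \<in> W" "smooth_on \<rho> W" "\<And>z. z \<in> W \<Longrightarrow> gradient \<rho> z \<noteq> 0"
    "\<And>z. z \<in> W \<Longrightarrow> \<bar>\<rho> z\<bar> < 1" "\<And>z. z \<in> W \<Longrightarrow> z \<in> K \<longleftrightarrow> \<rho> z \<le> 0"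
    "\<And>z. z \<in> W \<Longrightarrow> z \<in> frontier K \<longleftrightarrow> \<rho> z = 0"
    by (rule boundary_defining_function[OF assms]) (rule that; assumption)
  define N where "N z = ((gradient \<rho> z \<bullet> gradient \<rho> z) powr (- 1 / 2)) *\<^sub>R gradient \<rho> z" for z
  have N_eq: "N z = gradient \<rho> z /\<^sub>R norm (gradient \<rho> z)" if "z \<in> W" for z
  proof -
    have "norm (gradient \<rho> z) > 0" using W(4)[OF that] by simp
    then show ?thesis
      unfolding N_def by (simp add: powr_minus powr_half_sqrt norm_eq_sqrt_inner)
  qed
  have d: "\<rho> differentiable (at z)" if "z \<in> W" for z
    using W(3)[unfolded smooth_on_def, rule_format, of "Suc 0"] that by simp
  have "smooth_on N W" unfolding smooth_on_def
  proof
    fix k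
    have "Ck_on k (gradient \<rho>) W"
      using W(1,3) by (intro Ck_on_gradient) (auto simp: smooth_on_def)
    then show "Ck_on k N W" unfolding N_def
      by (intro Ck_on_scaleR Ck_on_powr Ck_on_inner W(1)) (use W(4) in auto)
  qed
  moreover have "N z \<bullet> N z = 1" if "z \<in> W" for z
    using N_eq[OF that] W(4)[OF that] by (simp add: dot_square_norm power2_eq_square)
  moreover have "gauss_map K z = N z" if z: "z \<in> W" "z \<in> frontier K" for z
    using gauss_map_eq_gradient(1)[OF z(2,1) W(1,6) d[OF z(1)] W(4)[OF z(1)]] W(7)[OF z(1)] z N_eq[OF z(1)] by simp
  moreover have "frechet_derivative \<rho> (at p) = (\<lambda>v. norm (gradient \<rho> p) * (N p \<bullet> v))"
    using gradient_inner[OF d[OF W(2)]] N_eq[OF W(2)] W(4)[OF W(2)] by (auto simp: fun_eq_iff)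
  ultimately show ?thesis
    using that[of W \<rho> N] W by blast
qed

text \<open>Only the existence of a derivative is taken from the extension: the derivative of
  \<open>N\<close> and the one chosen by \<open>gauss_differential\<close> may differ off the
  tangent space.\<close>

lemma gauss_map_has_derivative:
  assumes "p \<in> frontier K"
  shows "(gauss_map K has_derivative gauss_differential K p) (at p within frontier K)"
proof -
  obtain W \<rho> N where W: "open W" "p \<in> W" "smooth_on N W"
    "\<And>z. z \<in> W \<Longrightarrow> z \<in> frontier K \<Longrightarrow> gauss_map K z = N z"
    by (rule gauss_map_smooth_extension[OF assms]) (rule that; assumption)
  obtain r where r: "r > 0" "ball p r \<subseteq> W" using openE[OF W(1,2)] .
  have "Ck_on (Suc 0) N W" using W(3) unfolding smooth_on_def by blast
  then have "(N has_derivative frechet_derivative N (at p)) (at p within frontier K)"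
    by (rule has_derivative_at_withinI[OF Ck_on_has_derivative[OF _ W(2)]])
  then have "(gauss_map K has_derivative frechet_derivative N (at p)) (at p within frontier K)"
  proof (rule has_derivative_transform_within[OF _ r(1) assms])
    fix z assume "z \<in> frontier K" "dist z p < r"
    then show "N z = gauss_map K z"
      using W(4)[of z] r(2) by (auto simp: subset_eq dist_commute)
  qed
  then have "gauss_map K differentiable (at p within frontier K)"
    by (rule differentiableI)
  then show ?thesis
    unfolding gauss_differential_def frechet_derivative_works .
qed

lemma continuous_on_gauss_map: "continuous_on (frontier K) (gauss_map K)"
  unfolding continuous_on_eq_continuous_within
  by (intro ballI has_derivative_continuous[OF gauss_map_has_derivative])

lemma gauss_map_curve:
  assumes "(q has_vector_derivative v) (at t)" "open I" "t \<in> I" "q ` I \<subseteq> frontier K"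
  shows "((\<lambda>s. gauss_map K (q s)) has_vector_derivative gauss_differential K (q t) v) (at t)"
proof -
  have "q t \<in> frontier K" using assms(3,4) by blast
  then show ?thesis
    by (rule has_vector_derivative_compose_within[OF gauss_map_has_derivative assms])
qed

text \<open>\<open>\<Theta>\<close> straightens the boundary: it keeps the tangential part of
  \<open>z - p\<close> and puts \<open>\<rho> z\<close> in the normal coordinate, so that the
  frontier becomes the hyperplane orthogonal to \<open>m\<close>. The curve is the preimage of the
  line along \<open>v\<close>; its velocity is \<open>v\<close> because the derivative of
  \<open>\<Theta>\<close> at \<open>p\<close> fixes tangent vectors.\<close>

lemma tangent_curve:
  assumes p: "p \<in> frontier K" and v: "v \<bullet> gauss_map K p = 0"
  obtains q I where "(q has_vector_derivative v) (at (0::real))" "open I" "0 \<in> I"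
    "q ` I \<subseteq> frontier K" "q 0 = p"
proof -
  obtain W \<rho> N where W: "open W" "p \<in> W" "smooth_on \<rho> W"
    "\<And>z. z \<in> W \<Longrightarrow> z \<in> frontier K \<longleftrightarrow> \<rho> z = 0"
    "\<And>z. z \<in> W \<Longrightarrow> N z \<bullet> N z = 1" "\<And>z. z \<in> W \<Longrightarrow> z \<in> frontier K \<Longrightarrow> gauss_map K z = N z"
    "frechet_derivative \<rho> (at p) = (\<lambda>v. norm (gradient \<rho> p) * (N p \<bullet> v))" "gradient \<rho> p \<noteq> 0"
    by (rule gauss_map_smooth_extension[OF p]) (rule that; assumption)
  define m where "m = N p"
  define c where "c = norm (gradient \<rho> p)"
  have m: "m \<bullet> m = 1" "m \<bullet> v = 0" using W(5)[OF W(2)] W(6)[OF W(2) p] v by (auto simp: m_def inner_commute)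
  have "c > 0" using W(8) by (simp add: c_def)
  define \<Theta> where "\<Theta> z = (z - p) + (\<rho> z - m \<bullet> (z - p)) *\<^sub>R m" for z
  have Ck\<rho>: "Ck_on k \<rho> W" for k using W(3) by (simp add: smooth_on_def)
  have sm: "smooth_on \<Theta> W"
    unfolding smooth_on_def \<Theta>_def
    by (intro allI Ck_on_add Ck_on_diff Ck_on_scaleR Ck_on_inner Ck_on_const Ck_on_ident W(1) Ck\<rho>)
  have d\<rho>: "(\<rho> has_derivative (\<lambda>u. c * (m \<bullet> u))) (at p)"
    using Ck_on_has_derivative[OF Ck\<rho> W(2)] unfolding W(7) c_def m_def .
  have "(\<Theta> has_derivative (\<lambda>u. u + (c * (m \<bullet> u) - m \<bullet> u) *\<^sub>R m)) (at p)"
    unfolding \<Theta>_def by (auto intro!: derivative_eq_intros d\<rho>)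
  then have D: "frechet_derivative \<Theta> (at p) = (\<lambda>u. u + (c * (m \<bullet> u) - m \<bullet> u) *\<^sub>R m)"
    by (rule frechet_derivative_at[symmetric])
  have inj: "inj (frechet_derivative \<Theta> (at p))"
  proof (rule injI)
    fix a b assume "frechet_derivative \<Theta> (at p) a = frechet_derivative \<Theta> (at p) b"
    then have eq: "a + (c * (m \<bullet> a) - m \<bullet> a) *\<^sub>R m = b + (c * (m \<bullet> b) - m \<bullet> b) *\<^sub>R m" unfolding D .
    from arg_cong[OF this, of "\<lambda>w. m \<bullet> w"] have "c * (m \<bullet> a) = c * (m \<bullet> b)"
      using m(1) by (simp add: inner_add_right)
    then have "m \<bullet> a = m \<bullet> b" using \<open>c > 0\<close> by simp
    then show "a = b" using eq by simp
  qed
  obtain U V g where UV: "open U" "U \<subseteq> W" "p \<in> U" "open V" "\<Theta> p \<in> V" "homeomorphism U V \<Theta> g"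
    "smooth_on g V"
    "\<And>y v. y \<in> V \<Longrightarrow> frechet_derivative \<Theta> (at (g y)) (frechet_derivative g (at y) v) = v"
    by (rule smooth_inverse_function[OF W(1) sm W(2) inj]) blast
  have \<Theta>p: "\<Theta> p = 0" using W(4)[OF W(2)] p by (simp add: \<Theta>_def)
  have V0: "0 \<in> V" using UV(5) \<Theta>p by simp
  have gp: "g 0 = p" using homeomorphism_apply1[OF UV(6,3)] \<Theta>p by simp
  have dg: "(g has_derivative frechet_derivative g (at 0)) (at 0)"
    using UV(7)[unfolded smooth_on_def, rule_format, of "Suc 0"] by (rule Ck_on_has_derivative[OF _ V0])
  have "frechet_derivative \<Theta> (at p) (frechet_derivative g (at 0) v) = frechet_derivative \<Theta> (at p) v"
    using UV(8)[OF V0] gp m(2) by (simp add: D)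
  then have dgv: "frechet_derivative g (at 0) v = v" using inj by (simp add: inj_eq)
  have "((\<lambda>s. s *\<^sub>R v) has_vector_derivative v) (at 0)"
    by (auto intro!: derivative_eq_intros)
  then have "((\<lambda>s. g (s *\<^sub>R v)) has_vector_derivative frechet_derivative g (at 0) v) (at 0)"
    using has_vector_derivative_compose_within[of g "frechet_derivative g (at 0)" "\<lambda>s. s *\<^sub>R v" 0 UNIV v UNIV] dg
    by simp
  then have q: "((\<lambda>s. g (s *\<^sub>R v)) has_vector_derivative v) (at 0)" by (simp add: dgv)
  have "g (s *\<^sub>R v) \<in> frontier K" if "s *\<^sub>R v \<in> V" for s
  proof -
    have gU: "g (s *\<^sub>R v) \<in> U" and eq: "\<Theta> (g (s *\<^sub>R v)) = s *\<^sub>R v"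
      using UV(6) that by (auto simp: homeomorphism_def)
    from arg_cong[OF eq, of "\<lambda>w. m \<bullet> w"] have "\<rho> (g (s *\<^sub>R v)) = 0"
      unfolding \<Theta>_def using m by (simp add: inner_add_right inner_diff_right)
    then show ?thesis using W(4) gU UV(2) by auto
  qed
  then have "(\<lambda>s. g (s *\<^sub>R v)) ` ((\<lambda>s. s *\<^sub>R v) -` V) \<subseteq> frontier K" by auto
  moreover have "open ((\<lambda>s::real. s *\<^sub>R v) -` V)"
    by (intro open_vimage UV(4) continuous_intros)
  ultimately show ?thesis
    using that[OF q] V0 gp by simp
qed

text \<open>To invert a map between hypersurfaces it is thickened to
  \<open>\<Psi> z = (1 + \<rho> z) *\<^sub>R N z\<close>, whose radius records the level of
  \<open>\<rho>\<close>; unit vectors then correspond exactly to frontier points. The derivative is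
  injective: the radius sees the normal direction, and positive curvature the tangent ones.\<close>

lemma local_inverse_gauss_map:
  assumes p: "p \<in> frontier K"
  obtains U V \<Phi> where "open U" "p \<in> U" "open V" "gauss_map K p \<in> V" "smooth_on \<Phi> V"
    "\<And>\<theta>. \<theta> \<in> V \<Longrightarrow> norm \<theta> = 1 \<Longrightarrow> \<Phi> \<theta> \<in> frontier K \<and> gauss_map K (\<Phi> \<theta>) = \<theta>"
    "\<And>z. z \<in> U \<Longrightarrow> z \<in> frontier K \<Longrightarrow> \<Phi> (gauss_map K z) = z"
proof -
  obtain W \<rho> N where W: "open W" "p \<in> W" "smooth_on \<rho> W" "smooth_on N W"
    "\<And>z. z \<in> W \<Longrightarrow> \<bar>\<rho> z\<bar> < 1" "\<And>z. z \<in> W \<Longrightarrow> z \<in> frontier K \<longleftrightarrow> \<rho> z = 0"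
    "\<And>z. z \<in> W \<Longrightarrow> N z \<bullet> N z = 1" "\<And>z. z \<in> W \<Longrightarrow> z \<in> frontier K \<Longrightarrow> gauss_map K z = N z"
    "frechet_derivative \<rho> (at p) = (\<lambda>v. norm (gradient \<rho> p) * (N p \<bullet> v))" "gradient \<rho> p \<noteq> 0"
    by (rule gauss_map_smooth_extension[OF p]) (rule that; assumption)
  have Ck\<rho>: "Ck_on k \<rho> W" and CkN: "Ck_on k N W" for k using W(3,4) by (simp_all add: smooth_on_def)
  define \<Psi> where "\<Psi> z = (1 + \<rho> z) *\<^sub>R N z" for z
  define D where "D = frechet_derivative N (at p)"
  have \<rho>p: "\<rho> p = 0" and Np: "gauss_map K p = N p" using W(6,8)[OF W(2)] p by auto
  have dN: "(N has_derivative D) (at p)"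
    unfolding D_def by (rule Ck_on_has_derivative[OF CkN W(2)])
  have d\<rho>: "(\<rho> has_derivative (\<lambda>v. norm (gradient \<rho> p) * (N p \<bullet> v))) (at p)"
    using Ck_on_has_derivative[OF Ck\<rho> W(2)] unfolding W(9) .
  have N1: "((\<lambda>z. N z \<bullet> N z) has_derivative (\<lambda>v. N p \<bullet> D v + D v \<bullet> N p)) (at p)"
    by (intro has_derivative_inner dN)
  have N2: "((\<lambda>z. N z \<bullet> N z) has_derivative (\<lambda>v. 0)) (at p)"
    by (rule has_derivative_transform_within_open[OF has_derivative_const[of 1] W(1,2)]) (simp add: W(7))
  have "N p \<bullet> D v + D v \<bullet> N p = 0" for v
    using fun_cong[OF has_derivative_unique[OF N1 N2], of v] .
  then have ND: "N p \<bullet> D v = 0" for v by (simp add: inner_commute)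
  \<comment> \<open>Both sides are the velocity of the normal along one curve in the
    frontier.\<close>
  have tang: "gauss_differential K p v = D v" if v: "v \<bullet> N p = 0" for v
  proof -
    obtain q I where q: "(q has_vector_derivative v) (at (0::real))" "open I" "0 \<in> I"
      "q ` I \<subseteq> frontier K" "q 0 = p"
      by (rule tangent_curve[OF p, of v]) (use v Np in auto)
    have "continuous (at 0) q" using q(1) has_vector_derivative_continuous by blast
    then obtain J where J: "open J" "0 \<in> J" "q ` J \<subseteq> W"
      by (rule isCont_mem_open[of 0 q W]) (use W(1,2) q(5) in auto)
    have "((\<lambda>s. N (q s)) has_vector_derivative D v) (at 0)"
      using has_vector_derivative_compose_within[of N D q 0 UNIV v UNIV] q(1,5) dN by simp
    then have "((\<lambda>s. gauss_map K (q s)) has_vector_derivative D v) (at 0)"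
      by (rule has_vector_derivative_transform_within_open[of _ _ _ "I \<inter> J"])
         (use q(2-4) J W(8) in \<open>simp_all add: image_subset_iff open_Int\<close>)
    moreover have "((\<lambda>s. gauss_map K (q s)) has_vector_derivative gauss_differential K p v) (at 0)"
      using gauss_map_curve[OF q(1-4)] q(5) by simp
    ultimately show ?thesis using vector_derivative_unique_at by blast
  qed
  have "(\<Psi> has_derivative (\<lambda>v. (1 + \<rho> p) *\<^sub>R D v + (0 + norm (gradient \<rho> p) * (N p \<bullet> v)) *\<^sub>R N p)) (at p)"
    unfolding \<Psi>_def by (intro has_derivative_scaleR has_derivative_add has_derivative_const d\<rho> dN)
  then have d\<Psi>: "(\<Psi> has_derivative (\<lambda>v. D v + (norm (gradient \<rho> p) * (N p \<bullet> v)) *\<^sub>R N p)) (at p)"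
    by (simp add: \<rho>p)
  have ker: "v = 0" if v: "D v + (norm (gradient \<rho> p) * (N p \<bullet> v)) *\<^sub>R N p = 0" for v
  proof -
    from arg_cong[OF v, of "\<lambda>w. N p \<bullet> w"] have "norm (gradient \<rho> p) * (N p \<bullet> v) = 0"
      using ND W(7)[OF W(2)] by (simp add: inner_add_right)
    then have Nv: "N p \<bullet> v = 0" using W(10) by simp
    then have "D v = 0" using v by simp
    moreover have "gauss_differential K p v = D v" using Nv by (intro tang) (simp add: inner_commute)
    moreover have "positively_curved_boundary K" using K by (simp add: smooth_convex_body_def)
    then have "v \<noteq> 0 \<longrightarrow> gauss_differential K p v \<bullet> v > 0"
      using p Nv Np unfolding positively_curved_boundary_def by (simp add: inner_commute)
    ultimately show ?thesis by auto
  qed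
  have "linear (\<lambda>v. D v + (norm (gradient \<rho> p) * (N p \<bullet> v)) *\<^sub>R N p)"
    using d\<Psi> has_derivative_linear by blast
  then have "inj (\<lambda>v. D v + (norm (gradient \<rho> p) * (N p \<bullet> v)) *\<^sub>R N p)"
    using ker by (subst linear_injective_0[OF \<open>linear _\<close>]) blast
  then have inj: "inj (frechet_derivative \<Psi> (at p))"
    unfolding frechet_derivative_at[OF d\<Psi>] .
  have sm: "smooth_on \<Psi> W"
    unfolding smooth_on_def \<Psi>_def
    by (intro allI Ck_on_add Ck_on_scaleR Ck_on_const W(1) Ck\<rho> CkN)
  obtain U V \<Phi> where UV: "open U" "U \<subseteq> W" "p \<in> U" "open V" "\<Psi> p \<in> V" "homeomorphism U V \<Psi> \<Phi>"
    "smooth_on \<Phi> V"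
    by (rule smooth_inverse_function[OF W(1) sm W(2) inj]) blast
  show ?thesis
  proof (rule that[OF UV(1,3,4) _ UV(7)])
    show "gauss_map K p \<in> V" using UV(5) \<rho>p Np by (simp add: \<Psi>_def)
  next
    fix \<theta> assume \<theta>: "\<theta> \<in> V" "norm \<theta> = 1"
    have z: "\<Phi> \<theta> \<in> W" "\<Psi> (\<Phi> \<theta>) = \<theta>"
      using UV(2) homeomorphism_image2[OF UV(6)] homeomorphism_apply2[OF UV(6) \<theta>(1)] \<theta>(1) by blast+
    have "norm (N (\<Phi> \<theta>)) = 1" using W(7)[OF z(1)] by (simp add: norm_eq_1)
    then have "\<bar>1 + \<rho> (\<Phi> \<theta>)\<bar> = 1" using \<theta>(2) z(2) unfolding \<Psi>_def by (metis norm_scaleR mult_1_right)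
    \<comment> \<open>The other solution \<open>\<rho> = -2\<close> is excluded by
      \<open>\<bar>\<rho>\<bar> < 1\<close>.\<close>
    then have "\<rho> (\<Phi> \<theta>) = 0" using W(5)[OF z(1)] by linarith
    then show "\<Phi> \<theta> \<in> frontier K \<and> gauss_map K (\<Phi> \<theta>) = \<theta>"
      using W(6,8)[OF z(1)] z(2) by (simp add: \<Psi>_def)
  next
    fix z assume z: "z \<in> U" "z \<in> frontier K"
    then have "\<Psi> z = gauss_map K z" using W(6,8) UV(2) by (auto simp: \<Psi>_def)
    then show "\<Phi> (gauss_map K z) = z" using homeomorphism_apply1[OF UV(6) z(1)] by simp
  qed
qed

text \<open>If the Gauss map took the same value at two points, it would be constant on the segment
  between them, contradicting its local injectivity.\<close>

lemma inj_on_gauss_map: "inj_on (gauss_map K) (frontier K)"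
proof (rule inj_onI)
  fix p q assume p: "p \<in> frontier K" and q: "q \<in> frontier K" and eq: "gauss_map K p = gauss_map K q"
  let ?\<nu> = "gauss_map K p"
  have pq: "p \<in> K" "q \<in> K" using p q frontier_subset by auto
  have \<nu>: "?\<nu> \<bullet> q = ?\<nu> \<bullet> p"
    using gauss_map_supporting[OF p pq(2)] gauss_map_supporting[OF q pq(1)] eq
    by (simp add: inner_diff_right)
  obtain U V \<Phi> where U: "open U" "p \<in> U"
    "\<And>z. z \<in> U \<Longrightarrow> z \<in> frontier K \<Longrightarrow> \<Phi> (gauss_map K z) = z"
    by (rule local_inverse_gauss_map[OF p]) (rule that; assumption)
  have op: "open ((\<lambda>s::real. p + s *\<^sub>R (q - p)) -` U)"
    by (intro open_vimage U(1) continuous_intros)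
  have "0 \<in> (\<lambda>s::real. p + s *\<^sub>R (q - p)) -` U" using U(2) by simp
  then obtain e where e: "e > 0" "ball 0 e \<subseteq> (\<lambda>s::real. p + s *\<^sub>R (q - p)) -` U"
    using openE[OF op] by blast
  define s where "s = min (e / 2) 1"
  have s: "0 < s" "s < e" "s \<le> 1" using e(1) by (auto simp: s_def min_def)
  define z where "z = p + s *\<^sub>R (q - p)"
  have "s \<in> ball 0 e" using s by simp
  then have zU: "z \<in> U" using e(2) unfolding z_def by blast
  have "z = (1 - s) *\<^sub>R p + s *\<^sub>R q" by (simp add: z_def algebra_simps)
  then have zK: "z \<in> K" using convexD_alt[OF convex_K pq, of s] s by simp
  have "?\<nu> \<bullet> z = ?\<nu> \<bullet> p" using \<nu> by (simp add: z_def inner_add_right inner_diff_right)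
  then have sup: "?\<nu> \<bullet> (y - z) \<le> 0" if "y \<in> K" for y
    using gauss_map_supporting[OF p that] by (simp add: inner_diff_right)
  have n1: "norm ?\<nu> = 1" by (rule norm_gauss_map[OF p])
  then have "?\<nu> \<noteq> 0" by auto
  then have zf: "z \<in> frontier K" by (rule supporting_point_frontier[OF zK _ sup])
  have "gauss_map K z = ?\<nu>" by (rule gauss_map_unique[OF zf n1 sup])
  then have "z = p" using U(3)[OF zU zf] U(3)[OF U(2) p] by metis
  then show "p = q" using s by (simp add: z_def)
qed

end

definition inverse_gauss_map :: "'a::euclidean_space set \<Rightarrow> 'a \<Rightarrow> 'a" where
  "inverse_gauss_map K = inv_into (frontier K) (gauss_map K)"

context
  fixes K :: "'a::euclidean_space set"
  assumes K: "smooth_convex_body K"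
begin

lemma inverse_gauss_map:
  assumes "norm \<theta> = 1"
  shows inverse_gauss_map_frontier: "inverse_gauss_map K \<theta> \<in> frontier K"
    and gauss_map_inverse: "gauss_map K (inverse_gauss_map K \<theta>) = \<theta>"
proof -
  have "\<theta> \<in> gauss_map K ` frontier K"
    using gauss_map_surj[OF K assms] by blast
  then show "inverse_gauss_map K \<theta> \<in> frontier K" "gauss_map K (inverse_gauss_map K \<theta>) = \<theta>"
    unfolding inverse_gauss_map_def by (simp_all add: inv_into_into f_inv_into_f)
qed

lemma inverse_gauss_map_gauss:
  "p \<in> frontier K \<Longrightarrow> inverse_gauss_map K (gauss_map K p) = p"
  unfolding inverse_gauss_map_def by (rule inv_into_f_f[OF inj_on_gauss_map[OF K]])

text \<open>\<open>\<Phi>\<close> is one extension off the sphere among many; its derivatives along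
  tangent vectors of the sphere do not depend on the choice.\<close>

lemma inverse_gauss_map_locally_smooth:
  assumes "norm \<theta> = 1"
  obtains V \<Phi> where "open V" "\<theta> \<in> V" "smooth_on \<Phi> V"
    "\<And>\<eta>. \<eta> \<in> V \<Longrightarrow> norm \<eta> = 1 \<Longrightarrow> inverse_gauss_map K \<eta> = \<Phi> \<eta>"
proof -
  let ?p = "inverse_gauss_map K \<theta>"
  obtain U V \<Phi> where "open U" "?p \<in> U" and V: "open V" "gauss_map K ?p \<in> V" "smooth_on \<Phi> V"
    "\<And>\<theta>. \<theta> \<in> V \<Longrightarrow> norm \<theta> = 1 \<Longrightarrow> \<Phi> \<theta> \<in> frontier K \<and> gauss_map K (\<Phi> \<theta>) = \<theta>"
    by (rule local_inverse_gauss_map[OF K inverse_gauss_map_frontier[OF assms]]) (rule that; assumption)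
  show ?thesis
    by (rule that[OF V(1) _ V(3)])
       (use V(2,4) gauss_map_inverse[OF assms] inverse_gauss_map_gauss in \<open>auto, metis\<close>)
qed

lemma support_fun_eq_inner:
  assumes "norm \<theta> = 1"
  shows "support_fun K \<theta> = \<theta> \<bullet> inverse_gauss_map K \<theta>"
  using support_fun_gauss_map[OF K inverse_gauss_map_frontier[OF assms]] gauss_map_inverse[OF assms] by simp

end

section \<open>The curvature condition in stereographic coordinates\<close>

lemma partial_eq:
  assumes "(F has_derivative D) (at u)"
  shows "partial i F u = D (axis i 1)"
  unfolding partial_def frechet_derivative_at[OF assms, symmetric] ..

lemma partial_cong_open:
  assumes "open U" "u \<in> U" "\<And>w. w \<in> U \<Longrightarrow> F w = F' w"
  shows "partial i F u = partial i F' u"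
  unfolding partial_def using frechet_derivative_cong_open[OF assms] by simp

lemma partial_has_derivative_open:
  assumes "open U" "u \<in> U" "\<And>w. w \<in> U \<Longrightarrow> F w = F' w" "(F' has_derivative D) (at u)"
  shows "partial i F u = D (axis i 1)"
  using partial_cong_open[OF assms(1-3)] partial_eq[OF assms(4)] by simp

lemma has_derivative_component: "((\<lambda>w::real^'n. w $ i) has_derivative (\<lambda>v. v $ i)) (at u)"
  by (rule bounded_linear_imp_has_derivative[OF bounded_linear_vec_nth])

lemma has_derivative_inverse_quadratic:
  fixes u :: "'a::real_inner"
  shows "((\<lambda>u. inverse (1 + u \<bullet> u)) has_derivative (\<lambda>v. - (2 * (u \<bullet> v) / (1 + u \<bullet> u)\<^sup>2))) (at u)"
proof -
  have "1 + u \<bullet> u \<noteq> 0" by (smt (verit) inner_ge_zero)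
  then show ?thesis
    by (auto intro!: derivative_eq_intros simp: inner_commute power2_eq_square field_simps)
qed

text \<open>The metric of the unit sphere in stereographic coordinates.\<close>

definition round_metric :: "real ^ 'n \<Rightarrow> real ^ 'n ^ 'n" where
  "round_metric u = (\<chi> i j. 4 * (inverse (1 + u \<bullet> u))\<^sup>2 * (if i = j then 1 else 0))"

lemma partial_round_metric:
  "partial i (\<lambda>w. round_metric w $ j $ l) u =
     - (16 * u $ i * (inverse (1 + u \<bullet> u)) ^ 3) * (if j = l then 1 else 0)"
proof -
  let ?q = "\<lambda>u::real^'n. inverse (1 + u \<bullet> u)"
  let ?c = "if j = l then 1 else 0 :: real"
  have "((\<lambda>w. ?c * 4 * (?q w)\<^sup>2) has_derivative
      (\<lambda>v. ?c * 4 * (of_nat 2 * - (2 * (u \<bullet> v) / (1 + u \<bullet> u)\<^sup>2) * ?q u ^ (2 - 1)))) (at u)"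
    by (rule has_derivative_mult_right[OF has_derivative_power[OF has_derivative_inverse_quadratic]])
  from partial_eq[OF this, of i]
  have "partial i (\<lambda>w. ?c * 4 * (?q w)\<^sup>2) u = - (16 * u $ i * ?q u ^ 3) * ?c"
    by (simp add: inner_axis divide_inverse power_inverse power2_eq_square power3_eq_cube)
  moreover have "(\<lambda>w. round_metric w $ j $ l) = (\<lambda>w. ?c * 4 * (?q w)\<^sup>2)"
    by (simp add: round_metric_def fun_eq_iff)
  ultimately show ?thesis by simp
qed

lemma matrix_inv_eqI:
  fixes A :: "'a::semiring_1 ^ 'n ^ 'n"
  assumes "A ** B = mat 1" "B ** A = mat 1"
  shows "matrix_inv A = B"
proof -
  have "A ** matrix_inv A = mat 1"
    unfolding matrix_inv_def by (rule someI2[of _ B]) (use assms in auto)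
  then have "B ** (A ** matrix_inv A) = B" by (simp add: matrix_mul_rid)
  then show ?thesis by (simp add: matrix_mul_assoc assms(2) matrix_mul_lid)
qed

lemma matrix_inv_round_metric:
  "matrix_inv (round_metric u) $ k $ l = (1 + u \<bullet> u)\<^sup>2 / 4 * (if k = l then 1 else 0)"
proof -
  let ?M = "(\<chi> i j. (1 + u \<bullet> u)\<^sup>2 / 4 * (if i = j then 1 else 0)) :: real^'n^'n"
  have nz: "1 + u \<bullet> u \<noteq> 0" by (smt (verit) inner_ge_zero)
  have sq: "4 * (inverse (1 + u \<bullet> u))\<^sup>2 * ((1 + u \<bullet> u)\<^sup>2 / 4) = 1"
    using nz by (simp add: power_inverse)
  have diag: "(\<chi> i j. a * (if i = j then 1 else 0)) ** (\<chi> i j. b * (if i = j then 1 else 0)) = (mat 1 :: real^'n^'n)"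
    if "a * b = 1" for a b :: real
  proof -
    have "(\<Sum>k\<in>UNIV. (a * (if i = k then 1 else 0)) * (b * (if k = j then 1 else 0))) =
        (if i = j then 1 else 0)" for i j :: 'n
    proof -
      have "(\<Sum>k\<in>UNIV. (a * (if i = k then 1 else 0)) * (b * (if k = j then 1 else 0))) =
          (\<Sum>k\<in>UNIV. if k = i then (if i = j then 1 else 0) else 0)"
        using that by (intro sum.cong refl) auto
      then show ?thesis by (simp add: sum.delta)
    qed
    then show ?thesis by (simp add: matrix_matrix_mult_def mat_def vec_eq_iff)
  qed
  have "round_metric u ** ?M = mat 1" "?M ** round_metric u = mat 1"
    unfolding round_metric_def using sq by (intro diag; simp only: mult.commute)+
  then have "matrix_inv (round_metric u) = ?M"
    by (rule matrix_inv_eqI)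
  then show ?thesis by simp
qed

lemma christoffel_cong_open:
  assumes "open U" "u \<in> U" "\<And>w. w \<in> U \<Longrightarrow> G w = G' w"
  shows "christoffel G k i j u = christoffel G' k i j u"
proof -
  have "partial i (\<lambda>w. G w $ j $ l) u = partial i (\<lambda>w. G' w $ j $ l) u" for i j l
    by (rule partial_cong_open[OF assms(1,2)]) (simp add: assms(3))
  then show ?thesis unfolding christoffel_def by (simp add: assms)
qed

text \<open>The general formula for a conformally flat metric: the conformal factor is the square of
  2 / (1 + \<open>u \<bullet> u\<close>), and the logarithm of this quotient has partial derivatives
  - 2 \<open>u $ i\<close> / (1 + \<open>u \<bullet> u\<close>).\<close>

lemma christoffel_round_metric:
  "christoffel round_metric k i j u = - 2 * inverse (1 + u \<bullet> u) *
     ((if j = k then u $ i else 0) + (if i = k then u $ j else 0) - (if i = j then u $ k else 0))"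
proof -
  have nz: "1 + u \<bullet> u \<noteq> 0" by (smt (verit) inner_ge_zero)
  let ?f = "\<lambda>l. partial i (\<lambda>w. round_metric w $ j $ l) u + partial j (\<lambda>w. round_metric w $ i $ l) u
          - partial l (\<lambda>w. round_metric w $ i $ j) u"
  have "christoffel round_metric k i j u = (\<Sum>l\<in>UNIV. (if k = l then (1 + u \<bullet> u)\<^sup>2 / 4 * ?f l else 0)) / 2"
    unfolding christoffel_def matrix_inv_round_metric by (intro arg_cong2[where f="(/)"] sum.cong refl) auto
  also have "\<dots> = (1 + u \<bullet> u)\<^sup>2 / 4 * ?f k / 2" by (simp add: sum.delta')
  finally have eq: "christoffel round_metric k i j u = (1 + u \<bullet> u)\<^sup>2 / 4 * ?f k / 2" .
  show ?thesis
  proof -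
    have gen: "a / 4 * (- (16 * x * r) * b + - (16 * y * r) * c - - (16 * z * r) * d) / 2 =
        - 2 * (a * r) * (x * b + y * c - z * d)" for a b c d r x y z :: real
      by (simp add: field_simps)
    have "x\<^sup>2 * inverse x ^ 3 = inverse x" if "x \<noteq> 0" for x :: real
      using that by (simp add: field_simps power2_eq_square power3_eq_cube)
    from this[OF nz] have "(1 + u \<bullet> u)\<^sup>2 * inverse (1 + u \<bullet> u) ^ 3 = inverse (1 + u \<bullet> u)" .
    then show ?thesis
      unfolding eq partial_round_metric gen by simp
  qed
qed

text \<open>The Christoffel symbols are odd in \<open>u\<close>, so at the origin only their first
  derivatives survive in the Ricci tensor. The 4 is the metric coefficient there: the Ricci tensor
  is the dimension minus one times the metric. Agreement on a neighbourhood is assumed because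
  derivatives of the metric enter.\<close>

lemma
  fixes G :: "real ^ 'n::finite \<Rightarrow> real ^ 'n ^ 'n"
  assumes U: "open U" "0 \<in> U" "\<And>w. w \<in> U \<Longrightarrow> G w = round_metric w"
  shows christoffel_stereographic_origin: "christoffel G k i j 0 = 0"
    and ricci_stereographic_origin:
      "ricci G 0 = (\<chi> i j. 4 * (real CARD('n) - 1) * (if i = j then 1 else 0))"
proof -
  have chr: "christoffel G k i j u = christoffel round_metric k i j u" if "u \<in> U" for k i j u
    using christoffel_cong_open[OF U(1) that U(3)] .
  show c0: "christoffel G k i j 0 = 0" for k i j
    using chr[OF U(2)] by (simp add: christoffel_round_metric)
  let ?C = "\<lambda>k i j (u::real^'n). (if j = k then u $ i else 0) + (if i = k then u $ j else 0) - (if i = j then u $ k else 0)"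
  have d: "partial l (christoffel G k i j) 0 = - 2 * ?C k i j (axis l 1)" for l k i j
  proof (rule partial_has_derivative_open[OF U(1,2)])
    show "christoffel G k i j w = - 2 * inverse (1 + w \<bullet> w) * ?C k i j w" if "w \<in> U" for w
      unfolding chr[OF that] christoffel_round_metric ..
    have dif: "((\<lambda>u::real^'n. if b then u $ i else 0) has_derivative (\<lambda>u. if b then u $ i else 0)) (at 0)" for b i
      by (cases b) (simp_all add: has_derivative_component)
    have dC: "(?C k i j has_derivative ?C k i j) (at 0)"
      by (intro has_derivative_diff has_derivative_add dif)
    have "((\<lambda>w. (- 2 * inverse (1 + w \<bullet> w)) * ?C k i j w) has_derivative
       (\<lambda>v. (- 2 * inverse (1 + (0::real^'n) \<bullet> 0)) * ?C k i j v
          + (- 2 * - (2 * ((0::real^'n) \<bullet> v) / (1 + (0::real^'n) \<bullet> 0)\<^sup>2)) * ?C k i j 0)) (at 0)"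
      by (intro has_derivative_mult has_derivative_mult_right has_derivative_inverse_quadratic dC)
    then show "((\<lambda>w. - 2 * inverse (1 + w \<bullet> w) * ?C k i j w) has_derivative (\<lambda>v. - 2 * ?C k i j v)) (at 0)"
      by simp
  qed
  have "ricci G 0 $ i $ j = 4 * (real CARD('n) - 1) * (if i = j then 1 else 0)" for i j
  proof -
    have "ricci G 0 $ i $ j = (\<Sum>k\<in>UNIV. - 2 * ?C k i j (axis k 1) + 2 * ?C k i k (axis j 1))"
      unfolding ricci_def by (simp add: c0 d)
    also have "\<dots> = (\<Sum>k\<in>(UNIV::'n set). (if i = j then 4 else 0) - (if k = i then (if i = j then 4 else 0) else 0))"
      by (intro sum.cong refl) (auto simp: axis_def)
    also have "\<dots> = 4 * (real CARD('n) - 1) * (if i = j then 1 else 0)"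
      by (simp add: sum_subtractf sum.delta)
    finally show ?thesis .
  qed
  then show "ricci G 0 = (\<chi> i j. 4 * (real CARD('n) - 1) * (if i = j then 1 else 0))"
    by (simp add: vec_eq_iff)
qed

section \<open>Stereographic projection centred at an arbitrary point of the sphere\<close>

locale stereographic_chart =
  fixes pole :: "'a::euclidean_space" and B :: "real ^ 'n::finite \<Rightarrow> 'a" and B_inv :: "'a \<Rightarrow> real ^ 'n"
  assumes norm_pole: "norm pole = 1"
    and linear_B: "linear B" and linear_B_inv: "linear B_inv"
    and norm_B: "\<And>u. norm (B u) = norm u" and B_orth: "\<And>u. B u \<bullet> pole = 0"
    and B_inv_B: "\<And>u. B_inv (B u) = u" and B_B_inv: "\<And>z. z \<bullet> pole = 0 \<Longrightarrow> B (B_inv z) = z"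
begin

text \<open>Inverse stereographic projection from \<open>- pole\<close>, centred at
  \<open>pole\<close>. The usual numerator \<open>2 B u + (1 - u \<bullet> u) pole\<close> over
  \<open>1 + u \<bullet> u\<close> is rearranged so that a single scalar factor has to be
  differentiated.\<close>

definition chart :: "real ^ 'n \<Rightarrow> 'a" where
  "chart u = (2 * inverse (1 + u \<bullet> u)) *\<^sub>R (pole + B u) - pole"

definition chart' :: "real ^ 'n \<Rightarrow> real ^ 'n \<Rightarrow> 'a" where
  "chart' u v = (2 * inverse (1 + u \<bullet> u)) *\<^sub>R B v
     - (4 * (u \<bullet> v) * (inverse (1 + u \<bullet> u))\<^sup>2) *\<^sub>R (pole + B u)"

lemma inner_B: "B u \<bullet> B v = u \<bullet> v"
  unfolding dot_norm[of "B u"] linear_add[OF linear_B, symmetric] norm_B dot_norm[of u] ..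

lemma pole_pole: "pole \<bullet> pole = 1" using norm_pole by (simp add: norm_eq_1)

lemma pole_B: "pole \<bullet> B u = 0" using B_orth[of u] by (simp only: inner_commute)

lemma pos: "1 + u \<bullet> u > (0::real)" for u :: "real ^ 'n"
  by (rule add_pos_nonneg[OF zero_less_one inner_ge_zero])

lemma inner_pole_B: "(pole + B u) \<bullet> (pole + B u) = 1 + u \<bullet> u"
  by (simp add: inner_add_left inner_add_right pole_pole inner_B B_orth pole_B)

lemma chart_pole: "chart u \<bullet> pole = 2 * inverse (1 + u \<bullet> u) - 1"
  by (simp add: chart_def inner_diff_left inner_add_left pole_pole B_orth)

lemma norm_chart: "norm (chart u) = 1"
proof -
  define r where "r = inverse (1 + u \<bullet> u)"
  have r: "r * (1 + u \<bullet> u) = 1" using pos[of u] by (simp add: r_def)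
  have "(pole + B u) \<bullet> pole = 1" "pole \<bullet> (pole + B u) = 1"
    by (simp_all add: inner_add_left inner_add_right pole_pole B_orth pole_B)
  then have "chart u \<bullet> chart u = (2 * r) * (2 * r * (1 + u \<bullet> u)) - 2 * (2 * r) + 1"
    unfolding chart_def r_def[symmetric]
    by (simp only: inner_diff_left inner_diff_right inner_scaleR_left inner_scaleR_right inner_pole_B pole_pole)
       (simp add: algebra_simps)
  also have "\<dots> = 1" using r by (simp add: mult.assoc)
  finally show ?thesis by (simp add: norm_eq_1)
qed

lemma chart_neq: "chart u \<noteq> - pole"
proof
  assume "chart u = - pole"
  then have "chart u \<bullet> pole = -1" using pole_pole by simp
  then show False using chart_pole[of u] pos[of u] by simp
qed

lemma chart_zero: "chart 0 = pole"
  by (simp add: chart_def linear_0[OF linear_B] scaleR_2)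

lemma bounded_linear_B: "bounded_linear B"
  using linear_B linear_conv_bounded_linear by blast

lemma has_derivative_chart: "(chart has_derivative chart' u) (at u)"
proof -
  have "((\<lambda>u. (2 * inverse (1 + u \<bullet> u)) *\<^sub>R (pole + B u) - pole) has_derivative
      (\<lambda>v. ((2 * inverse (1 + u \<bullet> u)) *\<^sub>R (0 + B v) +
        (2 * - (2 * (u \<bullet> v) / (1 + u \<bullet> u)\<^sup>2)) *\<^sub>R (pole + B u)) - 0)) (at u)"
    by (intro has_derivative_diff has_derivative_scaleR has_derivative_add has_derivative_const
        has_derivative_mult_right has_derivative_inverse_quadratic bounded_linear_imp_has_derivative bounded_linear_B)
  moreover have "(\<lambda>v. ((2 * inverse (1 + u \<bullet> u)) *\<^sub>R (0 + B v) +
        (2 * - (2 * (u \<bullet> v) / (1 + u \<bullet> u)\<^sup>2)) *\<^sub>R (pole + B u)) - 0) = chart' u"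
    by (simp add: chart'_def fun_eq_iff divide_inverse power_inverse scaleR_minus_left)
  ultimately show ?thesis unfolding chart_def[abs_def] by metis
qed

text \<open>Stereographic projection is conformal: with \<open>r\<close> the inverse of
  \<open>1 + u \<bullet> u\<close>, the terms in \<open>(u \<bullet> v) * (u \<bullet> w)\<close>
  collect into a multiple of \<open>r * (1 + u \<bullet> u) - 1 = 0\<close>.\<close>

lemma inner_chart': "chart' u v \<bullet> chart' u w = 4 * (inverse (1 + u \<bullet> u))\<^sup>2 * (v \<bullet> w)"
proof -
  define r where "r = inverse (1 + u \<bullet> u)"
  define b where "b = pole + B u"
  have r: "r * (1 + u \<bullet> u) = 1" using pos[of u] by (simp add: r_def)
  have b: "B v \<bullet> b = u \<bullet> v" "b \<bullet> B w = u \<bullet> w" "b \<bullet> b = 1 + u \<bullet> u"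
    unfolding b_def inner_pole_B
    by (simp_all add: inner_add_left inner_add_right B_orth pole_B inner_B inner_commute[of v])
  have "chart' u v \<bullet> chart' u w = ((2 * r) *\<^sub>R B v - (4 * (u \<bullet> v) * r\<^sup>2) *\<^sub>R b) \<bullet>
      ((2 * r) *\<^sub>R B w - (4 * (u \<bullet> w) * r\<^sup>2) *\<^sub>R b)"
    by (simp add: chart'_def r_def b_def)
  also have "\<dots> = 4 * r\<^sup>2 * (v \<bullet> w) + 16 * (u \<bullet> v) * (u \<bullet> w) * r\<^sup>2 * r * (r * (1 + u \<bullet> u) - 1)"
    unfolding inner_diff_left inner_diff_right inner_scaleR_left inner_scaleR_right b inner_B
    by (simp add: algebra_simps power2_eq_square)
  finally show ?thesis using r by (simp add: r_def)
qed

lemma smooth_chart: "smooth_on chart UNIV"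
  unfolding smooth_on_def
proof
  fix k
  have h: "Ck_on k (\<lambda>u::real^'n. (1 + u \<bullet> u) powr (-1)) UNIV"
    by (intro Ck_on_powr Ck_on_add Ck_on_inner Ck_on_const Ck_on_ident open_UNIV pos)
  have "Ck_on k B UNIV" by (rule Ck_on_bounded_linear[OF bounded_linear_B open_UNIV])
  with h have "Ck_on k (\<lambda>u. (2 *\<^sub>R (1 + u \<bullet> u) powr (-1)) *\<^sub>R (pole + B u) - pole) UNIV"
    by (intro Ck_on_diff Ck_on_scaleR Ck_on_add Ck_on_const open_UNIV)
  moreover have "(1 + u \<bullet> u) powr (-1) = inverse (1 + u \<bullet> u)" for u :: "real^'n"
    using pos[of u] by (simp add: powr_minus)
  ultimately show "Ck_on k chart UNIV"
    unfolding chart_def[abs_def] by (simp add: divide_inverse)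
qed

definition chart_inv :: "'a \<Rightarrow> real ^ 'n" where
  "chart_inv \<theta> = inverse (1 + \<theta> \<bullet> pole) *\<^sub>R B_inv (\<theta> - (\<theta> \<bullet> pole) *\<^sub>R pole)"

lemma chart_inv_chart: "chart_inv (chart u) = u"
proof -
  define r where "r = inverse (1 + u \<bullet> u)"
  have r: "r > 0" using pos[of u] by (simp add: r_def)
  have "chart u - (chart u \<bullet> pole) *\<^sub>R pole = (2 * r) *\<^sub>R B u"
    unfolding chart_pole r_def[symmetric] unfolding chart_def r_def[symmetric] by (simp add: algebra_simps)
  then show ?thesis
    unfolding chart_inv_def using r unfolding chart_pole r_def[symmetric]
    by (simp add: linear_scale[OF linear_B_inv] B_inv_B)
qed

lemma chart_chart_inv:
  assumes "norm \<theta> = 1" "\<theta> \<noteq> - pole"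
  shows "chart (chart_inv \<theta>) = \<theta>"
proof -
  define c where "c = \<theta> \<bullet> pole"
  define z where "z = \<theta> - c *\<^sub>R pole"
  have tt: "\<theta> \<bullet> \<theta> = 1" using assms(1) by (simp add: norm_eq_1)
  have "(\<theta> + pole) \<bullet> (\<theta> + pole) = 2 * (1 + c)"
    using tt pole_pole by (simp add: inner_add_left inner_add_right c_def inner_commute)
  moreover have "(\<theta> + pole) \<bullet> (\<theta> + pole) > 0"
    using assms(2) by (simp add: eq_neg_iff_add_eq_0)
  ultimately have c: "1 + c > 0" by simp
  have zo: "z \<bullet> pole = 0" by (simp add: z_def inner_diff_left c_def pole_pole)
  have pc: "pole \<bullet> \<theta> = c" unfolding c_def by (rule inner_commute)
  have zz: "z \<bullet> z = (1 + c) * (1 - c)"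
    using tt pole_pole by (simp add: z_def inner_diff_left inner_diff_right c_def[symmetric] pc algebra_simps)
  have BB: "B_inv z \<bullet> B_inv z = z \<bullet> z" using inner_B[of "B_inv z" "B_inv z"] B_B_inv[OF zo] by simp
  have "chart_inv \<theta> \<bullet> chart_inv \<theta> = inverse (1 + c) * (inverse (1 + c) * ((1 + c) * (1 - c)))"
    unfolding chart_inv_def c_def[symmetric] z_def[symmetric]
    by (simp only: inner_scaleR_left inner_scaleR_right BB zz)
  then have "chart_inv \<theta> \<bullet> chart_inv \<theta> = (1 - c) / (1 + c)"
    using c by (simp add: divide_inverse)
  moreover have "1 + (1 - c) / (1 + c) = 2 / (1 + c)" using c by (simp add: field_simps)
  ultimately have e: "2 * inverse (1 + chart_inv \<theta> \<bullet> chart_inv \<theta>) = 1 + c" by simp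
  have "B (chart_inv \<theta>) = inverse (1 + c) *\<^sub>R z"
    unfolding chart_inv_def c_def[symmetric] z_def[symmetric] by (simp add: linear_scale[OF linear_B] B_B_inv[OF zo])
  then have "chart (chart_inv \<theta>) = (1 + c) *\<^sub>R pole + ((1 + c) * inverse (1 + c)) *\<^sub>R z - pole"
    unfolding chart_def e by (simp only: scaleR_add_right scaleR_scaleR)
  also have "\<dots> = \<theta>" using c by (simp add: z_def scaleR_add_left)
  finally show ?thesis .
qed

lemma continuous_on_chart_inv: "continuous_on {\<theta>. norm \<theta> = 1 \<and> \<theta> \<noteq> - pole} chart_inv"
proof -
  have "1 + \<theta> \<bullet> pole \<noteq> 0" if "norm \<theta> = 1" "\<theta> \<noteq> - pole" for \<theta>
  proof
    assume "1 + \<theta> \<bullet> pole = 0"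
    moreover have "\<theta> \<bullet> \<theta> = 1" using that(1) by (simp add: norm_eq_1)
    ultimately have "(\<theta> + pole) \<bullet> (\<theta> + pole) = 0"
      using pole_pole by (simp add: inner_add_left inner_add_right inner_commute)
    then show False using that(2) by (simp add: eq_neg_iff_add_eq_0)
  qed
  moreover have "bounded_linear B_inv" using linear_B_inv linear_conv_bounded_linear by blast
  ultimately show ?thesis
    unfolding chart_inv_def
    by (intro continuous_on_scaleR continuous_on_inverse bounded_linear.continuous_on[of B_inv]
        continuous_on_add continuous_on_diff continuous_on_inner continuous_on_const continuous_on_id) auto
qed

end

lemma stereographic_chart_exists:
  fixes \<theta> :: "'a::euclidean_space"
  assumes "norm \<theta> = 1" "DIM('a) = CARD('n::finite) + 1"
  obtains B :: "real ^ 'n \<Rightarrow> 'a" and B_inv where "stereographic_chart \<theta> B B_inv"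
proof -
  have "\<theta> \<noteq> 0" using assms(1) by auto
  then have d: "dim (UNIV :: (real ^ 'n) set) = dim {z. \<theta> \<bullet> z = 0}"
    using assms(2) by (simp add: dim_hyperplane)
  obtain f :: "real ^ 'n \<Rightarrow> 'a" and g where fg: "linear f" "linear g" "f ` UNIV = {z. \<theta> \<bullet> z = 0}"
    "\<And>x. x \<in> UNIV \<Longrightarrow> norm (f x) = norm x" "\<And>x. x \<in> UNIV \<Longrightarrow> g (f x) = x"
    "\<And>z. z \<in> {z. \<theta> \<bullet> z = 0} \<Longrightarrow> f (g z) = z"
    by (rule isometries_subspaces[OF subspace_UNIV subspace_hyperplane d]) (rule that; assumption)
  have "f u \<in> {z. \<theta> \<bullet> z = 0}" for u using fg(3) by blast
  then have orth: "f u \<bullet> \<theta> = 0" for u by (simp add: inner_commute)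
  have inv: "f (g z) = z" if "z \<bullet> \<theta> = 0" for z
    using fg(6)[of z] that by (simp add: inner_commute)
  have "stereographic_chart \<theta> f g"
    by (rule stereographic_chart.intro[OF assms(1) fg(1,2)])
       (simp_all only: fg(4,5)[OF UNIV_I] orth inv)
  then show ?thesis by (rule that)
qed

lemma linear_vec_expansion:
  fixes f :: "real ^ 'n \<Rightarrow> 'b::real_vector"
  assumes "linear f"
  shows "f \<xi> = (\<Sum>i\<in>UNIV. \<xi> $ i *\<^sub>R f (axis i 1))"
proof -
  have "f \<xi> = f (\<Sum>i\<in>UNIV. \<xi> $ i *\<^sub>R axis i 1)"
    using basis_expansion[of \<xi>] unfolding scalar_mult_eq_scaleR by metis
  then show ?thesis by (simp add: linear_sum[OF assms] linear_scale[OF assms])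
qed

lemma inner_matrix_vector:
  fixes M :: "real ^ 'k ^ 'k"
  shows "\<xi> \<bullet> (M *v \<xi>) = (\<Sum>i\<in>UNIV. \<Sum>j\<in>UNIV. \<xi> $ i * \<xi> $ j * M $ i $ j)"
  by (simp add: inner_vec_def matrix_vector_mult_def sum_distrib_left mult_ac)

section \<open>The boundary parametrized by its outer normal\<close>

text \<open>The inverse Gauss map is read in stereographic coordinates of the normal. The
  pulled-back metric is then the round one whatever \<open>K\<close> is, and the shape of
  \<open>K\<close> enters through the support function alone.\<close>

locale boundary_chart = stereographic_chart pole B B_inv
  for pole :: "'a::euclidean_space" and B :: "real ^ 'n::finite \<Rightarrow> 'a" and B_inv +
  fixes K :: "'a set" and V :: "'a set" and \<Phi> :: "'a \<Rightarrow> 'a"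
  assumes K: "smooth_convex_body K" and open_V: "open V" and pole_V: "pole \<in> V"
    and smooth_\<Phi>: "smooth_on \<Phi> V"
    and \<Phi>_eq: "\<And>\<eta>. \<eta> \<in> V \<Longrightarrow> norm \<eta> = 1 \<Longrightarrow> inverse_gauss_map K \<eta> = \<Phi> \<eta>"
begin

definition chart_dom :: "(real ^ 'n) set" where "chart_dom = chart -` V"

definition \<phi> :: "real ^ 'n \<Rightarrow> 'a" where "\<phi> u = \<Phi> (chart u)"

definition d\<phi> :: "real ^ 'n \<Rightarrow> real ^ 'n \<Rightarrow> 'a" where
  "d\<phi> u v = frechet_derivative \<Phi> (at (chart u)) (chart' u v)"

lemma open_chart_dom: "open chart_dom"
proof -
  have "continuous_on UNIV chart"
    using smooth_chart Ck_on_imp_continuous_on unfolding smooth_on_def by blast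
  then show ?thesis unfolding chart_dom_def by (rule open_vimage[OF open_V])
qed

lemma zero_chart_dom: "0 \<in> chart_dom" by (simp add: chart_dom_def chart_zero pole_V)

lemma
  assumes "u \<in> chart_dom"
  shows \<phi>_frontier: "\<phi> u \<in> frontier K" and gauss_map_\<phi>: "gauss_map K (\<phi> u) = chart u"
proof -
  have "\<phi> u = inverse_gauss_map K (chart u)"
    using assms \<Phi>_eq[of "chart u"] by (simp add: \<phi>_def chart_dom_def norm_chart)
  then show "\<phi> u \<in> frontier K" "gauss_map K (\<phi> u) = chart u"
    using inverse_gauss_map_frontier[OF K norm_chart] gauss_map_inverse[OF K norm_chart] by simp_all
qed

lemma smooth_\<phi>: "smooth_on \<phi> chart_dom"
  unfolding smooth_on_def
proof
  fix k
  have "Ck_on k \<Phi> V" using smooth_\<Phi> by (simp add: smooth_on_def)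
  moreover have "Ck_on k chart chart_dom"
    using smooth_chart unfolding smooth_on_def by (blast intro: Ck_on_subset)
  moreover have "chart ` chart_dom \<subseteq> V" by (auto simp: chart_dom_def)
  ultimately have "Ck_on k (\<lambda>u. \<Phi> (chart u)) chart_dom"
    using Ck_on_compose[OF open_chart_dom open_V, of chart k \<Phi>] by blast
  then show "Ck_on k \<phi> chart_dom" unfolding \<phi>_def[abs_def] .
qed

lemma \<phi>_has_derivative:
  assumes "u \<in> chart_dom"
  shows "(\<phi> has_derivative d\<phi> u) (at u)"
proof -
  have "Ck_on (Suc 0) \<Phi> V" using smooth_\<Phi> unfolding smooth_on_def by blast
  then have "(\<Phi> has_derivative frechet_derivative \<Phi> (at (chart u))) (at (chart u))"
    by (rule Ck_on_has_derivative) (use assms in \<open>simp add: chart_dom_def\<close>)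
  from diff_chain_at[OF has_derivative_chart this] show ?thesis
    unfolding \<phi>_def[abs_def] d\<phi>_def[abs_def] o_def .
qed

lemma linear_d\<phi>: "u \<in> chart_dom \<Longrightarrow> linear (d\<phi> u)"
  using \<phi>_has_derivative has_derivative_linear by blast

lemma partial_\<phi>: "u \<in> chart_dom \<Longrightarrow> partial i \<phi> u = d\<phi> u (axis i 1)"
  by (rule partial_eq[OF \<phi>_has_derivative])

text \<open>Along the image of a coordinate line the Gauss map undoes \<open>\<phi>\<close> and
  leaves \<open>chart\<close>; the two velocities therefore agree.\<close>

lemma gauss_differential_d\<phi>:
  assumes u: "u \<in> chart_dom"
  shows "gauss_differential K (\<phi> u) (d\<phi> u v) = chart' u v"
proof -
  let ?I = "(\<lambda>s::real. u + s *\<^sub>R v) -` chart_dom"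
  have I: "open ?I" "0 \<in> ?I"
    using u by (auto intro!: open_vimage open_chart_dom continuous_intros)
  have line: "((\<lambda>s. u + s *\<^sub>R v) has_vector_derivative v) (at 0)"
    by (auto intro!: derivative_eq_intros)
  have q: "((\<lambda>s. \<phi> (u + s *\<^sub>R v)) has_vector_derivative d\<phi> u v) (at 0)"
    using has_vector_derivative_compose_within[of \<phi> "d\<phi> u" "\<lambda>s. u + s *\<^sub>R v" 0 UNIV v UNIV]
      \<phi>_has_derivative[OF u] line by simp
  have "((\<lambda>s. gauss_map K (\<phi> (u + s *\<^sub>R v))) has_vector_derivative gauss_differential K (\<phi> u) (d\<phi> u v)) (at 0)"
    using gauss_map_curve[OF K q I] \<phi>_frontier by (auto simp: image_subset_iff)
  moreover have "((\<lambda>s. gauss_map K (\<phi> (u + s *\<^sub>R v))) has_vector_derivative chart' u v) (at 0)"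
  proof (rule has_vector_derivative_transform_within_open[OF _ I])
    show "((\<lambda>s. chart (u + s *\<^sub>R v)) has_vector_derivative chart' u v) (at 0)"
      using has_vector_derivative_compose_within[of chart "chart' u" "\<lambda>s. u + s *\<^sub>R v" 0 UNIV v UNIV]
        has_derivative_chart line by simp
    show "chart (u + s *\<^sub>R v) = gauss_map K (\<phi> (u + s *\<^sub>R v))" if "s \<in> ?I" for s
      using gauss_map_\<phi>[of "u + s *\<^sub>R v"] that by simp
  qed
  ultimately show ?thesis using vector_derivative_unique_at by blast
qed

lemma linear_gauss_differential: "p \<in> frontier K \<Longrightarrow> linear (gauss_differential K p)"
  using gauss_map_has_derivative[OF K] has_derivative_linear by blast

lemma metric_coeff_\<phi>:
  assumes "u \<in> chart_dom"
  shows "metric_coeff (bd_metric K) \<phi> u = round_metric u"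
  unfolding metric_coeff_def bd_metric_def partial_\<phi>[OF assms] gauss_differential_d\<phi>[OF assms]
    inner_chart' round_metric_def
  by (simp add: vec_eq_iff inner_axis_axis)

lemma image_\<phi>: "\<phi> ` chart_dom = frontier K \<inter> gauss_map K -` (V - {- pole})"
proof (intro equalityI subsetI)
  fix z assume "z \<in> \<phi> ` chart_dom"
  then show "z \<in> frontier K \<inter> gauss_map K -` (V - {- pole})"
    using \<phi>_frontier gauss_map_\<phi> chart_neq by (auto simp: chart_dom_def)
next
  fix z assume z: "z \<in> frontier K \<inter> gauss_map K -` (V - {- pole})"
  let ?\<theta> = "gauss_map K z"
  have n: "norm ?\<theta> = 1" using norm_gauss_map[OF K] z by simp
  then have c: "chart (chart_inv ?\<theta>) = ?\<theta>" using chart_chart_inv z by simp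
  then have "\<phi> (chart_inv ?\<theta>) = z"
    using \<Phi>_eq[OF _ n] inverse_gauss_map_gauss[OF K] z by (simp add: \<phi>_def)
  moreover have "chart_inv ?\<theta> \<in> chart_dom" using c z by (simp add: chart_dom_def)
  ultimately show "z \<in> \<phi> ` chart_dom" by (metis image_eqI)
qed

text \<open>\<open>\<phi>\<close> is an immersion since the differential of the Gauss map takes
  \<open>d\<phi> u\<close> to the injective \<open>chart' u\<close>. Its inverse is
  \<open>chart_inv\<close> after the Gauss map, and its image is relatively open as the preimage of
  an open set under the continuous Gauss map.\<close>

lemma local_parametrization_\<phi>: "local_parametrization (frontier K) chart_dom \<phi>"
  unfolding local_parametrization_def
proof (intro conjI ballI open_chart_dom smooth_\<phi>)
  fix u assume u: "u \<in> chart_dom"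
  have "v = 0" if "d\<phi> u v = 0" for v
  proof -
    have "chart' u v = 0"
      using gauss_differential_d\<phi>[OF u, of v] that linear_0[OF linear_gauss_differential[OF \<phi>_frontier[OF u]]]
      by simp
    then show ?thesis using inner_chart'[of u v v] pos[of u] by simp
  qed
  then have "inj (d\<phi> u)"
    by (subst linear_injective_0[OF linear_d\<phi>[OF u]]) blast
  then show "inj (frechet_derivative \<phi> (at u))"
    unfolding frechet_derivative_at[OF \<phi>_has_derivative[OF u]] .
next
  show "openin (top_of_set (frontier K)) (\<phi> ` chart_dom)"
    unfolding image_\<phi>
    by (rule continuous_openin_preimage_gen[OF continuous_on_gauss_map[OF K]]) (simp add: open_delete open_V)
next
  have "homeomorphism chart_dom (\<phi> ` chart_dom) \<phi> (\<lambda>z. chart_inv (gauss_map K z))"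
  proof (rule homeomorphismI)
    show "continuous_on chart_dom \<phi>"
      using smooth_\<phi> Ck_on_imp_continuous_on unfolding smooth_on_def by blast
    have "continuous_on (\<phi> ` chart_dom) (gauss_map K)"
      by (rule continuous_on_subset[OF continuous_on_gauss_map[OF K]]) (simp add: image_\<phi>)
    moreover have "gauss_map K ` \<phi> ` chart_dom \<subseteq> {\<theta>. norm \<theta> = 1 \<and> \<theta> \<noteq> - pole}"
      using norm_chart chart_neq gauss_map_\<phi> by auto
    ultimately show "continuous_on (\<phi> ` chart_dom) (\<lambda>z. chart_inv (gauss_map K z))"
      by (rule continuous_on_compose2[OF continuous_on_chart_inv])
  qed (auto simp: gauss_map_\<phi> chart_inv_chart)
  then show "\<exists>\<psi>. homeomorphism chart_dom (\<phi> ` chart_dom) \<phi> \<psi>" by blast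
qed

text \<open>The functional \<open>chart u\<close> attains its maximum over \<open>K\<close> at
  \<open>\<phi> u\<close>, so its derivative along the boundary vanishes there.\<close>

lemma chart_orth_d\<phi>:
  assumes u: "u \<in> chart_dom"
  shows "chart u \<bullet> d\<phi> u v = 0"
proof -
  have d: "((\<lambda>w. chart u \<bullet> \<phi> w) has_derivative (\<lambda>v. chart u \<bullet> d\<phi> u v)) (at u)"
    by (rule has_derivative_inner_right[OF \<phi>_has_derivative[OF u]])
  have "chart u \<bullet> \<phi> w \<le> chart u \<bullet> \<phi> u" if "w \<in> chart_dom" for w
    using gauss_map_supporting[OF K \<phi>_frontier[OF u], of "\<phi> w"] gauss_map_\<phi>[OF u]
      \<phi>_frontier[OF that] frontier_subset[OF K] by (auto simp: inner_diff_right)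
  then have "eventually (\<lambda>w. chart u \<bullet> \<phi> w \<le> chart u \<bullet> \<phi> u) (at u)"
    unfolding eventually_at_topological using open_chart_dom u by blast
  from has_derivative_local_max[OF d this] show ?thesis by meson
qed

definition H :: "real ^ 'n \<Rightarrow> real" where "H u = chart u \<bullet> \<phi> u"

lemma H_eq_support_fun: "u \<in> chart_dom \<Longrightarrow> H u = support_fun K (chart u)"
  using support_fun_gauss_map[OF K \<phi>_frontier] by (simp add: H_def gauss_map_\<phi>)

lemma H_pos: "u \<in> chart_dom \<Longrightarrow> H u > 0"
  using support_fun_pos[OF K, of "chart u"] norm_chart[of u] H_eq_support_fun[of u]
  by (metis norm_zero zero_neq_one)

text \<open>No \<open>d\<phi>\<close> appears: the gradient of a support function is the boundary
  point. Second derivatives of \<open>H\<close> therefore involve \<open>\<phi>\<close> to first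
  order only.\<close>

lemma H_has_derivative:
  assumes "u \<in> chart_dom"
  shows "(H has_derivative (\<lambda>v. chart' u v \<bullet> \<phi> u)) (at u)"
proof -
  have "(H has_derivative (\<lambda>v. chart u \<bullet> d\<phi> u v + chart' u v \<bullet> \<phi> u)) (at u)"
    unfolding H_def[abs_def] by (rule has_derivative_inner[OF has_derivative_chart \<phi>_has_derivative[OF assms]])
  then show ?thesis by (simp only: chart_orth_d\<phi>[OF assms] add_0)
qed

text \<open>At its centre the chart bends along the normal \<open>pole\<close> alone; paired with
  \<open>\<phi> 0\<close> this yields the term \<open>- 4 * (w \<bullet> v) * H 0\<close>.\<close>

lemma chart'_has_derivative_origin:
  "((\<lambda>u. chart' u v) has_derivative (\<lambda>w. - (4 * (w \<bullet> v)) *\<^sub>R pole)) (at 0)"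
proof -
  have r: "((\<lambda>u::real^'n. inverse (1 + u \<bullet> u)) has_derivative (\<lambda>w. 0)) (at 0)"
    using has_derivative_inverse_quadratic[of 0] by simp
  have r2: "((\<lambda>u::real^'n. (inverse (1 + u \<bullet> u))\<^sup>2) has_derivative (\<lambda>w. 0)) (at 0)"
    using has_derivative_power[OF r, of 2] by simp
  have lin: "((\<lambda>u::real^'n. 4 * (u \<bullet> v)) has_derivative (\<lambda>w. 4 * (w \<bullet> v))) (at 0)"
    by (intro has_derivative_mult_right has_derivative_inner_left has_derivative_ident)
  have c: "((\<lambda>u::real^'n. 4 * (u \<bullet> v) * (inverse (1 + u \<bullet> u))\<^sup>2) has_derivative (\<lambda>w. 4 * (w \<bullet> v))) (at 0)"
    using has_derivative_mult[OF lin r2] by simp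
  have b: "((\<lambda>u. pole + B u) has_derivative B) (at 0)"
    using has_derivative_add[OF has_derivative_const[of pole] bounded_linear_imp_has_derivative[OF bounded_linear_B]]
    by simp
  have 1: "((\<lambda>u::real^'n. (2 * inverse (1 + u \<bullet> u)) *\<^sub>R B v) has_derivative (\<lambda>w. (2 * 0) *\<^sub>R B v)) (at 0)"
    by (intro has_derivative_scaleR_left has_derivative_mult_right r)
  have 2: "((\<lambda>u. (4 * (u \<bullet> v) * (inverse (1 + u \<bullet> u))\<^sup>2) *\<^sub>R (pole + B u)) has_derivative
      (\<lambda>w. (4 * (w \<bullet> v)) *\<^sub>R pole)) (at 0)"
    using has_derivative_scaleR[OF c b] by (simp add: linear_0[OF linear_B])
  show ?thesis
    unfolding chart'_def using has_derivative_diff[OF 1 2] by simp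
qed

lemma chart'_zero: "chart' 0 v = 2 *\<^sub>R B v" by (simp add: chart'_def)

text \<open>At the centre of the chart the gradient terms of \<open>Hess f\<close> and \<open>df \<otimes> df / (n - 1)\<close> cancel and
  the Ricci tensor of the sphere absorbs the second derivative of the chart, so only the second
  fundamental form remains.\<close>

lemma ricci1_origin:
  assumes n: "CARD('n) = n" "n \<ge> 2"
  shows "ricci1 (metric_coeff (bd_metric K) \<phi>) (bd_weight n K \<circ> \<phi>) 0 $ i $ j =
    (real n - 1) * inverse (H 0) * (chart' 0 (axis j 1) \<bullet> d\<phi> 0 (axis i 1))"
proof -
  let ?G = "metric_coeff (bd_metric K) \<phi>" and ?f = "bd_weight n K \<circ> \<phi>"
  let ?m = "real n - 1"
  have m: "?m > 0" using n by simp
  note z = zero_chart_dom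
  define P where "P j u = ?m * (inverse (H u) * (chart' u (axis j 1) \<bullet> \<phi> u))" for j u
  have f_eq: "?f u = ?m * ln (H u)" if "u \<in> chart_dom" for u
    using support_fun_gauss_map[OF K \<phi>_frontier[OF that]] gauss_map_\<phi>[OF that]
    by (simp add: bd_weight_def bd_support_def H_def)
  have pf: "partial j ?f u = P j u" if u: "u \<in> chart_dom" for j u
  proof -
    have "((\<lambda>u. ?m * ln (H u)) has_derivative (\<lambda>v. ?m * (inverse (H u) * (chart' u v \<bullet> \<phi> u)))) (at u)"
      using H_pos[OF u] by (auto intro!: derivative_eq_intros H_has_derivative[OF u] simp: divide_inverse mult_ac)
    from partial_has_derivative_open[OF open_chart_dom u _ this, of ?f j] show ?thesis
      by (simp add: f_eq P_def del: comp_apply)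
  qed
  have h: "H 0 \<noteq> 0" using H_pos[OF z] by simp
  have dP: "partial i (partial j ?f) 0 = ?m * (inverse (H 0) *
        (chart' 0 (axis j 1) \<bullet> d\<phi> 0 (axis i 1) - 4 * (axis i 1 \<bullet> (axis j 1 :: real^'n)) * H 0)
      - inverse (H 0) * (chart' 0 (axis i 1) \<bullet> \<phi> 0) * inverse (H 0) * (chart' 0 (axis j 1) \<bullet> \<phi> 0))"
  proof -
    have i: "((\<lambda>u. inverse (H u)) has_derivative (\<lambda>w. - (inverse (H 0) * (chart' 0 w \<bullet> \<phi> 0) * inverse (H 0)))) (at 0)"
      by (rule Deriv.has_derivative_inverse[OF h H_has_derivative[OF z]])
    have c: "((\<lambda>u. chart' u (axis j 1) \<bullet> \<phi> u) has_derivative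
        (\<lambda>w. chart' 0 (axis j 1) \<bullet> d\<phi> 0 w + - (4 * (w \<bullet> axis j 1)) *\<^sub>R pole \<bullet> \<phi> 0)) (at 0)"
      by (rule has_derivative_inner[OF chart'_has_derivative_origin \<phi>_has_derivative[OF z]])
    have "(P j has_derivative (\<lambda>w. ?m * (inverse (H 0) *
          (chart' 0 (axis j 1) \<bullet> d\<phi> 0 w + - (4 * (w \<bullet> axis j 1)) *\<^sub>R pole \<bullet> \<phi> 0)
        + - (inverse (H 0) * (chart' 0 w \<bullet> \<phi> 0) * inverse (H 0)) * (chart' 0 (axis j 1) \<bullet> \<phi> 0)))) (at 0)"
      unfolding P_def[abs_def] by (intro has_derivative_mult_right has_derivative_mult i c)
    from partial_has_derivative_open[OF open_chart_dom z pf this, of i]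
    show ?thesis by (simp add: H_def chart_zero)
  qed
  have ric: "ricci ?G 0 = (\<chi> i j. 4 * ?m * (if i = j then 1 else 0))"
    unfolding n(1)[symmetric] by (rule ricci_stereographic_origin[OF open_chart_dom z metric_coeff_\<phi>])
  have chr: "christoffel ?G k i j 0 = 0" for k i j
    by (rule christoffel_stereographic_origin[OF open_chart_dom z metric_coeff_\<phi>])
  have "ricci1 ?G ?f 0 $ i $ j = 4 * ?m * (if i = j then 1 else 0) + partial i (partial j ?f) 0
      + P i 0 * P j 0 / ?m"
    unfolding ricci1_def hessian_def ric chr by (simp add: pf[OF z] n(1) del: comp_apply)
  moreover have "P i 0 * P j 0 / ?m = ?m * (inverse (H 0) * (chart' 0 (axis i 1) \<bullet> \<phi> 0) *
      inverse (H 0) * (chart' 0 (axis j 1) \<bullet> \<phi> 0))"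
    unfolding P_def using m by (simp add: mult_ac)
  \<comment> \<open>\<open>d\<close> is the Kronecker delta, \<open>A\<close> the pairing of
    \<open>chart'\<close> with \<open>d\<phi>\<close>, and \<open>q\<close> the product of two first
    derivatives of \<open>ln H\<close>; the terms in \<open>d\<close> cancel because
    \<open>a * h = 1\<close>.\<close>
  moreover have "4 * m * d + m * (a * (A - 4 * d * h) - q) + m * q = m * a * A"
    if "a * h = 1" for m d a A h q :: real
  proof -
    have "a * (A - 4 * d * h) = a * A - 4 * d * (a * h)" by (simp add: algebra_simps)
    then show ?thesis by (simp add: that algebra_simps)
  qed
  moreover have "inverse (H 0) * H 0 = 1" using h by simp
  moreover have "axis i 1 \<bullet> (axis j 1 :: real^'n) = (if i = j then 1 else 0)" by (simp add: inner_axis_axis)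
  ultimately show ?thesis unfolding dP by (simp only:)
qed

text \<open>The left side is Hess h + h g at the tangent vector \<open>w\<close>. Since
  \<open>chart' 0\<close> is twice \<open>B\<close>, both sides of the Ricci bound carry a factor 4;
  dividing by \<open>(n - 1) / h\<close> turns the power -4 of \<open>h\<close> into -3.\<close>

lemma second_fundamental_form_bound:
  assumes n: "CARD('n) = n" "n \<ge> 2"
    and bound: "\<And>\<xi>. \<xi> \<bullet> (ricci1 (metric_coeff (bd_metric K) \<phi>) (bd_weight n K \<circ> \<phi>) 0 *v \<xi>)
        \<ge> (real n - 1) * \<kappa> * exp (- 4 * bd_weight n K (\<phi> 0) / (real n - 1))
            * (\<xi> \<bullet> (metric_coeff (bd_metric K) \<phi> 0 *v \<xi>))"
    and w: "w \<bullet> pole = 0"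
  shows "w \<bullet> frechet_derivative \<Phi> (at pole) w \<ge> \<kappa> / support_fun K pole ^ 3 * (w \<bullet> w)"
proof -
  let ?m = "real n - 1"
  have m: "?m > 0" using n by simp
  note z = zero_chart_dom
  define \<xi> where "\<xi> = B_inv w"
  define h where "h = H 0"
  have h: "h > 0" "h = support_fun K pole"
    using H_pos[OF z] H_eq_support_fun[OF z] by (simp_all add: h_def chart_zero)
  have B\<xi>: "B \<xi> = w" unfolding \<xi>_def by (rule B_B_inv[OF w])
  have \<xi>\<xi>: "\<xi> \<bullet> \<xi> = w \<bullet> w" using inner_B[of \<xi> \<xi>] B\<xi> by simp
  have lc: "linear (chart' 0)" using has_derivative_chart has_derivative_linear by blast
  have "(\<Sum>i\<in>UNIV. \<Sum>j\<in>UNIV. \<xi> $ i * \<xi> $ j * (?m * inverse h * (chart' 0 (axis j 1) \<bullet> d\<phi> 0 (axis i 1)))) =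
      ?m * inverse h * (chart' 0 \<xi> \<bullet> d\<phi> 0 \<xi>)"
    unfolding linear_vec_expansion[OF lc, of \<xi>] linear_vec_expansion[OF linear_d\<phi>[OF z], of \<xi>]
    by (simp add: inner_sum_left inner_sum_right sum_distrib_left mult_ac)
  then have L: "\<xi> \<bullet> (ricci1 (metric_coeff (bd_metric K) \<phi>) (bd_weight n K \<circ> \<phi>) 0 *v \<xi>) =
      ?m * inverse h * (chart' 0 \<xi> \<bullet> d\<phi> 0 \<xi>)"
    unfolding inner_matrix_vector ricci1_origin[OF n] h_def .
  have "(\<Sum>i\<in>UNIV. \<Sum>j\<in>UNIV. \<xi> $ i * \<xi> $ j * round_metric 0 $ i $ j) =
      (\<Sum>i\<in>UNIV. \<Sum>j\<in>UNIV. if i = j then 4 * (\<xi> $ i * \<xi> $ j) else 0)"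
    by (intro sum.cong refl) (simp add: round_metric_def)
  also have "\<dots> = 4 * (\<xi> \<bullet> \<xi>)" by (simp add: sum.delta' inner_vec_def sum_distrib_left)
  finally have R: "\<xi> \<bullet> (metric_coeff (bd_metric K) \<phi> 0 *v \<xi>) = 4 * (w \<bullet> w)"
    unfolding inner_matrix_vector metric_coeff_\<phi>[OF z] \<xi>\<xi> .
  have "bd_weight n K (\<phi> 0) = ?m * ln h"
    using support_fun_gauss_map[OF K \<phi>_frontier[OF z]] gauss_map_\<phi>[OF z]
    by (simp add: bd_weight_def bd_support_def H_def h_def)
  then have "- 4 * bd_weight n K (\<phi> 0) / ?m = - (of_nat 4 * ln h)" using m by simp
  then have E: "exp (- 4 * bd_weight n K (\<phi> 0) / ?m) = inverse (h ^ 4)"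
    using h(1) by (simp only: exp_minus exp_of_nat_mult exp_ln)
  have lF: "linear (frechet_derivative \<Phi> (at pole))"
  proof -
    have "Ck_on (Suc 0) \<Phi> V" using smooth_\<Phi> unfolding smooth_on_def by blast
    then show ?thesis using Ck_on_has_derivative[OF _ pole_V] has_derivative_linear by blast
  qed
  have "chart' 0 \<xi> \<bullet> d\<phi> 0 \<xi> = 4 * (w \<bullet> frechet_derivative \<Phi> (at pole) w)"
    unfolding d\<phi>_def chart'_zero B\<xi> chart_zero by (simp add: linear_scale[OF lF])
  then have *: "?m * \<kappa> * inverse (h ^ 4) * (4 * (w \<bullet> w)) \<le>
      ?m * inverse h * (4 * (w \<bullet> frechet_derivative \<Phi> (at pole) w))"
    using bound[of \<xi>] unfolding L R E by simp
  have "(4 * ?m * inverse h) * (\<kappa> * inverse (h ^ 3) * (w \<bullet> w)) \<le>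
      (4 * ?m * inverse h) * (w \<bullet> frechet_derivative \<Phi> (at pole) w)"
  proof -
    have "a * \<kappa> * inverse (h ^ 4) * (4 * x) = (4 * a * inverse h) * (\<kappa> * inverse (h ^ 3) * x)"
      "a * inverse h * (4 * x) = (4 * a * inverse h) * x" for a x
      by (simp_all add: power3_eq_cube power4_eq_xxxx)
    then show ?thesis using * by (simp only:)
  qed
  then have "\<kappa> * inverse (h ^ 3) * (w \<bullet> w) \<le> w \<bullet> frechet_derivative \<Phi> (at pole) w"
    using m h(1) by (subst (asm) mult_le_cancel_left_pos) simp_all
  then show ?thesis unfolding h(2) by (simp add: divide_inverse)
qed

end

section \<open>Sturm comparison for the Ermakov--Pinney inequality\<close>

text \<open>\<open>A\<close> and \<open>B\<close> are coordinates of \<open>z\<close> and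
  \<open>z'\<close> in a frame rotating with the oscillator, hence constant. The equation is asked
  in the open interval only, because there it will come from a function that is constant
  inside.\<close>

lemma harmonic_oscillator_unique:
  fixes z z' z'' :: "real \<Rightarrow> real"
  assumes "\<And>t. t \<in> {0..b} \<Longrightarrow> (z has_real_derivative z' t) (at t)"
    and "\<And>t. t \<in> {0..b} \<Longrightarrow> (z' has_real_derivative z'' t) (at t)"
    and "\<And>t. t \<in> {0<..<b} \<Longrightarrow> z'' t + z t = 0"
    and t: "t \<in> {0..b}"
  shows "z t = z 0 * cos t + z' 0 * sin t"
proof (cases "t = 0")
  case False
  define A where "A t = z' t * sin t - z t * cos t" for t
  define B where "B t = z' t * cos t + z t * sin t" for t
  have A: "(A has_real_derivative (z'' t + z t) * sin t) (at t)" if "t \<in> {0..b}" for t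
    unfolding A_def
    by (rule derivative_eq_intros assms(1,2)[OF that] refl)+ (simp add: algebra_simps)
  have B: "(B has_real_derivative (z'' t + z t) * cos t) (at t)" if "t \<in> {0..b}" for t
    unfolding B_def
    by (rule derivative_eq_intros assms(1,2)[OF that] refl)+ (simp add: algebra_simps)
  have "continuous_on {0..b} A" "continuous_on {0..b} B"
    using A B by (auto intro!: DERIV_atLeastAtMost_imp_continuous_on)
  moreover have "(A has_real_derivative 0) (at t)" "(B has_real_derivative 0) (at t)"
    if "0 < t" "t < b" for t
    using A[of t] B[of t] assms(3)[of t] that by auto
  ultimately have "A t = A 0" "B t = B 0"
    using DERIV_isconst2[of 0 b A t] DERIV_isconst2[of 0 b B t] t False by auto
  then have "A t = - z 0" "B t = z' 0" unfolding A_def B_def by auto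
  moreover have "z t = B t * sin t - A t * cos t"
  proof -
    have "B t * sin t - A t * cos t = z t * ((sin t)\<^sup>2 + (cos t)\<^sup>2)"
      unfolding A_def B_def by (simp only: power2_eq_square ring_distribs) (simp add: algebra_simps)
    then show ?thesis by simp
  qed
  ultimately show ?thesis by simp
qed simp

text \<open>With \<open>\<tau>\<close> an antiderivative of \<open>1 / h\<^sup>2\<close> and \<open>s\<^sup>2 = \<kappa>\<close>, the functions \<open>h * sin (s * \<tau>)\<close>
  and \<open>h * cos (s * \<tau>)\<close> turn the Ermakov--Pinney operator \<open>h'' + h - \<kappa> / h\<^sup>3\<close> into the linear
  operator \<open>z'' + z\<close>, so that Sturm comparison with \<open>sin\<close> applies.\<close>

lemma ermakov_pinney_rigidity:
  fixes h h' h'' :: "real \<Rightarrow> real"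
  assumes \<kappa>: "\<kappa> > 0" and pos: "\<And>t. h t > 0"
    and dh: "\<And>t. (h has_real_derivative h' t) (at t)"
    and dh': "\<And>t. (h' has_real_derivative h'' t) (at t)"
    and ineq: "\<And>t. h'' t + h t \<ge> \<kappa> / h t ^ 3"
    and T: "0 \<le> T" "T \<le> pi"
    and long: "integral {0..T} (\<lambda>t. 1 / (h t)\<^sup>2) \<ge> pi / sqrt \<kappa>"
  shows "T = pi"
    and "t \<in> {0..pi} \<Longrightarrow>
      (h t)\<^sup>2 = (h 0 * cos t + h' 0 * sin t)\<^sup>2 + \<kappa> / (h 0)\<^sup>2 * (sin t)\<^sup>2"
proof -
  define s where "s = sqrt \<kappa>"
  have s: "s > 0" "s * s = \<kappa>" using \<kappa> by (auto simp: s_def)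
  have h0: "h t \<noteq> 0" for t using pos[of t] by simp
  define f where "f t = 1 / (h t)\<^sup>2" for t
  have cf: "continuous_on X f" for X
    unfolding f_def using dh h0
    by (intro continuous_intros) (auto intro!: DERIV_continuous_on intro: has_field_derivative_at_within)
  \<comment> \<open>Integrating from -1 makes \<open>\<tau>\<close> differentiable from both sides
    at the end point 0; the upper limit \<open>pi + 1\<close> below does the same at
    \<open>pi\<close>.\<close>
  define \<tau> where "\<tau> t = integral {-1..t} f - integral {-1..0} f" for t
  have \<tau>0: "\<tau> 0 = 0" unfolding \<tau>_def by simp
  have \<tau>_eq: "\<tau> t = integral {0..t} f" if "0 \<le> t" for t
    unfolding \<tau>_def
    using Henstock_Kurzweil_Integration.integral_combine[of "-1" 0 t f] that
      integrable_continuous_real[OF cf] by simp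
  have d\<tau>: "(\<tau> has_real_derivative 1 / (h t)\<^sup>2) (at t)" if "t \<in> {0..pi}" for t
  proof -
    have "((\<lambda>t. integral {-1..t} f) has_real_derivative f t) (at t within {-1..pi+1})"
      using that by (intro integral_has_real_derivative cf) auto
    then have "((\<lambda>t. integral {-1..t} f) has_real_derivative f t) (at t)"
      using that at_within_interior[of t "{-1..pi+1}"] by simp
    then show ?thesis unfolding \<tau>_def f_def
      by (auto intro!: derivative_eq_intros)
  qed
  define S where "S t = h t * sin (s * \<tau> t)" for t
  define S' where "S' t = h' t * sin (s * \<tau> t) + s * cos (s * \<tau> t) / h t" for t
  define C where "C t = h t * cos (s * \<tau> t)" for t
  define C' where "C' t = h' t * cos (s * \<tau> t) - s * sin (s * \<tau> t) / h t" for t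
  \<comment> \<open>Differentiating \<open>S\<close> and \<open>C\<close> twice multiplies the sine
    and the cosine by \<open>q\<close>, with no mixed terms: those cancel because the derivative of
    \<open>\<tau>\<close> is \<open>1 / (h t)\<^sup>2\<close>.\<close>
  define q where "q t = h'' t - \<kappa> / h t ^ 3" for t
  have dS: "(S has_real_derivative S' t) (at t)" if "t \<in> {0..pi}" for t
    unfolding S_def S'_def
    by (rule derivative_eq_intros dh d\<tau>[OF that] refl)+ (use h0 in \<open>simp add: field_simps power2_eq_square\<close>)
  have dC: "(C has_real_derivative C' t) (at t)" if "t \<in> {0..pi}" for t
    unfolding C_def C'_def
    by (rule derivative_eq_intros dh d\<tau>[OF that] refl)+ (use h0 in \<open>simp add: field_simps power2_eq_square\<close>)
  have dS': "(S' has_real_derivative q t * sin (s * \<tau> t)) (at t)" if "t \<in> {0..pi}" for t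
    unfolding S'_def q_def s(2)[symmetric]
    by (rule derivative_eq_intros dh dh' d\<tau>[OF that] refl h0)+
       (use h0[of t] in \<open>simp add: field_simps power2_eq_square power3_eq_cube\<close>)
  have dC': "(C' has_real_derivative q t * cos (s * \<tau> t)) (at t)" if "t \<in> {0..pi}" for t
    unfolding C'_def q_def s(2)[symmetric]
    by (rule derivative_eq_intros dh dh' d\<tau>[OF that] refl h0)+
       (use h0[of t] in \<open>simp add: field_simps power2_eq_square power3_eq_cube\<close>)
  have mono: "\<tau> a < \<tau> b" if "0 \<le> a" "a < b" "b \<le> pi" for a b
  proof (rule DERIV_pos_imp_increasing[OF that(2)])
    fix t assume "a \<le> t" "t \<le> b"
    then show "\<exists>y. (\<tau> has_real_derivative y) (at t) \<and> 0 < y"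
      using that d\<tau>[of t] h0[of t] by (intro exI[of _ "1 / (h t)\<^sup>2"]) auto
  qed
  have "continuous_on {0..T} \<tau>"
    using d\<tau> T by (intro DERIV_atLeastAtMost_imp_continuous_on) (meson atLeastAtMost_iff order_trans)
  moreover have "pi / s \<le> \<tau> T" using long T \<tau>_eq[of T] unfolding s_def f_def by simp
  \<comment> \<open>The first positive zero of \<open>S\<close>: up to \<open>T'\<close> the phase
    \<open>s * \<tau>\<close> runs from 0 to \<open>pi\<close>.\<close>
  ultimately obtain T' where T': "0 \<le> T'" "T' \<le> T" "\<tau> T' = pi / s"
    using IVT'[of \<tau> 0 "pi / s" T] \<tau>0 T s by auto
  have "T' \<noteq> 0" using T' \<tau>0 s by auto
  \<comment> \<open>The Wronskian of \<open>S\<close> and \<open>sin\<close>; its derivative is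
    non-negative as long as both sines are.\<close>
  define W where "W t = S' t * sin t - S t * cos t" for t
  have dW: "(W has_real_derivative (q t + h t) * sin (s * \<tau> t) * sin t) (at t)" if "t \<in> {0..pi}" for t
    unfolding W_def
    by (rule derivative_eq_intros dS[OF that] dS'[OF that] refl)+ (simp add: S_def algebra_simps)
  have range: "s * \<tau> t \<ge> 0" "s * \<tau> t \<le> pi" if "t \<in> {0..T'}" for t
  proof -
    have "\<tau> 0 \<le> \<tau> t" "\<tau> t \<le> \<tau> T'"
      using mono[of 0 t] mono[of t T'] that T' T less_le[of 0 t] less_le[of t T'] by auto
    then show "s * \<tau> t \<ge> 0" "s * \<tau> t \<le> pi" using s \<tau>0 T'(3) by (auto simp: field_simps)
  qed
  have W_mono: "W a \<le> W b" if "0 \<le> a" "a \<le> b" "b \<le> T'" for a b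
  proof (rule DERIV_nonneg_imp_nondecreasing[OF that(2)])
    fix t assume t: "a \<le> t" "t \<le> b"
    have "(q t + h t) * sin (s * \<tau> t) * sin t \<ge> 0"
      using range[of t] t that T' T ineq[of t] sin_ge_zero[of "s * \<tau> t"] sin_ge_zero[of t]
      by (intro mult_nonneg_nonneg) (auto simp: q_def)
    then show "\<exists>y. (W has_real_derivative y) (at t) \<and> 0 \<le> y"
      using dW[of t] t that T' T by auto
  qed
  have W0: "W 0 = 0" by (simp add: W_def S_def \<tau>0)
  have sp: "s * \<tau> T' = pi" using T' s by simp
  have WT: "W T' = - (s / h T') * sin T'" by (simp add: W_def S_def S'_def sp)
  \<comment> \<open>\<open>W\<close> grows from 0, but its value at \<open>T'\<close> is a negative
    multiple of \<open>sin T'\<close>; a positive sine is excluded, which pushes \<open>T'\<close>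
    to \<open>pi\<close>.\<close>
  have "sin T' \<le> 0"
  proof -
    have "\<not> (s / h T') * sin T' > 0" using W_mono[of 0 T'] W0 WT T' by simp
    moreover have "s / h T' > 0" using s pos[of T'] by simp
    ultimately show ?thesis by (meson mult_pos_pos not_less)
  qed
  then have "T' = pi"
    using sin_gt_zero[of T'] T' T \<open>T' \<noteq> 0\<close> by force
  then show "T = pi" using T' T by simp
  \<comment> \<open>\<open>W\<close> is monotone and vanishes at both ends of
    \<open>{0..pi}\<close>, so it is constant and the differential inequality is an equality
    inside.\<close>
  have qh: "q t + h t = 0" if "t \<in> {0<..<pi}" for t
  proof -
    have "W u = 0" if "u \<in> {0<..<pi}" for u
      using W_mono[of 0 u] W_mono[of u T'] that WT W0 \<open>T' = pi\<close> by auto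
    then have "(W has_real_derivative 0) (at t)"
      using has_field_derivative_transform_within_open[of "\<lambda>_. 0" 0 t "{0<..<pi}" W] that by auto
    then have "(q t + h t) * sin (s * \<tau> t) * sin t = 0"
      using dW[of t] that DERIV_unique by force
    moreover have "s * \<tau> t > 0" "s * \<tau> t < pi"
      using mono[of 0 t] mono[of t T'] that \<open>T' = pi\<close> sp \<tau>0 s mult_strict_left_mono[of "\<tau> t" "\<tau> T'" s] by auto
    ultimately show ?thesis
      using sin_gt_zero[of "s * \<tau> t"] sin_gt_zero[of t] that by auto
  qed
  assume t: "t \<in> {0..pi}"
  have "S t = S 0 * cos t + S' 0 * sin t"
    using dS dS' qh t by (intro harmonic_oscillator_unique[of pi S S' "\<lambda>t. q t * sin (s * \<tau> t)"])
      (auto simp: S_def simp flip: distrib_right)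
  then have St: "S t = s / h 0 * sin t" by (simp add: S_def S'_def \<tau>0)
  have "C t = C 0 * cos t + C' 0 * sin t"
    using dC dC' qh t by (intro harmonic_oscillator_unique[of pi C C' "\<lambda>t. q t * cos (s * \<tau> t)"])
      (auto simp: C_def simp flip: distrib_right)
  then have Ct: "C t = h 0 * cos t + h' 0 * sin t" by (simp add: C_def C'_def \<tau>0)
  \<comment> \<open>Summing the squares of \<open>C\<close> and \<open>S\<close> eliminates the
    phase \<open>s * \<tau>\<close>.\<close>
  have "(h t)\<^sup>2 = (h t)\<^sup>2 * ((cos (s * \<tau> t))\<^sup>2 + (sin (s * \<tau> t))\<^sup>2)" by simp
  also have "\<dots> = (C t)\<^sup>2 + (S t)\<^sup>2" by (simp only: C_def S_def power_mult_distrib distrib_left)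
  also have "\<dots> = (h 0 * cos t + h' 0 * sin t)\<^sup>2 + \<kappa> / (h 0)\<^sup>2 * (sin t)\<^sup>2"
    unfolding Ct St using s(2) by (simp add: power_mult_distrib power_divide power2_eq_square[of s])
  finally show "(h t)\<^sup>2 = (h 0 * cos t + h' 0 * sin t)\<^sup>2 + \<kappa> / (h 0)\<^sup>2 * (sin t)\<^sup>2" .
qed

section \<open>Great circles\<close>

lemma unit_orthogonal_exists:
  fixes S :: "'a::euclidean_space set"
  assumes "finite S" "card S < DIM('a)"
  obtains u where "norm u = 1" "\<And>y. y \<in> S \<Longrightarrow> y \<bullet> u = 0"
proof -
  have "dim S < DIM('a)" using dim_le_card'[OF assms(1)] assms(2) by simp
  then obtain x where x: "x \<noteq> 0" "\<And>y. y \<in> span S \<Longrightarrow> orthogonal x y"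
    using orthogonal_to_subspace_exists by metis
  show ?thesis
  proof (rule that[of "x /\<^sub>R norm x"])
    show "norm (x /\<^sub>R norm x) = 1" using x(1) by simp
    show "y \<bullet> (x /\<^sub>R norm x) = 0" if "y \<in> S" for y
      using x(2)[OF span_base[OF that]] by (simp add: orthogonal_def inner_commute)
  qed
qed

lemma unit_vector_polar:
  fixes e \<theta> :: "'a::euclidean_space"
  assumes e: "norm e = 1" and \<theta>: "norm \<theta> = 1" and dim: "DIM('a) \<ge> 2"
  obtains w t where "norm w = 1" "e \<bullet> w = 0" "0 \<le> t" "t \<le> pi" "\<theta> = cos t *\<^sub>R e + sin t *\<^sub>R w"
proof -
  define c where "c = e \<bullet> \<theta>"
  define z where "z = \<theta> - c *\<^sub>R e"
  have ee: "e \<bullet> e = 1" "\<theta> \<bullet> \<theta> = 1" using e \<theta> by (simp_all add: norm_eq_1)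
  have ez: "e \<bullet> z = 0" by (simp add: z_def inner_diff_right ee c_def)
  have c: "\<bar>c\<bar> \<le> 1" using Cauchy_Schwarz_ineq2[of e \<theta>] e \<theta> by (simp add: c_def)
  have "\<theta> \<bullet> e = c" by (simp add: c_def inner_commute)
  then have "z \<bullet> z = 1 - c * c"
    by (simp add: z_def inner_diff_right inner_diff_left ee c_def[symmetric])
  then have nz: "norm z = sqrt (1 - c\<^sup>2)" by (simp add: norm_eq_sqrt_inner power2_eq_square)
  have t: "0 \<le> arccos c" "arccos c \<le> pi" "cos (arccos c) = c" "sin (arccos c) = norm z"
    using arccos_lbound[of c] arccos_ubound[of c] cos_arccos[of c] sin_arccos_abs[OF c] nz c by (simp_all add: abs_le_iff)
  show ?thesis
  proof (cases "z = 0")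
    case True
    \<comment> \<open>For \<open>\<theta>\<close> equal to \<open>e\<close> or \<open>- e\<close>,
      any unit vector orthogonal to \<open>e\<close> will do.\<close>
    obtain w where w: "norm w = 1" "\<And>y. y \<in> {e} \<Longrightarrow> y \<bullet> w = 0"
      by (rule unit_orthogonal_exists[of "{e}"]) (use dim in auto)
    then show ?thesis
      using t True by (intro that[of w "arccos c"]) (auto simp: z_def)
  next
    case False
    then show ?thesis
      using t ez by (intro that[of "z /\<^sub>R norm z" "arccos c"]) (auto simp: z_def)
  qed
qed

section \<open>The curvature inequality along great circles\<close>

text \<open>The curvature assumption freed of charts. It is phrased with a local extension
  \<open>\<Phi>\<close> because the inverse Gauss map is meaningful on unit vectors only; for
  \<open>w\<close> tangent to the sphere the quadratic form is independent of the extension.\<close>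

locale pinched_body =
  fixes K :: "'a::euclidean_space set" and \<kappa> :: real
  assumes K: "smooth_convex_body K" and \<kappa>: "\<kappa> > 0"
    and bound: "\<And>p. norm p = 1 \<Longrightarrow> \<exists>V \<Phi>. open V \<and> p \<in> V \<and> smooth_on \<Phi> V \<and>
      (\<forall>\<eta>\<in>V. norm \<eta> = 1 \<longrightarrow> inverse_gauss_map K \<eta> = \<Phi> \<eta>) \<and>
      (\<forall>w. w \<bullet> p = 0 \<longrightarrow> w \<bullet> frechet_derivative \<Phi> (at p) w \<ge> \<kappa> / support_fun K p ^ 3 * (w \<bullet> w))"

locale great_circle = pinched_body K \<kappa> for K :: "'a::euclidean_space set" and \<kappa> +
  fixes e w :: 'a
  assumes e: "norm e = 1" and w: "norm w = 1" and ew: "e \<bullet> w = 0"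
begin

definition circle :: "real \<Rightarrow> 'a" where "circle t = cos t *\<^sub>R e + sin t *\<^sub>R w"
definition circle' :: "real \<Rightarrow> 'a" where "circle' t = - sin t *\<^sub>R e + cos t *\<^sub>R w"
definition \<gamma> :: "real \<Rightarrow> 'a" where "\<gamma> t = inverse_gauss_map K (circle t)"
definition \<gamma>' :: "real \<Rightarrow> 'a" where "\<gamma>' t = frechet_derivative \<gamma> (at t) 1"
definition h :: "real \<Rightarrow> real" where "h t = support_fun K (circle t)"
definition h' :: "real \<Rightarrow> real" where "h' t = circle' t \<bullet> \<gamma> t"
text \<open>The derivative of \<open>h'\<close>, because the acceleration of the circle is
  \<open>- circle\<close>. Thus \<open>h'' + h\<close> is the quadratic form bounded in
  \<open>pinched_body\<close>, taken at the unit vector \<open>circle'\<close>.\<close>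

definition h'' :: "real \<Rightarrow> real" where "h'' t = circle' t \<bullet> \<gamma>' t - h t"

lemma orthonormal: "e \<bullet> e = 1" "w \<bullet> w = 1" "e \<bullet> w = 0" "w \<bullet> e = 0"
  using e w ew by (simp_all add: norm_eq_1 inner_commute)

lemma norm_circle: "norm (circle t) = 1"
proof -
  have "circle t \<bullet> circle t = 1"
    unfolding circle_def by (simp only: inner_add_left inner_add_right inner_scaleR_left inner_scaleR_right orthonormal) simp
  then show ?thesis by (simp add: norm_eq_1)
qed

lemma inner_circle': "circle' t \<bullet> circle' t = 1" "circle' t \<bullet> circle t = 0"
proof -
  have "circle' t \<bullet> circle' t = (sin t)\<^sup>2 + (cos t)\<^sup>2"
    unfolding circle'_def power2_eq_square by (simp only: inner_add_left inner_add_right inner_scaleR_left inner_scaleR_right orthonormal) simp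
  then show "circle' t \<bullet> circle' t = 1" by simp
  show "circle' t \<bullet> circle t = 0"
    unfolding circle'_def circle_def by (simp add: inner_add_left inner_add_right inner_diff_left inner_diff_right orthonormal)
qed

lemma circle_deriv: "(circle has_vector_derivative circle' t) (at t)"
  unfolding circle_def[abs_def] circle'_def
  by (auto intro!: derivative_eq_intros simp: has_real_derivative_iff_has_vector_derivative[symmetric])

lemma circle'_deriv: "(circle' has_vector_derivative - circle t) (at t)"
  unfolding circle_def circle'_def[abs_def]
  by (auto intro!: derivative_eq_intros simp: has_real_derivative_iff_has_vector_derivative[symmetric])

lemma continuous_circle': "continuous_on S circle'"
  unfolding circle'_def[abs_def] by (intro continuous_intros)

lemma continuous_circle: "continuous_on S circle"
  unfolding circle_def[abs_def] by (intro continuous_intros)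

lemma Ck_circle: "Ck_on (Suc 0) circle I" if "open I"
proof (rule Ck_on_SucI[OF that])
  show "(circle has_derivative (\<lambda>s. s *\<^sub>R circle' t)) (at t)" for t
    using circle_deriv unfolding has_vector_derivative_def .
  show "Ck_on 0 (\<lambda>t. v *\<^sub>R circle' t) I" for v
    by (auto intro: continuous_on_scaleR continuous_on_const continuous_circle')
qed

lemma \<gamma>_local:
  obtains I where "open I" "t \<in> I" "Ck_on (Suc 0) \<gamma> I"
    "circle' t \<bullet> \<gamma>' t \<ge> \<kappa> / h t ^ 3"
proof -
  obtain V \<Phi> where V: "open V" "circle t \<in> V" "smooth_on \<Phi> V"
    "\<forall>\<eta>\<in>V. norm \<eta> = 1 \<longrightarrow> inverse_gauss_map K \<eta> = \<Phi> \<eta>"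
    "\<forall>w. w \<bullet> circle t = 0 \<longrightarrow> w \<bullet> frechet_derivative \<Phi> (at (circle t)) w \<ge> \<kappa> / support_fun K (circle t) ^ 3 * (w \<bullet> w)"
    using bound[OF norm_circle[of t]] by blast
  define I where "I = circle -` V"
  have I: "open I" unfolding I_def by (rule open_vimage[OF V(1) continuous_circle])
  have t: "t \<in> I" using V(2) by (simp add: I_def)
  have Ck\<Phi>: "Ck_on (Suc 0) \<Phi> V" using V(3) unfolding smooth_on_def by blast
  have IV: "circle ` I \<subseteq> V" by (auto simp: I_def)
  have eq: "\<Phi> (circle s) = \<gamma> s" if "s \<in> I" for s
    using V(4) that norm_circle[of s] by (simp add: \<gamma>_def I_def)
  have "Ck_on (Suc 0) (\<lambda>s. \<Phi> (circle s)) I"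
    by (rule Ck_on_compose[OF I V(1) IV Ck\<Phi> Ck_circle[OF I]])
  then have Ck: "Ck_on (Suc 0) \<gamma> I"
    using Ck_on_cong[OF I, of "\<lambda>s. \<Phi> (circle s)" \<gamma> "Suc 0"] eq by blast
  have "((\<lambda>s. \<Phi> (circle s)) has_vector_derivative frechet_derivative \<Phi> (at (circle t)) (circle' t)) (at t)"
    by (rule has_vector_derivative_compose_within[of _ _ _ _ UNIV _ UNIV])
       (use Ck_on_has_derivative[OF Ck\<Phi> V(2)] circle_deriv in auto)
  then have "(\<gamma> has_vector_derivative frechet_derivative \<Phi> (at (circle t)) (circle' t)) (at t)"
    by (rule has_vector_derivative_transform_within_open[OF _ I t eq])
  then have "(\<gamma> has_derivative (\<lambda>s. s *\<^sub>R frechet_derivative \<Phi> (at (circle t)) (circle' t))) (at t)"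
    unfolding has_vector_derivative_def .
  from frechet_derivative_at[OF this] have "\<gamma>' t = frechet_derivative \<Phi> (at (circle t)) (circle' t)"
    unfolding \<gamma>'_def by (metis scaleR_one)
  then have "circle' t \<bullet> \<gamma>' t \<ge> \<kappa> / h t ^ 3"
    using V(5)[rule_format, OF inner_circle'(2)[of t]] by (simp add: inner_circle' h_def)
  then show ?thesis using that I t Ck by blast
qed

lemma Ck_\<gamma>: "Ck_on (Suc 0) \<gamma> UNIV"
  by (rule Ck_on_locally) (metis \<gamma>_local)

lemma \<gamma>_deriv: "(\<gamma> has_vector_derivative \<gamma>' t) (at t)"
proof -
  have d: "(\<gamma> has_derivative frechet_derivative \<gamma> (at t)) (at t)"
    by (rule Ck_on_has_derivative[OF Ck_\<gamma> UNIV_I])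
  have "frechet_derivative \<gamma> (at t) s = s *\<^sub>R \<gamma>' t" for s
    using linear_scale[OF has_derivative_linear[OF d], of s 1] by (simp add: \<gamma>'_def)
  then have "frechet_derivative \<gamma> (at t) = (\<lambda>s. s *\<^sub>R \<gamma>' t)" by blast
  with d show ?thesis unfolding has_vector_derivative_def by metis
qed

lemma continuous_\<gamma>': "continuous_on S \<gamma>'"
proof (rule continuous_on_subset)
  show "continuous_on UNIV \<gamma>'" using Ck_\<gamma> unfolding \<gamma>'_def[abs_def] by simp
qed simp

lemma \<gamma>_frontier: "\<gamma> t \<in> frontier K" and gauss_map_\<gamma>: "gauss_map K (\<gamma> t) = circle t"
  unfolding \<gamma>_def by (simp_all add: inverse_gauss_map_frontier[OF K] gauss_map_inverse[OF K] norm_circle)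

lemma h_eq: "h t = circle t \<bullet> \<gamma> t"
  unfolding h_def \<gamma>_def by (rule support_fun_eq_inner[OF K norm_circle])

lemma h_pos: "h t > 0"
proof -
  have "circle t \<noteq> 0" using norm_circle[of t] by auto
  then show ?thesis unfolding h_def by (rule support_fun_pos[OF K])
qed

lemma circle_\<gamma>': "circle t \<bullet> \<gamma>' t = 0"
proof -
  have "((\<lambda>s. circle t \<bullet> \<gamma> s) has_derivative (\<lambda>s. circle t \<bullet> (s *\<^sub>R \<gamma>' t))) (at t)"
    using \<gamma>_deriv unfolding has_vector_derivative_def by (rule has_derivative_inner_right)
  moreover have "circle t \<bullet> \<gamma> s \<le> circle t \<bullet> \<gamma> t" for s
    using support_fun_ge[OF K, of "\<gamma> s" "circle t"] \<gamma>_frontier frontier_subset[OF K] h_eq[of t]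
    by (auto simp: h_def)
  ultimately have "(\<lambda>s. circle t \<bullet> (s *\<^sub>R \<gamma>' t)) = (\<lambda>s. 0)"
    by (intro has_derivative_local_max always_eventually) auto
  from fun_cong[OF this, of 1] show ?thesis by simp
qed

lemma h_deriv: "(h has_real_derivative h' t) (at t)"
proof -
  have "((\<lambda>s. circle s \<bullet> \<gamma> s) has_vector_derivative circle t \<bullet> \<gamma>' t + circle' t \<bullet> \<gamma> t) (at t)"
    by (rule bounded_bilinear.has_vector_derivative[OF bounded_bilinear_inner circle_deriv \<gamma>_deriv])
  then show ?thesis
    unfolding has_real_derivative_iff_has_vector_derivative h_eq[abs_def] h'_def
    by (simp add: circle_\<gamma>')
qed

lemma h'_deriv: "(h' has_real_derivative h'' t) (at t)"
proof -
  have "((\<lambda>s. circle' s \<bullet> \<gamma> s) has_vector_derivative circle' t \<bullet> \<gamma>' t + - circle t \<bullet> \<gamma> t) (at t)"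
    by (rule bounded_bilinear.has_vector_derivative[OF bounded_bilinear_inner circle'_deriv \<gamma>_deriv])
  then show ?thesis
    unfolding has_real_derivative_iff_has_vector_derivative h'_def[abs_def] h''_def h_eq
    by simp
qed

lemma h_ineq: "h'' t + h t \<ge> \<kappa> / h t ^ 3"
  using \<gamma>_local[of t] by (auto simp: h''_def)

text \<open>The Gauss map carries \<open>\<gamma>\<close> to a great circle of unit speed, so the
  conformal factor, the power -4 of \<open>h\<close>, makes the speed of \<open>\<gamma>\<close>
  equal to \<open>1 / (h t)\<^sup>2\<close>. The factor \<open>T\<close> in \<open>c\<close>
  rescales the arc to the unit interval.\<close>

lemma riem_dist_le:
  assumes n: "n \<ge> 2" and T: "0 \<le> T"
  shows "riem_dist (frontier K) (bd_conformal_metric n K) (\<gamma> 0) (\<gamma> T) \<le> integral {0..T} (\<lambda>t. 1 / (h t)\<^sup>2)"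
proof -
  let ?g = "bd_conformal_metric n K"
  define f where "f t = 1 / (h t)\<^sup>2" for t
  define c where "c s = \<gamma> (T * s)" for s
  have hn: "h t \<noteq> 0" for t using h_pos[of t] by simp
  have cf: "continuous_on S f" for S
  proof -
    have "isCont h t" for t using h_deriv by (rule DERIV_isCont)
    then show ?thesis unfolding f_def
      by (intro continuous_intros continuous_at_imp_continuous_on ballI) (simp_all add: hn)
  qed
  have line: "((\<lambda>s. T * s) has_vector_derivative T) (at s)" for s
    by (auto intro!: derivative_eq_intros simp: has_real_derivative_iff_has_vector_derivative[symmetric])
  have dc: "(c has_vector_derivative T *\<^sub>R \<gamma>' (T * s)) (at s)" for s
    using vector_diff_chain_at[OF line \<gamma>_deriv] unfolding c_def[abs_def] o_def .
  have cc: "continuous_on S (\<lambda>s. T *\<^sub>R \<gamma>' (T * s))" for S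
    by (intro continuous_on_scaleR continuous_on_const continuous_on_compose2[OF continuous_\<gamma>'[of UNIV]]
        continuous_on_mult continuous_on_id) auto
  have sp: "speed ?g c s = T * f (T * s)" for s
  proof -
    let ?D = "gauss_differential K (c s) (T *\<^sub>R \<gamma>' (T * s))"
    have "((\<lambda>s. gauss_map K (c s)) has_vector_derivative ?D) (at s)"
      by (rule gauss_map_curve[OF K dc open_UNIV UNIV_I]) (auto simp: c_def \<gamma>_frontier)
    moreover have "((\<lambda>s. gauss_map K (c s)) has_vector_derivative T *\<^sub>R circle' (T * s)) (at s)"
      using vector_diff_chain_at[OF line circle_deriv] unfolding c_def o_def gauss_map_\<gamma> .
    ultimately have D: "?D = T *\<^sub>R circle' (T * s)" by (rule vector_derivative_unique_at)
    have "bd_weight n K (c s) = (real n - 1) * ln (h (T * s))"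
      by (simp add: bd_weight_def bd_support_def c_def gauss_map_\<gamma> h_def)
    then have "- 4 * bd_weight n K (c s) / (real n - 1) = - (of_nat 4 * ln (h (T * s)))" using n by simp
    then have E: "exp (- 4 * bd_weight n K (c s) / (real n - 1)) = inverse (h (T * s) ^ 4)"
      using h_pos by (simp only: exp_minus exp_of_nat_mult exp_ln)
    have "speed ?g c s = sqrt (inverse (h (T * s) ^ 4) * (T * T))"
      unfolding speed_def vector_derivative_at[OF dc] bd_conformal_metric_def bd_metric_def D E
      by (simp add: inner_circle')
    also have "inverse (h (T * s) ^ 4) * (T * T) = (T * f (T * s))\<^sup>2"
      unfolding f_def by (simp add: power2_eq_square power4_eq_xxxx divide_inverse)
    also have "sqrt \<dots> = T * f (T * s)"
      using T by (simp add: f_def)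
    finally show ?thesis .
  qed
  \<comment> \<open>The change of variables is made through an antiderivative, which includes the
    degenerate case \<open>T = 0\<close>.\<close>
  have I: "(speed ?g c has_integral integral {0..T} f) {0..1}"
  proof -
    let ?A = "\<lambda>x. integral {0..x} f"
    have "((?A \<circ> (\<lambda>s. T * s)) has_real_derivative f (T * s) * T) (at s within {0..1})" if s: "s \<in> {0..1}" for s
    proof (rule DERIV_image_chain)
      have Ts: "(\<lambda>s. T * s) ` {0..1} \<subseteq> {0..T}" using T by (auto simp: mult_left_le)
      moreover have "(?A has_real_derivative f (T * s)) (at (T * s) within {0..T})"
        using s Ts by (intro integral_has_real_derivative cf) blast
      ultimately show "(?A has_real_derivative f (T * s)) (at (T * s) within (\<lambda>s. T * s) ` {0..1})"
        using has_field_derivative_subset by blast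
      show "((\<lambda>s. T * s) has_real_derivative T) (at s within {0..1})"
        by (auto intro!: derivative_eq_intros)
    qed
    then have v: "((?A \<circ> (\<lambda>s. T * s)) has_vector_derivative f (T * s) * T) (at s within {0..1})"
      if "s \<in> {0..1}" for s
      using that unfolding has_real_derivative_iff_has_vector_derivative by blast
    have "((\<lambda>s. f (T * s) * T) has_integral (?A \<circ> (\<lambda>s. T * s)) 1 - (?A \<circ> (\<lambda>s. T * s)) 0) {0..1}"
      by (rule fundamental_theorem_of_calculus[OF zero_le_one v])
    moreover have "speed ?g c = (\<lambda>s. f (T * s) * T)" using sp by (simp add: fun_eq_iff)
    ultimately show ?thesis by simp
  qed
  have "c C1_differentiable_on {0..1}"
    unfolding C1_differentiable_on_def
  proof (intro exI conjI ballI)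
    show "(c has_vector_derivative T *\<^sub>R \<gamma>' (T * s)) (at s)" for s by (rule dc)
    show "continuous_on {0..1} (\<lambda>s. T *\<^sub>R \<gamma>' (T * s))" by (rule cc)
  qed
  then have "c piecewise_C1_differentiable_on {0..1}"
    by (rule C1_differentiable_imp_piecewise)
  moreover have "path_image c \<subseteq> frontier K" using \<gamma>_frontier by (auto simp: path_image_def c_def)
  moreover have "pathstart c = \<gamma> 0" "pathfinish c = \<gamma> T" by (simp_all add: pathstart_def pathfinish_def c_def)
  moreover have "speed ?g c integrable_on {0..1}" using I by (rule has_integral_integrable)
  moreover have "integral {0..1} (speed ?g c) = integral {0..T} f" using I by (rule integral_unique)
  ultimately have "\<exists>\<gamma>1. integral {0..T} f = integral {0..1} (speed ?g \<gamma>1) \<and>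
       \<gamma>1 piecewise_C1_differentiable_on {0..1} \<and> path_image \<gamma>1 \<subseteq> frontier K \<and>
       pathstart \<gamma>1 = \<gamma> 0 \<and> pathfinish \<gamma>1 = \<gamma> T \<and> speed ?g \<gamma>1 integrable_on {0..1}"
    by (intro exI[of _ c] conjI) simp_all
  then have mem: "integral {0..T} f \<in> {integral {0..1} (speed ?g \<gamma>1) | \<gamma>1.
       \<gamma>1 piecewise_C1_differentiable_on {0..1} \<and> path_image \<gamma>1 \<subseteq> frontier K \<and>
       pathstart \<gamma>1 = \<gamma> 0 \<and> pathfinish \<gamma>1 = \<gamma> T \<and> speed ?g \<gamma>1 integrable_on {0..1}}" (is "_ \<in> ?S")
    by (rule CollectI)
  \<comment> \<open>A real \<open>Inf\<close> is a lower bound of its set only if the set is bounded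
    below.\<close>
  have "0 \<le> integral {0..1} (speed ?g \<gamma>1)" if "speed ?g \<gamma>1 integrable_on {0..1}" for \<gamma>1
    using that by (intro integral_nonneg) (auto simp: speed_def bd_conformal_metric_def bd_metric_def)
  then have "bdd_below ?S" by (intro bdd_belowI[of ?S 0]) auto
  then have "Inf ?S \<le> integral {0..T} f" by (rule cInf_lower[OF mem])
  then show ?thesis unfolding riem_dist_def f_def[abs_def] .
qed

text \<open>The arc is at least as long as the distance between its ends, so maximal distance
  supplies the integral bound of the rigidity statement.\<close>

lemma maximal_distance:
  assumes n: "n \<ge> 2" and T: "0 \<le> T" "T \<le> pi"
    and dist: "riem_dist (frontier K) (bd_conformal_metric n K) (\<gamma> 0) (\<gamma> T) = pi / sqrt \<kappa>"
  shows "T = pi"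
    and "t \<in> {0..pi} \<Longrightarrow> (h t)\<^sup>2 = (h 0 * cos t + h' 0 * sin t)\<^sup>2 + \<kappa> / (h 0)\<^sup>2 * (sin t)\<^sup>2"
proof -
  have "integral {0..T} (\<lambda>t. 1 / (h t)\<^sup>2) \<ge> pi / sqrt \<kappa>"
    using riem_dist_le[OF n T(1)] dist by simp
  note * = ermakov_pinney_rigidity[of \<kappa> h h' h'' T, OF \<kappa> h_pos h_deriv h'_deriv h_ineq T this]
  show "T = pi" by (rule *(1))
  show "(h t)\<^sup>2 = (h 0 * cos t + h' 0 * sin t)\<^sup>2 + \<kappa> / (h 0)\<^sup>2 * (sin t)\<^sup>2" if "t \<in> {0..pi}"
    by (rule *(2)[OF that])
qed

text \<open>At \<open>t = 0\<close> the formula gives \<open>h' = 0\<close> and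
  \<open>h * h'' = \<beta> - A\<close> with \<open>A = h\<^sup>2\<close>. Hence
  \<open>\<beta> = h * (h'' + h)\<close>, and the curvature inequality bounds this below by
  \<open>\<kappa> / A\<close>.\<close>

lemma quadratic_circle_bound:
  assumes q: "\<And>t. (h t)\<^sup>2 = A * (cos t)\<^sup>2 + \<beta> * (sin t)\<^sup>2"
  shows "A * \<beta> \<ge> \<kappa>"
proof -
  have hh': "h t * h' t = (\<beta> - A) * (sin t * cos t)" for t
  proof -
    have "((\<lambda>t. (h t)\<^sup>2) has_real_derivative 2 * (h t * h' t)) (at t)"
      by (auto intro!: derivative_eq_intros h_deriv)
    moreover have "((\<lambda>t. A * (cos t)\<^sup>2 + \<beta> * (sin t)\<^sup>2) has_real_derivative 2 * ((\<beta> - A) * (sin t * cos t))) (at t)"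
      by (auto intro!: derivative_eq_intros simp: algebra_simps)
    ultimately show ?thesis unfolding q[abs_def] using DERIV_unique by fastforce
  qed
  have "h 0 * h' 0 = 0" using hh'[of 0] by simp
  then have h'0: "h' 0 = 0" using h_pos[of 0] by simp
  have "((\<lambda>t. h t * h' t) has_real_derivative h 0 * h'' 0) (at 0)"
    by (rule derivative_eq_intros h_deriv h'_deriv refl)+ (simp add: h'0)
  moreover have "((\<lambda>t. (\<beta> - A) * (sin t * cos t)) has_real_derivative \<beta> - A) (at 0)"
    by (rule derivative_eq_intros refl)+ simp
  ultimately have "h 0 * h'' 0 = \<beta> - A" unfolding hh'[abs_def] using DERIV_unique by blast
  moreover have A: "(h 0)\<^sup>2 = A" using q[of 0] by simp
  ultimately have "\<beta> = h 0 * (h'' 0 + h 0)" by (simp add: algebra_simps power2_eq_square)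
  moreover have "h 0 * (h'' 0 + h 0) \<ge> h 0 * (\<kappa> / h 0 ^ 3)"
    using h_pos[of 0] h_ineq[of 0] by (intro mult_left_mono) auto
  ultimately have "A * \<beta> \<ge> A * (h 0 * (\<kappa> / h 0 ^ 3))"
    using A by (intro mult_left_mono) auto
  moreover have "A * (h 0 * (\<kappa> / h 0 ^ 3)) = \<kappa>"
    unfolding A[symmetric] using h_pos[of 0] by (simp add: power2_eq_square power3_eq_cube)
  ultimately show ?thesis by simp
qed

end

section \<open>The support function of a body with two points at maximal distance\<close>

context pinched_body
begin

lemma great_circle: "norm e = 1 \<Longrightarrow> norm w = 1 \<Longrightarrow> e \<bullet> w = 0 \<Longrightarrow> great_circle K \<kappa> e w"
  by unfold_locales

text \<open>The derivative of the support function at \<open>gauss_map K x\<close> is the inner product with \<open>x\<close>, so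
  the initial data of all the Ermakov--Pinney equations along the meridians through that point
  are read off \<open>x\<close>.\<close>

lemma support_fun_squared:
  assumes n: "n \<ge> 2" and dim: "DIM('a) \<ge> 2" and x: "x \<in> frontier K" and y: "y \<in> frontier K"
    and dist: "riem_dist (frontier K) (bd_conformal_metric n K) x y = pi / sqrt \<kappa>"
    and \<theta>: "norm \<theta> = 1"
  defines "e \<equiv> gauss_map K x"
  shows "(support_fun K \<theta>)\<^sup>2 = (\<theta> \<bullet> x)\<^sup>2 + \<kappa> / (support_fun K e)\<^sup>2 * (1 - (\<theta> \<bullet> e)\<^sup>2)"
proof -
  have e: "norm e = 1" unfolding e_def by (rule norm_gauss_map[OF K x])
  have ey: "norm (gauss_map K y) = 1" by (rule norm_gauss_map[OF K y])
  have xe: "inverse_gauss_map K e = x" unfolding e_def by (rule inverse_gauss_map_gauss[OF K x])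
  obtain w0 T where w0: "norm w0 = 1" "e \<bullet> w0 = 0" "0 \<le> T" "T \<le> pi"
    "gauss_map K y = cos T *\<^sub>R e + sin T *\<^sub>R w0"
    by (rule unit_vector_polar[OF e ey dim])
  interpret c0: great_circle K \<kappa> e w0 by (rule great_circle[OF e w0(1,2)])
  have "c0.\<gamma> 0 = x" "c0.\<gamma> T = y"
    using inverse_gauss_map_gauss[OF K y]
    by (simp_all add: c0.\<gamma>_def c0.circle_def xe w0(5)[symmetric])
  \<comment> \<open>The arc joining the two normals is long enough only if it is half a great
    circle; so the normal at \<open>y\<close> is \<open>- e\<close>.\<close>
  then have "T = pi" using c0.maximal_distance(1)[OF n w0(3,4)] dist by simp
  then have y_eq: "y = inverse_gauss_map K (- e)"
    using inverse_gauss_map_gauss[OF K y] w0(5) by simp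
  obtain w t where w: "norm w = 1" "e \<bullet> w = 0" "0 \<le> t" "t \<le> pi" "\<theta> = cos t *\<^sub>R e + sin t *\<^sub>R w"
    by (rule unit_vector_polar[OF e \<theta> dim])
  interpret c: great_circle K \<kappa> e w by (rule great_circle[OF e w(1,2)])
  \<comment> \<open>Every half circle starting at \<open>e\<close> ends at \<open>- e\<close>, so
    the equality case is available in every direction \<open>w\<close>.\<close>
  have g: "c.\<gamma> 0 = x" "c.\<gamma> pi = y" by (simp_all add: c.\<gamma>_def c.circle_def xe y_eq)
  have "(c.h t)\<^sup>2 = (c.h 0 * cos t + c.h' 0 * sin t)\<^sup>2 + \<kappa> / (c.h 0)\<^sup>2 * (sin t)\<^sup>2"
  proof (rule c.maximal_distance(2)[OF n pi_ge_zero order_refl])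
    show "riem_dist (frontier K) (bd_conformal_metric n K) (c.\<gamma> 0) (c.\<gamma> pi) = pi / sqrt \<kappa>"
      unfolding g by (rule dist)
    show "t \<in> {0..pi}" using w(3,4) by simp
  qed
  moreover have "c.circle t = \<theta>" "c.circle 0 = e"
    unfolding c.circle_def by (rule w(5)[symmetric]) simp
  then have "c.h t = support_fun K \<theta>" "c.h 0 = support_fun K e"
    unfolding c.h_def by simp_all
  moreover have "c.h 0 * cos t + c.h' 0 * sin t = \<theta> \<bullet> x"
    unfolding c.h_eq c.h'_def g(1) w(5)
    by (simp add: c.circle_def c.circle'_def inner_add_left mult.commute)
  moreover have "1 - (\<theta> \<bullet> e)\<^sup>2 = (sin t)\<^sup>2"
    unfolding w(5) by (simp add: inner_add_left c.orthonormal sin_squared_eq)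
  ultimately show ?thesis by (simp only:)
qed

text \<open>If \<open>x\<close> had a component \<open>a \<noteq> 0\<close> orthogonal to its normal \<open>e\<close>, then the great circles that
  are orthogonal to the meridian in direction \<open>a\<close> and meet it close to \<open>e\<close> on the side of \<open>-a\<close>
  would violate the differential inequality.\<close>

lemma maximal_point_on_axis:
  assumes dim: "DIM('a) \<ge> 3" and e: "norm e = 1" and x: "x \<bullet> e = support_fun K e"
    and sq: "\<And>\<theta>. norm \<theta> = 1 \<Longrightarrow>
      (support_fun K \<theta>)\<^sup>2 = (\<theta> \<bullet> x)\<^sup>2 + \<kappa> / (support_fun K e)\<^sup>2 * (1 - (\<theta> \<bullet> e)\<^sup>2)"
  shows "x = support_fun K e *\<^sub>R e"
proof (rule ccontr)
  define h0 where "h0 = support_fun K e"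
  assume "x \<noteq> support_fun K e *\<^sub>R e"
  define a where "a = x - h0 *\<^sub>R e"
  have "a \<noteq> 0" using \<open>x \<noteq> _\<close> by (simp add: a_def h0_def)
  define \<alpha> where "\<alpha> = norm a"
  define w where "w = a /\<^sub>R \<alpha>"
  have ee: "e \<bullet> e = 1" using e by (simp add: norm_eq_1)
  have \<alpha>: "\<alpha> > 0" using \<open>a \<noteq> 0\<close> by (simp add: \<alpha>_def)
  have "e \<noteq> 0" using e by auto
  then have h0: "h0 > 0" unfolding h0_def by (rule support_fun_pos[OF K])
  have "a \<bullet> e = 0" using x by (simp add: a_def inner_diff_left ee h0_def)
  then have we: "w \<bullet> e = 0" "e \<bullet> w = 0" by (simp_all add: w_def inner_commute)
  have nw: "norm w = 1" using \<open>a \<noteq> 0\<close> by (simp add: w_def \<alpha>_def)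
  then have ww: "w \<bullet> w = 1" by (simp add: norm_eq_1)
  have x_eq: "x = h0 *\<^sub>R e + \<alpha> *\<^sub>R w" using \<alpha> by (simp add: w_def a_def)
  obtain u where u: "norm u = 1" "\<And>y. y \<in> {e, w} \<Longrightarrow> y \<bullet> u = 0"
  proof (rule unit_orthogonal_exists[of "{e, w}"])
    show "card {e, w} < DIM('a)" using dim card_insert_le_m1[of 2 "{w}" e] by simp
  qed auto
  have eu: "e \<bullet> u = 0" "w \<bullet> u = 0" "u \<bullet> u = 1" using u by (simp_all add: norm_eq_1)
  then have ue: "u \<bullet> e = 0" "u \<bullet> w = 0" by (simp_all only: inner_commute[of u e] inner_commute[of u w])
  define \<beta> where "\<beta> = \<kappa> / h0\<^sup>2"
  \<comment> \<open>The squared support function on the meridian in direction \<open>w\<close>, at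
    angle \<open>s\<close> from \<open>e\<close>.\<close>
  define f where "f s = (h0 * cos s + \<alpha> * sin s)\<^sup>2 + \<beta> * (sin s)\<^sup>2" for s
  have fmin: "f s \<ge> h0\<^sup>2" for s
  proof -
    define \<theta>1 where "\<theta>1 = cos s *\<^sub>R e + sin s *\<^sub>R w"
    have i1: "\<theta>1 \<bullet> e = cos s" "\<theta>1 \<bullet> x = h0 * cos s + \<alpha> * sin s" "u \<bullet> x = 0" "\<theta>1 \<bullet> u = 0"
      by (simp_all add: \<theta>1_def x_eq inner_add_left inner_add_right ee ww we eu ue)
    have "\<theta>1 \<bullet> \<theta>1 = 1"
      unfolding \<theta>1_def by (simp add: inner_add_left inner_add_right ee ww we)
    then have n1: "norm \<theta>1 = 1" by (simp add: norm_eq_1)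
    \<comment> \<open>This circle leaves the meridian in a direction \<open>u\<close> orthogonal to
      both \<open>e\<close> and \<open>x\<close>, so the squared support function along it has no
      mixed term.\<close>
    interpret c: great_circle K \<kappa> \<theta>1 u by (rule great_circle[OF n1 u(1) i1(4)])
    have "(c.h t)\<^sup>2 = f s * (cos t)\<^sup>2 + \<beta> * (sin t)\<^sup>2" for t
    proof -
      have "(c.h t)\<^sup>2 = (c.circle t \<bullet> x)\<^sup>2 + \<beta> * (1 - (c.circle t \<bullet> e)\<^sup>2)"
        unfolding c.h_def \<beta>_def h0_def by (rule sq[OF c.norm_circle])
      also have "c.circle t \<bullet> x = cos t * (h0 * cos s + \<alpha> * sin s)"
        by (simp add: c.circle_def inner_add_left i1)
      also have "c.circle t \<bullet> e = cos t * cos s"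
        by (simp add: c.circle_def inner_add_left i1 eu ue)
      also have "1 - (cos t * cos s)\<^sup>2 = (cos t)\<^sup>2 * (sin s)\<^sup>2 + (sin t)\<^sup>2"
        unfolding power_mult_distrib cos_squared_eq[of s] by (simp add: algebra_simps sin_squared_eq)
      finally show ?thesis
        unfolding f_def power_mult_distrib[of "cos t" "h0 * cos s + \<alpha> * sin s"] by (simp add: algebra_simps)
    qed
    then have "f s * \<beta> \<ge> \<kappa>" by (rule c.quadratic_circle_bound)
    then have "f s * \<kappa> \<ge> \<kappa> * h0\<^sup>2" using h0 by (simp add: \<beta>_def field_simps)
    then show ?thesis using \<kappa> by (simp add: mult.commute)
  qed
  \<comment> \<open>The slope at 0 is positive because \<open>\<alpha>\<close> is, whereas
    \<open>fmin\<close> makes 0 a minimum of \<open>f\<close>.\<close>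
  have "(f has_real_derivative 2 * h0 * \<alpha>) (at 0)"
    unfolding f_def by (rule derivative_eq_intros refl)+ simp
  moreover have "f 0 = h0\<^sup>2" by (simp add: f_def)
  ultimately have "2 * h0 * \<alpha> = 0"
    using DERIV_local_min[of f "2 * h0 * \<alpha>" 0 1] fmin by simp
  then show False using h0 \<alpha> by simp
qed

end

section \<open>Ellipsoids of revolution\<close>

text \<open>Self-adjoint, with factor \<open>a\<close> along the axis and \<open>b\<close> across
  it; hence the image of the unit ball has support function
  \<open>norm (axial_map e a b \<theta>)\<close>.\<close>

definition axial_map :: "'a::euclidean_space \<Rightarrow> real \<Rightarrow> real \<Rightarrow> 'a \<Rightarrow> 'a" where
  "axial_map e a b z = a *\<^sub>R (z \<bullet> e) *\<^sub>R e + b *\<^sub>R proj_perp e z"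

lemma axial_map:
  assumes e: "norm e = 1"
  shows linear_axial_map: "linear (axial_map e a b)"
    and inner_axial_map: "\<theta> \<bullet> axial_map e a b z = axial_map e a b \<theta> \<bullet> z"
    and norm_axial_map: "(norm (axial_map e a b z))\<^sup>2 = a\<^sup>2 * (z \<bullet> e)\<^sup>2 + b\<^sup>2 * (norm (proj_perp e z))\<^sup>2"
    and norm_proj_perp: "(norm (proj_perp e z))\<^sup>2 = (norm z)\<^sup>2 - (z \<bullet> e)\<^sup>2"
proof -
  have ee: "e \<bullet> e = 1" using e by (simp add: norm_eq_1)
  show "linear (axial_map e a b)"
    by (rule linearI) (simp_all add: axial_map_def proj_perp_def inner_add_left algebra_simps)
  show "\<theta> \<bullet> axial_map e a b z = axial_map e a b \<theta> \<bullet> z"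
    unfolding axial_map_def proj_perp_def
    by (simp add: inner_add_left inner_add_right inner_diff_left inner_diff_right inner_commute[of e z] algebra_simps)
  have pe: "proj_perp e z \<bullet> e = 0" "e \<bullet> proj_perp e z = 0"
    by (simp_all add: proj_perp_def inner_diff_left inner_diff_right ee inner_commute)
  show "(norm (axial_map e a b z))\<^sup>2 = a\<^sup>2 * (z \<bullet> e)\<^sup>2 + b\<^sup>2 * (norm (proj_perp e z))\<^sup>2"
    unfolding power2_norm_eq_inner axial_map_def
    by (simp add: inner_add_left inner_add_right pe ee power2_eq_square mult_ac)
  show "(norm (proj_perp e z))\<^sup>2 = (norm z)\<^sup>2 - (z \<bullet> e)\<^sup>2"
    unfolding power2_norm_eq_inner proj_perp_def
    by (simp add: inner_diff_left inner_diff_right ee inner_commute[of e z] power2_eq_square)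
qed

lemma bij_axial_map:
  assumes e: "norm e = 1" and ab: "a > 0" "b > 0"
  shows "bij (axial_map e a b)"
proof -
  have "z = 0" if "axial_map e a b z = 0" for z
  proof -
    have "a\<^sup>2 * (z \<bullet> e)\<^sup>2 + b\<^sup>2 * (norm (proj_perp e z))\<^sup>2 = 0"
      using norm_axial_map[OF e, of a b z] that by simp
    then have "z \<bullet> e = 0" "proj_perp e z = 0"
      using ab by (auto simp: add_nonneg_eq_0_iff)
    then show ?thesis by (simp add: proj_perp_def)
  qed
  then have "inj (axial_map e a b)"
    by (subst linear_injective_0[OF linear_axial_map[OF e]]) blast
  then show ?thesis
    using linear_injective_imp_surjective[OF linear_axial_map[OF e]] by (simp add: bij_def)
qed

lemma support_fun_axial_ball:
  assumes e: "norm e = 1" and "norm u \<le> 1"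
  shows "\<theta> \<bullet> axial_map e a b u \<le> norm (axial_map e a b \<theta>)"
proof -
  have "\<theta> \<bullet> axial_map e a b u \<le> norm (axial_map e a b \<theta>) * norm u"
    unfolding inner_axial_map[OF e] by (rule norm_cauchy_schwarz)
  also have "\<dots> \<le> norm (axial_map e a b \<theta>)" using assms(2) by (intro mult_left_le) auto
  finally show ?thesis .
qed

text \<open>A compact convex set is determined by its support function: a point of one set outside
  the other would be strictly separated from it by a unit vector, where the two support functions
  would then differ.\<close>

lemma eq_axial_ellipsoid:
  assumes e: "norm e = 1" and ab: "a > 0" "b > 0"
    and K: "compact K" "convex K" "K \<noteq> {}"
    and h: "\<And>\<theta>. norm \<theta> = 1 \<Longrightarrow> support_fun K \<theta> = norm (axial_map e a b \<theta>)"
    and max: "\<And>\<theta>. norm \<theta> = 1 \<Longrightarrow> \<exists>p\<in>K. support_fun K \<theta> = \<theta> \<bullet> p"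
    and le: "\<And>\<theta> z. z \<in> K \<Longrightarrow> \<theta> \<bullet> z \<le> support_fun K \<theta>"
  shows "K = axial_map e a b ` cball 0 1"
proof -
  let ?L = "axial_map e a b"
  let ?C = "?L ` cball 0 1"
  have C: "compact ?C" "convex ?C"
    using linear_axial_map[OF e, of a b] linear_conv_bounded_linear[of ?L]
    by (auto intro!: compact_continuous_image linear_continuous_on intro: convex_linear_image)
  \<comment> \<open>The separating functional is normalised because the support functions are
    compared on unit vectors.\<close>
  have sep: "\<exists>\<theta>. norm \<theta> = 1 \<and> (\<forall>y\<in>S. \<theta> \<bullet> y < \<theta> \<bullet> z)"
    if S: "closed S" "convex S" "S \<noteq> {}" "z \<notin> S" for S :: "'a set" and z
  proof -
    obtain c d where cd: "c \<bullet> z < d" "\<forall>y\<in>S. d < c \<bullet> y"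
      using separating_hyperplane_closed_point[OF S(2,1,4)] by blast
    then have "c \<noteq> 0" using S(3) by force
    have "(- c /\<^sub>R norm c) \<bullet> y < (- c /\<^sub>R norm c) \<bullet> z" if "y \<in> S" for y
    proof -
      have "c \<bullet> z < c \<bullet> y" using cd that by fastforce
      then show ?thesis using \<open>c \<noteq> 0\<close> by (simp add: mult_strict_left_mono)
    qed
    moreover have "norm (- c /\<^sub>R norm c) = 1" using \<open>c \<noteq> 0\<close> by simp
    ultimately show ?thesis by blast
  qed
  show ?thesis
  proof (intro equalityI subsetI)
    fix z assume z: "z \<in> K"
    show "z \<in> ?C"
    proof (rule ccontr)
      assume "z \<notin> ?C"
      then obtain \<theta> where \<theta>: "norm \<theta> = 1" "\<forall>y\<in>?C. \<theta> \<bullet> y < \<theta> \<bullet> z"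
        using sep[of ?C z] C compact_imp_closed by auto
      \<comment> \<open>\<open>?v /\<^sub>R norm ?v\<close> is the point of the ball whose image
        maximises the product with \<open>\<theta>\<close>; for \<open>?v = 0\<close> it is the zero
        vector, which also lies in the ball.\<close>
      let ?v = "?L \<theta>"
      have "?L (?v /\<^sub>R norm ?v) \<in> ?C"
        by (intro imageI) (cases "?v = 0"; simp)
      then have "\<theta> \<bullet> ?L (?v /\<^sub>R norm ?v) < \<theta> \<bullet> z" using \<theta>(2) by blast
      moreover have "\<theta> \<bullet> ?L (?v /\<^sub>R norm ?v) = norm ?v"
        unfolding inner_axial_map[OF e]
        by (cases "?v = 0") (simp_all add: dot_square_norm power2_eq_square)
      ultimately show False using le[OF z, of \<theta>] h[OF \<theta>(1)] by simp
    qed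
  next
    fix z assume "z \<in> ?C"
    then obtain u where u: "z = ?L u" "norm u \<le> 1" by auto
    show "z \<in> K"
    proof (rule ccontr)
      assume "z \<notin> K"
      then obtain \<theta> where \<theta>: "norm \<theta> = 1" "\<forall>y\<in>K. \<theta> \<bullet> y < \<theta> \<bullet> z"
        using sep[of K z] K compact_imp_closed by auto
      obtain p where "p \<in> K" "support_fun K \<theta> = \<theta> \<bullet> p" using max[OF \<theta>(1)] by blast
      then have "norm (?L \<theta>) < \<theta> \<bullet> z" using \<theta> h by auto
      then show False using support_fun_axial_ball[OF e u(2), of \<theta> a b] u(1) by simp
    qed
  qed
qed

text \<open>An isometry fixing \<open>e\<close> preserves the product with \<open>e\<close>, hence
  commutes with the axial map, and it preserves the unit ball.\<close>

lemma rotationally_symmetric_axial_ellipsoid: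
  assumes e: "norm e = 1"
  shows "rotationally_symmetric (axial_map e a b ` cball 0 1)"
  unfolding rotationally_symmetric_def
proof (rule exI[of _ 0], rule exI[of _ e], intro conjI allI impI e)
  fix R :: "'a \<Rightarrow> 'a" assume R: "orthogonal_transformation R \<and> R e = e"
  let ?L = "axial_map e a b"
  have lin: "linear R" using R orthogonal_transformation_linear by blast
  have Re: "R z \<bullet> e = z \<bullet> e" for z
    using R unfolding orthogonal_transformation_def by metis
  have comm: "R (?L z) = ?L (R z)" for z
    using R by (simp add: axial_map_def proj_perp_def Re linear_add[OF lin] linear_diff[OF lin] linear_scale[OF lin])
  have "R ` ?L ` cball 0 1 = ?L ` R ` cball 0 1" by (simp add: image_image comm)
  also have "R ` cball 0 1 = cball 0 1"
    using image_orthogonal_transformation_cball[of R 0 1] R linear_0[OF lin] by simp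
  finally show "(\<lambda>z. 0 + R (z - 0)) ` ?L ` cball 0 1 = ?L ` cball 0 1" by simp
qed

theorem theorem4p5:
  fixes n :: nat and K :: "'a::euclidean_space set" and \<kappa> :: real and x y :: 'a
  assumes n_ge: "n \<ge> 2"
    and dim_ambient: "DIM('a) = n + 1"
    and dim_chart: "CARD('n::finite) = n"
    and K: "smooth_convex_body K"
    and \<kappa>: "\<kappa> > 0"
    and ricci_bound: "\<And>(U :: (real ^ 'n) set) \<phi> u \<xi>.
      local_parametrization (frontier K) U \<phi> \<Longrightarrow> u \<in> U \<Longrightarrow>
        \<xi> \<bullet> (ricci1 (metric_coeff (bd_metric K) \<phi>) (bd_weight n K \<circ> \<phi>) u *v \<xi>)
        \<ge> (real n - 1) * \<kappa> * exp (- 4 * bd_weight n K (\<phi> u) / (real n - 1))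
            * (\<xi> \<bullet> (metric_coeff (bd_metric K) \<phi> u *v \<xi>))"
    and x: "x \<in> frontier K" and y: "y \<in> frontier K"
    and max_dist: "riem_dist (frontier K) (bd_conformal_metric n K) x y = pi / sqrt \<kappa>"
  shows "ellipsoid K \<and> rotationally_symmetric K \<and>
    (let e = gauss_map K x in
      \<forall>\<theta>\<in>sphere 0 1.
        (support_fun K \<theta>)\<^sup>2 =
          (support_fun K e)\<^sup>2 * (\<theta> \<bullet> e)\<^sup>2
          + \<kappa> / (support_fun K e)\<^sup>2 * (norm (proj_perp e \<theta>))\<^sup>2)"
proof -
  define e where "e = gauss_map K x"
  have e: "norm e = 1" unfolding e_def by (rule norm_gauss_map[OF K x])
  define a where "a = support_fun K e"
  \<comment> \<open>The square root of the coefficient of the projection term; \<open>a\<close> and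
    \<open>b\<close> will be the semi-axes.\<close>
  define b where "b = sqrt \<kappa> / a"
  have "e \<noteq> 0" using e by auto
  then have a: "a > 0" unfolding a_def by (rule support_fun_pos[OF K])
  have b: "b > 0" "b\<^sup>2 = \<kappa> / a\<^sup>2" using \<kappa> a by (simp_all add: b_def power_divide)
  have body: "pinched_body K \<kappa>"
  proof (rule pinched_body.intro[OF K \<kappa>])
    fix p :: 'a assume p: "norm p = 1"
    obtain V \<Phi> where V: "open V" "p \<in> V" "smooth_on \<Phi> V"
      "\<And>\<eta>. \<eta> \<in> V \<Longrightarrow> norm \<eta> = 1 \<Longrightarrow> inverse_gauss_map K \<eta> = \<Phi> \<eta>"
      by (rule inverse_gauss_map_locally_smooth[OF K p]) (rule that; assumption)
    have "DIM('a) = CARD('n) + 1" using dim_ambient dim_chart by simp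
    from stereographic_chart_exists[OF p this]
    obtain B :: "real ^ 'n \<Rightarrow> 'a" and B_inv where "stereographic_chart p B B_inv" by blast
    then interpret boundary_chart p B B_inv K V \<Phi>
      by (rule boundary_chart.intro) (rule boundary_chart_axioms.intro[OF K V])
    \<comment> \<open>The Ricci bound is evaluated at the centre of the stereographic chart about
      \<open>p\<close>, so \<open>p\<close> varies over the sphere and the chart with it.\<close>
    have "w \<bullet> frechet_derivative \<Phi> (at p) w \<ge> \<kappa> / support_fun K p ^ 3 * (w \<bullet> w)" if "w \<bullet> p = 0" for w
      by (rule second_fundamental_form_bound[OF dim_chart n_ge _ that])
         (rule ricci_bound[OF local_parametrization_\<phi> zero_chart_dom])
    then show "\<exists>V \<Phi>. open V \<and> p \<in> V \<and> smooth_on \<Phi> V \<and>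
      (\<forall>\<eta>\<in>V. norm \<eta> = 1 \<longrightarrow> inverse_gauss_map K \<eta> = \<Phi> \<eta>) \<and>
      (\<forall>w. w \<bullet> p = 0 \<longrightarrow> w \<bullet> frechet_derivative \<Phi> (at p) w \<ge> \<kappa> / support_fun K p ^ 3 * (w \<bullet> w))"
      using V by blast
  qed
  have dims: "DIM('a) \<ge> 2" "DIM('a) \<ge> 3" using dim_ambient n_ge by simp_all
  have sq: "(support_fun K \<theta>)\<^sup>2 = (\<theta> \<bullet> x)\<^sup>2 + \<kappa> / a\<^sup>2 * (1 - (\<theta> \<bullet> e)\<^sup>2)" if "norm \<theta> = 1" for \<theta>
    unfolding a_def e_def
    by (rule pinched_body.support_fun_squared[OF body n_ge dims(1) x y max_dist that])
  have "x \<bullet> e = support_fun K e"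
    using support_fun_gauss_map[OF K x] by (simp add: e_def inner_commute)
  then have x_eq: "x = a *\<^sub>R e"
    unfolding a_def by (rule pinched_body.maximal_point_on_axis[OF body dims(2) e _ sq[unfolded a_def]])
  \<comment> \<open>With \<open>x\<close> on the axis, \<open>\<theta> \<bullet> x\<close> becomes
    \<open>a * (\<theta> \<bullet> e)\<close> and the quadratic form is diagonal.\<close>
  have main: "(support_fun K \<theta>)\<^sup>2 = a\<^sup>2 * (\<theta> \<bullet> e)\<^sup>2 + \<kappa> / a\<^sup>2 * (norm (proj_perp e \<theta>))\<^sup>2"
    if "norm \<theta> = 1" for \<theta>
    using sq[OF that] that unfolding x_eq norm_proj_perp[OF e] by (simp add: power_mult_distrib)
  have K_eq: "K = axial_map e a b ` cball 0 1"
  proof (rule eq_axial_ellipsoid[OF e a b(1) compact_K[OF K] convex_K[OF K]])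
    show "K \<noteq> {}" using zero_interior[OF K] interior_subset by blast
    show "support_fun K \<theta> = norm (axial_map e a b \<theta>)" if "norm \<theta> = 1" for \<theta>
    proof (rule power2_eq_imp_eq)
      show "(support_fun K \<theta>)\<^sup>2 = (norm (axial_map e a b \<theta>))\<^sup>2"
        unfolding norm_axial_map[OF e] b(2) by (rule main[OF that])
      have "\<theta> \<noteq> 0" using that by auto
      then show "0 \<le> support_fun K \<theta>" using support_fun_pos[OF K] less_imp_le by blast
    qed simp
    show "\<exists>p\<in>K. support_fun K \<theta> = \<theta> \<bullet> p" if "norm \<theta> = 1" for \<theta>
      using support_fun_eq_inner[OF K that] inverse_gauss_map_frontier[OF K that] frontier_subset[OF K] by blast
    show "\<theta> \<bullet> z \<le> support_fun K \<theta>" if "z \<in> K" for \<theta> z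
      by (rule support_fun_ge[OF K that])
  qed
  have "ellipsoid K"
    unfolding ellipsoid_def
    by (intro exI[of _ 0] exI[of _ "axial_map e a b"] conjI linear_axial_map[OF e] bij_axial_map[OF e a b(1)])
       (simp add: K_eq[symmetric])
  moreover have "rotationally_symmetric K"
    by (subst K_eq) (rule rotationally_symmetric_axial_ellipsoid[OF e])
  ultimately show ?thesis
    unfolding Let_def e_def[symmetric] a_def[symmetric] using main by simp
qed

end
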